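(* Let $n\ge 2$, let $\mathcal S$ be a compact $(n-1)$-dimensional $C^1$ manifold in $\mathbb R^n$ (with or without boundary), and let $\Omega\subset\mathbb R^n$ be an open and bounded set with $\mathcal S\subset\Omega$. Then $$\lim_{s\to 1/2^-}(1-2s)\,s\text{-}\mathrm{Area}(\mathcal S,\Omega)=\mathrm{Area}(\mathcal S).$$
   Context: For $x,y\in\mathbb R^n$, $[x,y]=\{(1-\lambda)x+\lambda y : \lambda\in[0,1]\}$ is the straight-line segment joining $x$ and $y$. $\mathcal X(\mathcal S)\subset\mathbb R^n\times\mathbb R^n$ is the set of all pairs $(x,y)$ such that: (i) $[x,y]$ has only finitely many points in common with $\mathcal S$; (ii) $[x,y]$ is not tangent to $\mathcal S$ (at any common point); (iii) the number of points that $[x,y]$ has in common with $\mathcal S$, not counting the end points $x$ and $y$, is odd. For $0<s<1/2$, $$s\text{-}\mathrm{Area}(\mathcal S,\Omega):=\frac12\int_{\mathcal X(\mathcal S)}\kappa(x,y)\,\max\{\chi_\Omega(x),\chi_\Omega(y)\}\,dx\,dy,\qquad \kappa(x,y)=\frac{1}{\alpha_{n-1}}\frac{1}{|x-y|^{n+2s}},$$ where $\alpha_{n-1}$ is the volume of the unit ball in $\mathbb R^{n-1}$ and $\chi_\Omega$ is the characteristic function of $\Omega$. $\mathrm{Area}(\mathcal S)=\mathcal H^{n-1}(\mathcal S)$ is the $(n-1)$-dimensional Hausdorff measure of $\mathcal S$. *)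

theory Defs
  imports "HOL-Analysis.Analysis"
begin

section \<open>Hausdorff measure\<close>

text \<open>
  The normalisation by the volume of the unit ball makes the \<open>d\<close>-dimensional measure agree with
  Lebesgue measure on \<open>d\<close>-dimensional Euclidean space.  Boundedness of the covering sets has to
  be required explicitly because \<^const>\<open>diameter\<close> is real-valued (and meaningless on unbounded
  sets); empty covering sets are singled out so that the case \<open>d = 0\<close> yields counting measure.
\<close>

definition hausdorff_content :: "nat \<Rightarrow> real \<Rightarrow> 'a::metric_space set \<Rightarrow> ennreal" where
  "hausdorff_content d \<delta> A =
     (INF C \<in> {C :: nat \<Rightarrow> 'a set. A \<subseteq> (\<Union>i. C i) \<and> (\<forall>i. bounded (C i) \<and> diameter (C i) \<le> \<delta>)}.
        \<Sum>i. if C i = {} then 0 else ennreal (unit_ball_vol (real d) * (diameter (C i) / 2) ^ d))"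

definition hausdorff_measure :: "nat \<Rightarrow> 'a::metric_space set \<Rightarrow> ennreal" where
  "hausdorff_measure d A = (SUP \<delta> \<in> {0<..}. hausdorff_content d \<delta> A)"


section \<open>Embedded hypersurfaces of class C1, with or without boundary\<close>

definition C1_on :: "('a::euclidean_space \<Rightarrow> 'b::euclidean_space) \<Rightarrow> 'a set \<Rightarrow> bool" where
  "C1_on f U \<longleftrightarrow>
     (\<exists>f' :: 'a \<Rightarrow> 'a \<Rightarrow>\<^sub>L 'b.
        (\<forall>x\<in>U. (f has_derivative blinfun_apply (f' x)) (at x)) \<and> continuous_on U f')"

definition C1_diffeomorphism ::
    "'a::euclidean_space set \<Rightarrow> 'a set \<Rightarrow> ('a \<Rightarrow> 'a) \<Rightarrow> ('a \<Rightarrow> 'a) \<Rightarrow> bool" where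
  "C1_diffeomorphism U V \<phi> \<psi> \<longleftrightarrow>
     open U \<and> open V \<and> homeomorphism U V \<phi> \<psi> \<and> C1_on \<phi> U \<and> C1_on \<psi> V"

text \<open>
  A chart of the ambient space on \<open>U\<close> that maps \<open>S\<close> to an open piece of a coordinate
  hyperplane orthogonal to \<open>b\<close>, or to an open piece of a closed half of that hyperplane.
\<close>

definition hypersurface_chart ::
    "'a::euclidean_space set \<Rightarrow> 'a set \<Rightarrow> ('a \<Rightarrow> 'a) \<Rightarrow> 'a \<Rightarrow> bool" where
  "hypersurface_chart S U \<phi> b \<longleftrightarrow>
     b \<in> Basis \<and>
     (\<exists>V \<psi>. C1_diffeomorphism U V \<phi> \<psi> \<and>
        (\<phi> ` (S \<inter> U) = {z \<in> V. z \<bullet> b = 0} \<or>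
         (\<exists>c \<in> Basis - {b}. \<phi> ` (S \<inter> U) = {z \<in> V. z \<bullet> b = 0 \<and> z \<bullet> c \<ge> 0})))"

definition C1_hypersurface :: "'a::euclidean_space set \<Rightarrow> bool" where
  "C1_hypersurface S \<longleftrightarrow> (\<forall>p\<in>S. \<exists>U \<phi> b. p \<in> U \<and> hypersurface_chart S U \<phi> b)"

text \<open>
  For \<open>p \<in> S\<close> the condition on \<open>v\<close> does not depend on the chart.  At a boundary point this is
  the full linear tangent space, not only the half-space of inward directions.
\<close>

definition tangent_space :: "'a::euclidean_space set \<Rightarrow> 'a \<Rightarrow> 'a set" where
  "tangent_space S p =
     {v. \<exists>U \<phi> b. p \<in> U \<and> hypersurface_chart S U \<phi> b \<and> frechet_derivative \<phi> (at p) v \<bullet> b = 0}"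


section \<open>The nonlocal area\<close>

definition crossing_pairs :: "'a::euclidean_space set \<Rightarrow> ('a \<times> 'a) set" where
  "crossing_pairs S =
     {(x, y). finite (closed_segment x y \<inter> S) \<and>
              (\<forall>p \<in> closed_segment x y \<inter> S. y - x \<notin> tangent_space S p) \<and>
              odd (card (closed_segment x y \<inter> S - {x, y}))}"

definition frac_kernel :: "real \<Rightarrow> 'a::euclidean_space \<Rightarrow> 'a \<Rightarrow> real" where
  "frac_kernel s x y =
     1 / unit_ball_vol (real (DIM('a) - 1)) * (1 / norm (x - y) powr (real DIM('a) + 2 * s))"

text \<open>
  The integrand is nonnegative, so the integral is taken in the extended nonnegative reals.
\<close>

definition frac_area :: "real \<Rightarrow> 'a::euclidean_space set \<Rightarrow> 'a set \<Rightarrow> ennreal" where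
  "frac_area s S \<Omega> =
     ennreal (1 / 2) *
     (\<integral>\<^sup>+ (x, y) \<in> crossing_pairs S.
        ennreal (frac_kernel s x y * max (indicator \<Omega> x) (indicator \<Omega> y)) \<partial>lebesgue)"

end

theory Submission
  imports Defs
begin

text \<open>
  The integral is computed in the displacement \<open>v = y - x\<close>. For fixed \<open>v\<close>, the segments
  \<open>[x, x + v]\<close> that meet a set \<open>E\<close> are those that start in \<open>sweep E v\<close>, the set \<open>E\<close> dragged along
  \<open>-v\<close>. If \<open>E\<close> is a small piece of the hypersurface with unit normal \<open>\<nu>\<close>, then
  \<open>|sweep E v|\<close> is nearly \<open>|v \<bullet> \<nu>|\<close> times the area of \<open>E\<close>. Weighted by the kernel, \<open>|v \<bullet> \<nu>|\<close> has
  an explicit integral over a ball, which grows like \<open>1 / (1 - 2 s)\<close> with exactly the constant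
  that the normalisation of the kernel cancels. So each piece contributes its area in the limit.
  Displacements of length at least 1 contribute a bounded amount, which the factor \<open>1 - 2 s\<close> kills.

  The crossing condition is used through two facts. A crossing pair meets \<open>S\<close>, which gives the upper
  bound (\<open>weighted_area_le\<close>). Conversely, a short segment that meets a piece at an angle bounded away
  from tangency meets \<open>S\<close> exactly once, hence is a crossing pair unless an end point lies on the null
  set \<open>S\<close>, and the sweeps of different pieces in such directions are disjoint; this gives the lower
  bound (\<open>weighted_area_ge\<close>). The
  nearly tangential directions form a thin strip of the unit ball, where a crude Lipschitz bound
  on the sweep suffices.

  The hypersurface enters through its local flatness: near each of its points there is a
  unit vector \<open>\<nu>\<close> that is almost orthogonal to every secant (\<open>hypersurface_chart_flat\<close>). A flat
  piece is a Lipschitz graph with small constant over its projection to the hyperplane orthogonal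
  to \<open>\<nu>\<close>, and its sweep is almost isometric to the sweep of this projection. Areas in the
  hyperplane are expressed as \<open>n\<close>-dimensional volumes of slabs of height 1. Thus the whole proof
  takes place in one Euclidean space, and volumes are compared by the fact that an
  \<open>L\<close>-Lipschitz map multiplies them at most by \<open>L ^ n\<close> (\<open>emeasure_lipschitz_image_le\<close>).

  It remains to compare the Hausdorff measure of \<open>S\<close> with the sum of the projected areas. That the
  projected areas are at most the Hausdorff measure is the isodiametric inequality
  (\<open>isodiametric_projection\<close>), which follows from the Brunn-Minkowski inequality for a set and its
  reflection, and this in turn from the Prekopa-Leindler inequality. Conversely a slab is covered
  efficiently by small balls, and the slices of such a cover by a hyperplane cover the base of the
  slab by discs; averaging over the slices bounds the Hausdorff measure of a planar set by its
  area (\<open>hausdorff_measure_hyperplane_le\<close>).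
\<close>

section \<open>Efficient covers by balls and images under Lipschitz maps\<close>

text \<open>
  Two countable covers are merged by alternating between them, and this bounds the cost of the result.
\<close>

lemma suminf_interleave_le:
  fixes a b :: "nat \<Rightarrow> ennreal"
  shows "(\<Sum>i. if even i then a (i div 2) else b (i div 2)) \<le> suminf a + suminf b"
proof -
  let ?h = "\<lambda>i. if even i then a (i div 2) else b (i div 2)"
  have eq: "sum ?h {..<2 * n} = sum a {..<n} + sum b {..<n}" for n
    by (induction n) (simp_all add: ac_simps)
  have "sum ?h {..<n} \<le> suminf a + suminf b" for n
  proof -
    have "sum ?h {..<n} \<le> sum ?h {..<2 * n}"
      by (intro sum_mono2) auto
    also have "\<dots> \<le> suminf a + suminf b"
      unfolding eq by (intro add_mono sum_le_suminf) auto
    finally show ?thesis .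
  qed
  then show ?thesis
    by (simp add: suminf_eq_SUP SUP_le_iff)
qed

text \<open>
  A countable, possibly finite, family of balls becomes a sequence by filling up with balls of
  radius 0 around a point of \<open>A\<close>.
\<close>

lemma disjoint_balls_sequence:
  fixes A W :: "'a::euclidean_space set" and C :: "('a \<times> real) set"
  assumes C: "countable C" "\<And>x r. (x, r) \<in> C \<Longrightarrow> x \<in> A \<and> 0 < r \<and> r \<le> d"
    and dis: "pairwise (\<lambda>i j. disjnt (ball (fst i) (snd i)) (ball (fst j) (snd j))) C"
    and sub: "\<And>x r. (x, r) \<in> C \<Longrightarrow> ball x r \<subseteq> W"
    and W: "W \<in> sets borel" and "A \<noteq> {}" and "0 < d"
  obtains x r where "\<And>i::nat. x i \<in> A \<and> 0 \<le> r i \<and> r i \<le> d"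
    "\<And>y s. (y, s) \<in> C \<Longrightarrow> \<exists>i. x i = y \<and> r i = s"
    "(\<Sum>i. emeasure lborel (ball (x i) (r i))) \<le> emeasure lborel W"
proof -
  obtain a where a: "a \<in> A" using \<open>A \<noteq> {}\<close> by auto
  define f where "f i = (if i \<in> to_nat_on C ` C then from_nat_into C i else (a, 0))" for i
  have inC: "f i \<in> C" if "i \<in> to_nat_on C ` C" for i
    using that C(1) unfolding f_def by auto
  have surj: "f (to_nat_on C z) = z" if "z \<in> C" for z
    using that C(1) unfolding f_def by auto
  show ?thesis
  proof
    show "fst (f i) \<in> A \<and> 0 \<le> snd (f i) \<and> snd (f i) \<le> d" for i
    proof (cases "i \<in> to_nat_on C ` C")
      case True
      then show ?thesis using inC[of i] C(2)[of "fst (f i)" "snd (f i)"] by auto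
    next
      case False
      then show ?thesis using a \<open>0 < d\<close> by (auto simp: f_def)
    qed
    show "\<exists>i. fst (f i) = y \<and> snd (f i) = s" if "(y, s) \<in> C" for y s
      using surj[OF that] by (metis fst_conv snd_conv)
    let ?B = "\<lambda>i. ball (fst (f i)) (snd (f i))"
    have "disjoint_family ?B"
      unfolding disjoint_family_on_def
    proof (intro ballI impI)
      fix m n :: nat assume "m \<noteq> n"
      show "?B m \<inter> ?B n = {}"
      proof (cases "m \<in> to_nat_on C ` C \<and> n \<in> to_nat_on C ` C")
        case True
        then have "f m \<noteq> f n"
          using \<open>m \<noteq> n\<close> C(1) unfolding f_def by auto
        then show ?thesis
          using dis inC True unfolding pairwise_def disjnt_def by blast
      qed (auto simp: f_def)
    qed
    then have "(\<Sum>i. emeasure lborel (?B i)) = emeasure lborel (\<Union>i. ?B i)"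
      by (intro suminf_emeasure) auto
    also have "\<dots> \<le> emeasure lborel W"
    proof (intro emeasure_mono UN_least)
      show "?B i \<subseteq> W" for i
        using inC[of i] sub[of "fst (f i)" "snd (f i)"]
        by (cases "i \<in> to_nat_on C ` C") (auto simp: f_def)
    qed (use W in auto)
    finally show "(\<Sum>i. emeasure lborel (?B i)) \<le> emeasure lborel W" .
  qed
qed

lemma emeasure_lborel_cball_scale:
  fixes x y :: "'a::euclidean_space"
  assumes "0 \<le> r" "0 \<le> L"
  shows "emeasure lborel (cball x (L * r)) = ennreal (L ^ DIM('a)) * emeasure lborel (ball y r)"
proof -
  have "emeasure lborel (cball x (L * r)) = ennreal (unit_ball_vol DIM('a) * (L * r) ^ DIM('a))"
    using assms by (simp add: emeasure_cball)
  also have "\<dots> = ennreal (L ^ DIM('a) * (unit_ball_vol DIM('a) * r ^ DIM('a)))"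
    by (simp add: power_mult_distrib mult_ac)
  also have "\<dots> = ennreal (L ^ DIM('a)) * emeasure lborel (ball y r)"
    using assms by (simp add: emeasure_ball ennreal_mult')
  finally show ?thesis .
qed

lemma ball_cover_null:
  fixes A :: "'a::euclidean_space set"
  assumes A: "A \<in> sets lebesgue" "emeasure lebesgue A = 0" "A \<noteq> {}" and e: "0 < (e::real)" and d: "0 < d"
  obtains x r where "\<And>i::nat. x i \<in> A \<and> 0 \<le> r i \<and> r i \<le> d"
    "A \<subseteq> (\<Union>i. cball (x i) (r i))" "(\<Sum>i. emeasure lborel (cball (x i) (r i))) \<le> ennreal e"
proof -
  \<comment> \<open>The Vitali lemma enlarges the radii of a disjoint subfamily by the factor 5.\<close>
  define e' where "e' = e / 5 ^ DIM('a)"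
  have e': "0 < e'" using e by (simp add: e'_def)
  obtain W where W: "open W" "A \<subseteq> W" "emeasure lebesgue (W - A) < e'"
    by (rule sets_lebesgue_outer_open[OF A(1) e'])
  have WA: "emeasure lborel W \<le> ennreal e'"
  proof -
    have "emeasure lborel W = emeasure lebesgue W" using W(1) by simp
    also have "\<dots> = emeasure lebesgue (A \<union> (W - A))" using W(2) by (metis Un_Diff_cancel sup.absorb2)
    also have "\<dots> \<le> emeasure lebesgue A + emeasure lebesgue (W - A)"
      using A W(1) by (intro emeasure_subadditive) auto
    finally show ?thesis using W(3) A(2) by simp
  qed
  have ex: "\<exists>r. 0 < r \<and> r \<le> d / 5 \<and> ball x r \<subseteq> W" if "x \<in> A" for x
  proof -
    have "x \<in> W" using W(2) that by auto
    then obtain r where "0 < r" "ball x r \<subseteq> W" by (rule openE[OF W(1)])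
    then show ?thesis using d by (intro exI[of _ "min r (d / 5)"]) auto
  qed
  then obtain R where R: "\<And>x. x \<in> A \<Longrightarrow> 0 < R x \<and> R x \<le> d / 5 \<and> ball x (R x) \<subseteq> W"
    by metis
  have "A \<subseteq> (\<Union>i\<in>A. ball i (R i))" using R by force
  moreover have "\<And>i. i \<in> A \<Longrightarrow> 0 < R i \<and> R i \<le> d / 5" using R by auto
  ultimately obtain C where C: "countable C" "C \<subseteq> A"
    "pairwise (\<lambda>i j. disjnt (ball i (R i)) (ball j (R j))) C" "A \<subseteq> (\<Union>i\<in>C. ball i (5 * R i))"
    by (rule Vitali_covering_lemma_balls)
  define D where "D = (\<lambda>x. (x, R x)) ` C"
  obtain x r where xr: "\<And>i::nat. x i \<in> A \<and> 0 \<le> r i \<and> r i \<le> d / 5"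
    "\<And>y s. (y, s) \<in> D \<Longrightarrow> \<exists>i. x i = y \<and> r i = s"
    "(\<Sum>i. emeasure lborel (ball (x i) (r i))) \<le> emeasure lborel W"
  proof (rule disjoint_balls_sequence)
    show "countable D" using C(1) by (simp add: D_def)
    show "\<And>x r. (x, r) \<in> D \<Longrightarrow> x \<in> A \<and> 0 < r \<and> r \<le> d / 5" using R C(2) by (auto simp: D_def)
    show "pairwise (\<lambda>i j. disjnt (ball (fst i) (snd i)) (ball (fst j) (snd j))) D"
      using C(3) by (auto simp: D_def pairwise_def)
    show "\<And>x r. (x, r) \<in> D \<Longrightarrow> ball x r \<subseteq> W" using R C(2) by (auto simp: D_def)
  qed (use W A d in auto)
  show ?thesis
  proof
    show "x i \<in> A \<and> 0 \<le> 5 * r i \<and> 5 * r i \<le> d" for i using xr(1)[of i] by auto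
    show "A \<subseteq> (\<Union>i. cball (x i) (5 * r i))"
    proof
      fix y assume "y \<in> A"
      then obtain c where c: "c \<in> C" "y \<in> ball c (5 * R c)" using C(4) by blast
      then obtain i where "x i = c" "r i = R c" using xr(2)[of c "R c"] by (auto simp: D_def)
      then show "y \<in> (\<Union>i. cball (x i) (5 * r i))" using c by (intro UN_I[of i]) auto
    qed
    have "(\<Sum>i. emeasure lborel (cball (x i) (5 * r i)))
        = (\<Sum>i. ennreal (5 ^ DIM('a)) * emeasure lborel (ball (x i) (r i)))"
      using xr(1) by (intro suminf_cong emeasure_lborel_cball_scale) auto
    also have "\<dots> = ennreal (5 ^ DIM('a)) * (\<Sum>i. emeasure lborel (ball (x i) (r i)))"
      by (rule ennreal_suminf_cmult)
    finally have "(\<Sum>i. emeasure lborel (cball (x i) (5 * r i)))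
        = ennreal (5 ^ DIM('a)) * (\<Sum>i. emeasure lborel (ball (x i) (r i)))" .
    also have "\<dots> \<le> ennreal (5 ^ DIM('a)) * ennreal e'"
      using xr(3) WA by (intro mult_left_mono) auto
    also have "\<dots> = ennreal e" using e by (simp add: e'_def flip: ennreal_mult)
    finally show "(\<Sum>i. emeasure lborel (cball (x i) (5 * r i))) \<le> ennreal e" .
  qed
qed

text \<open>
  By the Vitali covering theorem disjoint balls exhaust \<open>A\<close> up to a null set, at a cost that is at
  most the volume of an open superset. The remaining null set is covered at arbitrarily small cost.
  That the centres lie in \<open>A\<close> makes the cover usable for maps that are defined on \<open>A\<close> only.
\<close>

lemma ball_cover:
  fixes A :: "'a::euclidean_space set"
  assumes A: "A \<in> sets borel" "A \<noteq> {}" and e: "0 < (e::real)" and d: "0 < d"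
  obtains x r where "\<And>i::nat. x i \<in> A \<and> 0 \<le> r i \<and> r i \<le> d"
    "A \<subseteq> (\<Union>i. cball (x i) (r i))"
    "(\<Sum>i. emeasure lborel (cball (x i) (r i))) \<le> emeasure lborel A + ennreal e"
proof -
  have e2: "0 < e / 2" using e by simp
  have AL: "A \<in> sets lebesgue" using A by (intro sets_completionI_sets) auto
  obtain W where W: "open W" "A \<subseteq> W" "emeasure lebesgue (W - A) < e / 2"
    by (rule sets_lebesgue_outer_open[OF AL e2])
  have WA: "emeasure lborel W \<le> emeasure lborel A + ennreal (e / 2)"
  proof -
    have "emeasure lborel W = emeasure lborel (A \<union> (W - A))" using W(2) by (metis Un_Diff_cancel sup.absorb2)
    also have "\<dots> \<le> emeasure lborel A + emeasure lborel (W - A)"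
      using A W(1) by (intro emeasure_subadditive) auto
    also have "emeasure lborel (W - A) = emeasure lebesgue (W - A)" using A W(1) by simp
    finally show ?thesis using W(3) by (meson add_left_mono dual_order.trans less_imp_le)
  qed
  define K where "K = {(x, r). x \<in> A \<and> 0 < r \<and> r \<le> d \<and> ball x r \<subseteq> W}"
  have "\<exists>i. i \<in> K \<and> x \<in> ball (fst i) (snd i) \<and> snd i < t" if "x \<in> A" "0 < t" for x t
  proof -
    have "x \<in> W" using W(2) that by auto
    then obtain r where "0 < r" "ball x r \<subseteq> W" by (rule openE[OF W(1)])
    then show ?thesis using d that
      by (intro exI[of _ "(x, min r (min d (t / 2)))"]) (auto simp: K_def)
  qed
  then obtain C where C: "countable C" "C \<subseteq> K"
     "pairwise (\<lambda>i j. disjnt (ball (fst i) (snd i)) (ball (fst j) (snd j))) C"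
     and neg: "negligible (A - (\<Union>i\<in>C. ball (fst i) (snd i)))"
    by (rule Vitali_covering_theorem_balls)
  obtain x r where xr: "\<And>i::nat. x i \<in> A \<and> 0 \<le> r i \<and> r i \<le> d"
    "\<And>y s. (y, s) \<in> C \<Longrightarrow> \<exists>i. x i = y \<and> r i = s"
    "(\<Sum>i. emeasure lborel (ball (x i) (r i))) \<le> emeasure lborel W"
  proof (rule disjoint_balls_sequence)
    show "\<And>x r. (x, r) \<in> C \<Longrightarrow> x \<in> A \<and> 0 < r \<and> r \<le> d" using C(2) by (auto simp: K_def)
    show "\<And>x r. (x, r) \<in> C \<Longrightarrow> ball x r \<subseteq> W" using C(2) by (auto simp: K_def)
  qed (use C A W d in auto)
  let ?N = "A - (\<Union>i\<in>C. ball (fst i) (snd i))"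
  have N0: "?N \<in> sets lebesgue" "emeasure lebesgue ?N = 0"
    using neg negligible_imp_sets emeasure_eq_measure2 negligible_iff_emeasure0 by blast+
  obtain y s where ys: "\<And>i::nat. y i \<in> A \<and> 0 \<le> s i \<and> s i \<le> d"
    "?N \<subseteq> (\<Union>i. cball (y i) (s i))" "(\<Sum>i. emeasure lborel (cball (y i) (s i))) \<le> ennreal (e / 2)"
  proof (cases "?N = {}")
    case True
    obtain a where "a \<in> A" using A by auto
    then show ?thesis using True d e
      by (intro that[of "\<lambda>_. a" "\<lambda>_. 0"]) (auto simp: emeasure_cball)
  next
    case False
    show ?thesis
      by (rule ball_cover_null[OF N0 False e2 d]) (use that in blast)
  qed
  let ?x = "\<lambda>i. if even i then x (i div 2) else y (i div 2)"
  let ?r = "\<lambda>i. if even i then r (i div 2) else s (i div 2)"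
  show ?thesis
  proof
    show "?x i \<in> A \<and> 0 \<le> ?r i \<and> ?r i \<le> d" for i using xr(1) ys(1) by auto
    show "A \<subseteq> (\<Union>i. cball (?x i) (?r i))"
    proof
      fix z assume z: "z \<in> A"
      show "z \<in> (\<Union>i. cball (?x i) (?r i))"
      proof (cases "z \<in> ?N")
        case True
        then obtain i where "z \<in> cball (y i) (s i)" using ys(2) by blast
        then show ?thesis by (intro UN_I[of "2 * i + 1"]) auto
      next
        case False
        then obtain c t where c: "(c, t) \<in> C" "z \<in> ball c t" using z by auto
        then obtain i where "x i = c" "r i = t" using xr(2) by blast
        then show ?thesis using c by (intro UN_I[of "2 * i"]) auto
      qed
    qed
    have "(\<Sum>i. emeasure lborel (cball (?x i) (?r i))) =
        (\<Sum>i. if even i then emeasure lborel (cball (x (i div 2)) (r (i div 2)))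
             else emeasure lborel (cball (y (i div 2)) (s (i div 2))))"
      by (intro suminf_cong) auto
    also have "\<dots> \<le> (\<Sum>i. emeasure lborel (cball (x i) (r i))) + (\<Sum>i. emeasure lborel (cball (y i) (s i)))"
      by (rule suminf_interleave_le)
    also have "(\<Sum>i. emeasure lborel (cball (x i) (r i))) = (\<Sum>i. emeasure lborel (ball (x i) (r i)))"
      using xr(1) by (simp add: emeasure_cball emeasure_ball)
    also have "(\<Sum>i. emeasure lborel (ball (x i) (r i))) + (\<Sum>i. emeasure lborel (cball (y i) (s i)))
        \<le> (emeasure lborel A + ennreal (e / 2)) + ennreal (e / 2)"
      using xr(3) WA ys(3) by (intro add_mono) auto
    also have "\<dots> = emeasure lborel A + ennreal e"
      using e by (simp add: add.assoc flip: ennreal_plus)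
    finally show "(\<Sum>i. emeasure lborel (cball (?x i) (?r i))) \<le> emeasure lborel A + ennreal e" .
  qed
qed

text \<open>
  The image of a ball with centre in \<open>A\<close> lies in the ball of \<open>L\<close> times the radius around the image
  of the centre, so an efficient cover of \<open>A\<close> by balls is mapped to a cover of \<open>f ` A\<close>.
\<close>

lemma emeasure_lipschitz_image_le:
  fixes f :: "'a::euclidean_space \<Rightarrow> 'a"
  assumes A: "A \<in> sets borel" and L: "0 \<le> L"
    and lip: "\<And>x y. x \<in> A \<Longrightarrow> y \<in> A \<Longrightarrow> norm (f x - f y) \<le> L * norm (x - y)"
  shows "emeasure lborel (f ` A) \<le> ennreal (L ^ DIM('a)) * emeasure lborel A"
proof (cases "A = {}")
  case False
  show ?thesis
  proof (rule ennreal_le_epsilon)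
    fix e :: real assume e: "0 < e"
    define e' where "e' = e / (L ^ DIM('a) + 1)"
    have e': "0 < e'" using e L by (simp add: e'_def add_nonneg_pos)
    obtain x r where xr: "\<And>i::nat. x i \<in> A \<and> 0 \<le> r i \<and> r i \<le> 1"
      "A \<subseteq> (\<Union>i. cball (x i) (r i))"
      "(\<Sum>i. emeasure lborel (cball (x i) (r i))) \<le> emeasure lborel A + ennreal e'"
      by (rule ball_cover[OF A False e', of 1]) (use that in auto)
    have sub: "f ` A \<subseteq> (\<Union>i. cball (f (x i)) (L * r i))"
    proof
      fix z assume "z \<in> f ` A"
      then obtain a where a: "a \<in> A" "z = f a" by auto
      then obtain i where i: "a \<in> cball (x i) (r i)" using xr(2) by blast
      have "norm (f (x i) - f a) \<le> L * norm (x i - a)" using lip a xr(1) by auto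
      also have "\<dots> \<le> L * r i" using i L by (intro mult_left_mono) (auto simp: dist_norm)
      finally show "z \<in> (\<Union>i. cball (f (x i)) (L * r i))" using a by (auto simp: dist_norm)
    qed
    have "emeasure lborel (f ` A) \<le> emeasure lborel (\<Union>i. cball (f (x i)) (L * r i))"
      by (rule emeasure_mono[OF sub]) (auto intro!: sets.countable_UN)
    also have "\<dots> \<le> (\<Sum>i. emeasure lborel (cball (f (x i)) (L * r i)))"
      by (rule emeasure_subadditive_countably) auto
    also have "\<dots> = (\<Sum>i. ennreal (L ^ DIM('a)) * emeasure lborel (ball (x i) (r i)))"
      using xr(1) L by (intro suminf_cong emeasure_lborel_cball_scale) auto
    also have "\<dots> = ennreal (L ^ DIM('a)) * (\<Sum>i. emeasure lborel (cball (x i) (r i)))"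
      using xr(1) by (simp add: emeasure_cball emeasure_ball)
    also have "\<dots> \<le> ennreal (L ^ DIM('a)) * (emeasure lborel A + ennreal e')"
      using xr(3) by (intro mult_left_mono) auto
    also have "\<dots> = ennreal (L ^ DIM('a)) * emeasure lborel A + ennreal (L ^ DIM('a) * e')"
      using L by (simp add: distrib_left ennreal_mult')
    also have "\<dots> \<le> ennreal (L ^ DIM('a)) * emeasure lborel A + ennreal e"
    proof -
      have "L ^ DIM('a) * e' \<le> (L ^ DIM('a) + 1) * e'" using e' by (intro mult_right_mono) auto
      also have "\<dots> = e" using L unfolding e'_def by (simp add: add_nonneg_eq_0_iff)
      finally show ?thesis by (intro add_left_mono ennreal_leI)
    qed
    finally show "emeasure lborel (f ` A) \<le> ennreal (L ^ DIM('a)) * emeasure lborel A + ennreal e" .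
  qed
qed auto

text \<open>
  The orthogonal reflection that maps \<open>w\<close> to \<open>- w\<close>. Reflections suffice to move any unit vector to
  any other one.
\<close>

definition reflection :: "'a::euclidean_space \<Rightarrow> 'a \<Rightarrow> 'a" where
  "reflection w x = x - (2 * (x \<bullet> w) / (w \<bullet> w)) *\<^sub>R w"

lemma linear_reflection: "linear (reflection w)"
proof (rule linearI)
  show "reflection w (x + y) = reflection w x + reflection w y" for x y
    by (simp add: reflection_def inner_add_left distrib_left add_divide_distrib scaleR_left_distrib)
  show "reflection w (c *\<^sub>R x) = c *\<^sub>R reflection w x" for c x
    by (simp add: reflection_def scaleR_right_diff_distrib mult.left_commute)
qed

lemma reflection_inner_axis: "reflection w x \<bullet> w = - (x \<bullet> w)"
  by (cases "w = 0") (simp_all add: reflection_def inner_diff_left)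

lemma reflection_involution [simp]: "reflection w (reflection w x) = x"
  using reflection_inner_axis[of w x]
  by (simp add: reflection_def[of w "reflection w x"]) (simp add: reflection_def)

lemma inner_reflection: "reflection w x \<bullet> reflection w y = x \<bullet> y"
proof -
  have "reflection w x \<bullet> reflection w y = reflection w x \<bullet> y - (2 * (y \<bullet> w) / (w \<bullet> w)) * (reflection w x \<bullet> w)"
    by (simp add: reflection_def[of w y] inner_diff_right)
  also have "\<dots> = x \<bullet> y"
    by (simp add: reflection_inner_axis) (simp add: reflection_def inner_diff_left inner_commute[of w y])
  finally show ?thesis .
qed

lemma reflection_swap:
  assumes "norm a = norm b" shows "reflection (a - b) a = b"
proof (cases "a = b")
  case False
  have "(a - b) \<bullet> (a - b) = 2 * (a \<bullet> (a - b))"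
    using assms by (simp add: norm_eq algebra_simps inner_commute)
  moreover have "(a - b) \<bullet> (a - b) \<noteq> 0" using False by simp
  ultimately have "2 * (a \<bullet> (a - b)) / ((a - b) \<bullet> (a - b)) = 1" by (metis divide_self)
  then show ?thesis by (simp only: reflection_def scaleR_one) simp
qed (simp add: reflection_def)

text \<open>
  A reflection is its own inverse and 1-Lipschitz, so it can neither increase nor decrease volume.
\<close>

lemma lborel_distr_reflection:
  "distr lborel borel (reflection w) = (lborel :: 'a::euclidean_space measure)"
proof (rule measure_eqI)
  have [measurable]: "reflection w \<in> borel_measurable borel"
    by (intro borel_measurable_continuous_onI linear_continuous_on linear_conv_bounded_linear[THEN iffD1] linear_reflection)
  have img: "reflection w ` A = reflection w -` A" for A
    by (auto intro: image_eqI[where x="reflection w _"])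
  have le: "emeasure lborel (reflection w ` A) \<le> emeasure lborel A" if "A \<in> sets borel" for A
  proof -
    have "norm (reflection w x - reflection w y) = norm (x - y)" for x y
      by (metis inner_reflection linear_diff linear_reflection norm_eq)
    then show ?thesis
      using emeasure_lipschitz_image_le[OF that, of 1 "reflection w"] by simp
  qed
  show "emeasure (distr lborel borel (reflection w)) A = emeasure lborel A"
    if "A \<in> sets (distr lborel borel (reflection w))" for A
  proof -
    have A: "A \<in> sets borel" using that by simp
    have B: "reflection w ` A \<in> sets borel"
      unfolding img using measurable_sets[of "reflection w" borel borel A] A by simp
    have "emeasure lborel A = emeasure lborel (reflection w ` reflection w ` A)"
      by (simp add: image_image)
    then have "emeasure lborel (reflection w ` A) = emeasure lborel A"
      using le[OF A] le[OF B] by simp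
    then show ?thesis using A by (simp add: emeasure_distr img)
  qed
qed simp

section \<open>Fubini along an arbitrary direction\<close>

interpretation lborel_product: product_sigma_finite "\<lambda>_. lborel :: real measure"
  by standard

lemma nn_integral_lborel_coordinate:
  fixes f :: "'a::euclidean_space \<Rightarrow> ennreal"
  assumes b: "b \<in> Basis" and f[measurable]: "f \<in> borel_measurable borel"
  shows "(\<integral>\<^sup>+x. f x \<partial>lborel) =
      (\<integral>\<^sup>+w. (\<integral>\<^sup>+t. f (t *\<^sub>R b + (\<Sum>i\<in>Basis - {b}. w i *\<^sub>R i)) \<partial>lborel) \<partial>(\<Pi>\<^sub>M i\<in>Basis - {b}. lborel))"
    and "(\<integral>\<^sup>+x. f x \<partial>lborel) =
      (\<integral>\<^sup>+t. (\<integral>\<^sup>+w. f (t *\<^sub>R b + (\<Sum>i\<in>Basis - {b}. w i *\<^sub>R i)) \<partial>(\<Pi>\<^sub>M i\<in>Basis - {b}. lborel)) \<partial>lborel)"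
proof -
  have ins: "Basis = insert b (Basis - {b})" using b by auto
  have "(\<integral>\<^sup>+x. f x \<partial>lborel) = (\<integral>\<^sup>+w. f (\<Sum>i\<in>Basis. w i *\<^sub>R i) \<partial>(\<Pi>\<^sub>M i\<in>(Basis::'a set). lborel))"
    by (subst lborel_eq, subst nn_integral_distr) simp_all
  also have "\<dots> = (\<integral>\<^sup>+w. f (\<Sum>i\<in>Basis. w i *\<^sub>R i) \<partial>(\<Pi>\<^sub>M i\<in>insert b (Basis - {b}). lborel))"
    using ins by simp
  finally have eq: "(\<integral>\<^sup>+x. f x \<partial>lborel) = \<dots>" .
  have m: "(\<lambda>w. f (\<Sum>i\<in>Basis. w i *\<^sub>R i)) \<in> borel_measurable (\<Pi>\<^sub>M i\<in>insert b (Basis - {b}). lborel)"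
    using ins[symmetric] by simp
  have upd: "(\<Sum>i\<in>Basis. (w(b := t)) i *\<^sub>R i) = t *\<^sub>R b + (\<Sum>i\<in>Basis - {b}. w i *\<^sub>R i)" for w :: "'a \<Rightarrow> real" and t
    by (subst sum.remove[OF _ b]) (auto intro!: sum.cong)
  show "(\<integral>\<^sup>+x. f x \<partial>lborel) =
      (\<integral>\<^sup>+w. (\<integral>\<^sup>+t. f (t *\<^sub>R b + (\<Sum>i\<in>Basis - {b}. w i *\<^sub>R i)) \<partial>lborel) \<partial>(\<Pi>\<^sub>M i\<in>Basis - {b}. lborel))"
    unfolding eq by (subst lborel_product.product_nn_integral_insert[OF _ _ m]) (simp_all only: upd, auto)
  show "(\<integral>\<^sup>+x. f x \<partial>lborel) =
      (\<integral>\<^sup>+t. (\<integral>\<^sup>+w. f (t *\<^sub>R b + (\<Sum>i\<in>Basis - {b}. w i *\<^sub>R i)) \<partial>(\<Pi>\<^sub>M i\<in>Basis - {b}. lborel)) \<partial>lborel)"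
    unfolding eq by (subst lborel_product.product_nn_integral_insert_rev[OF _ _ m]) (simp_all only: upd, auto)
qed

lemma measurable_reflection [measurable]: "reflection w \<in> borel_measurable borel"
  by (intro borel_measurable_continuous_onI linear_continuous_on linear_conv_bounded_linear[THEN iffD1] linear_reflection)

lemma nn_integral_reflection:
  fixes f :: "'a::euclidean_space \<Rightarrow> ennreal"
  assumes [measurable]: "f \<in> borel_measurable borel"
  shows "(\<integral>\<^sup>+x. f (reflection w x) \<partial>lborel) = (\<integral>\<^sup>+x. f x \<partial>lborel)"
  by (subst (2) lborel_distr_reflection[of w, symmetric], subst nn_integral_distr) simp_all

lemma rotate_to_basis:
  fixes \<nu> :: "'a::euclidean_space"
  assumes "norm \<nu> = 1"
  obtains b w where "b \<in> Basis" "reflection w b = \<nu>" "\<And>x. reflection w x \<bullet> \<nu> = x \<bullet> b"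
proof -
  obtain b :: 'a where b: "b \<in> Basis" by (meson nonempty_Basis ex_in_conv)
  have r: "reflection (b - \<nu>) b = \<nu>" using b assms by (intro reflection_swap) simp
  show ?thesis using that[OF b r] inner_reflection[of "b - \<nu>" _ b] r by simp
qed

text \<open>
  On each line parallel to \<open>\<nu>\<close> the map is affine with slope \<open>c\<close>. For a basis vector the claim is
  therefore one-dimensional substitution under the integral over the other coordinates, and a
  reflection moves \<open>\<nu>\<close> to a basis vector. The shears and dilations needed later are of this form.
\<close>

lemma nn_integral_affine_along:
  fixes f :: "'a::euclidean_space \<Rightarrow> ennreal"
  assumes nu: "norm \<nu> = 1" and c: "c \<noteq> 0"
    and f[measurable]: "f \<in> borel_measurable borel" and g[measurable]: "g \<in> borel_measurable borel"
    and inv: "\<And>x s. g (x + s *\<^sub>R \<nu>) = (g x :: real)"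
  shows "(\<integral>\<^sup>+x. f x \<partial>lborel) = ennreal \<bar>c\<bar> * (\<integral>\<^sup>+x. f (x + ((c - 1) * (x \<bullet> \<nu>) + g x) *\<^sub>R \<nu>) \<partial>lborel)"
proof -
  have basis: "(\<integral>\<^sup>+x. f x \<partial>lborel) = ennreal \<bar>c\<bar> * (\<integral>\<^sup>+x. f (x + ((c - 1) * (x \<bullet> b) + g x) *\<^sub>R b) \<partial>lborel)"
    if b: "b \<in> Basis" and [measurable]: "f \<in> borel_measurable borel" "g \<in> borel_measurable borel"
      and inv: "\<And>x s. g (x + s *\<^sub>R b) = (g x :: real)"
    for f :: "'a \<Rightarrow> ennreal" and g and b :: 'a
  proof -
    let ?W = "\<lambda>w. \<Sum>i\<in>Basis - {b}. w i *\<^sub>R i"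
    have Wb: "?W w \<bullet> b = 0" for w
      using b by (auto simp: inner_sum_left inner_Basis intro!: sum.neutral)
    have eq: "t *\<^sub>R b + ?W w + ((c - 1) * ((t *\<^sub>R b + ?W w) \<bullet> b) + g (t *\<^sub>R b + ?W w)) *\<^sub>R b
        = (g (?W w) + c * t) *\<^sub>R b + ?W w" for t w
    proof -
      have "g (t *\<^sub>R b + ?W w) = g (?W w)" using inv[of "?W w" t] by (simp add: add.commute)
      then show ?thesis using b by (simp add: inner_add_left Wb algebra_simps)
    qed
    have m: "(\<lambda>t. f (t *\<^sub>R b + ?W w)) \<in> borel_measurable borel" for w by measurable
    have "(\<integral>\<^sup>+x. f x \<partial>lborel) = (\<integral>\<^sup>+w. (\<integral>\<^sup>+t. f (t *\<^sub>R b + ?W w) \<partial>lborel) \<partial>(\<Pi>\<^sub>M i\<in>Basis - {b}. lborel))"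
      by (rule nn_integral_lborel_coordinate[OF b]) measurable
    also have "\<dots> = (\<integral>\<^sup>+w. ennreal \<bar>c\<bar> * (\<integral>\<^sup>+t. f ((g (?W w) + c * t) *\<^sub>R b + ?W w) \<partial>lborel) \<partial>(\<Pi>\<^sub>M i\<in>Basis - {b}. lborel))"
      by (intro nn_integral_cong nn_integral_real_affine[OF m c])
    also have "\<dots> = ennreal \<bar>c\<bar> * (\<integral>\<^sup>+w. (\<integral>\<^sup>+t. f ((g (?W w) + c * t) *\<^sub>R b + ?W w) \<partial>lborel) \<partial>(\<Pi>\<^sub>M i\<in>Basis - {b}. lborel))"
      by (rule nn_integral_cmult) measurable
    also have "(\<integral>\<^sup>+w. (\<integral>\<^sup>+t. f ((g (?W w) + c * t) *\<^sub>R b + ?W w) \<partial>lborel) \<partial>(\<Pi>\<^sub>M i\<in>Basis - {b}. lborel))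
        = (\<integral>\<^sup>+x. f (x + ((c - 1) * (x \<bullet> b) + g x) *\<^sub>R b) \<partial>lborel)"
      by (subst nn_integral_lborel_coordinate(1)[OF b]) (measurable, simp only: eq)
    finally show ?thesis .
  qed
  obtain b w where b: "b \<in> Basis" and wb: "reflection w b = \<nu>" and wi: "\<And>x. reflection w x \<bullet> \<nu> = x \<bullet> b"
    using rotate_to_basis[OF nu] by blast
  have lin: "reflection w (x + s *\<^sub>R b) = reflection w x + s *\<^sub>R \<nu>" for x s
    by (simp add: linear_add[OF linear_reflection] linear_cmul[OF linear_reflection] wb)
  have "(\<integral>\<^sup>+x. f x \<partial>lborel) = (\<integral>\<^sup>+x. f (reflection w x) \<partial>lborel)"
    by (simp add: nn_integral_reflection)
  also have "\<dots> = ennreal \<bar>c\<bar> *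
      (\<integral>\<^sup>+x. f (reflection w (x + ((c - 1) * (x \<bullet> b) + g (reflection w x)) *\<^sub>R b)) \<partial>lborel)"
    by (rule basis[OF b]) (measurable, simp add: lin inv)
  also have "\<dots> = ennreal \<bar>c\<bar> * (\<integral>\<^sup>+x. (\<lambda>y. f (y + ((c - 1) * (y \<bullet> \<nu>) + g y) *\<^sub>R \<nu>)) (reflection w x) \<partial>lborel)"
    by (simp only: lin wi)
  also have "\<dots> = ennreal \<bar>c\<bar> * (\<integral>\<^sup>+x. f (x + ((c - 1) * (x \<bullet> \<nu>) + g x) *\<^sub>R \<nu>) \<partial>lborel)"
    by (subst nn_integral_reflection) simp_all
  finally show ?thesis .
qed

text \<open>
  The orthogonal projection to the hyperplane through 0 with unit normal \<open>\<nu>\<close>.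
\<close>

definition hproj :: "'a::euclidean_space \<Rightarrow> 'a \<Rightarrow> 'a" where
  "hproj \<nu> x = x - (x \<bullet> \<nu>) *\<^sub>R \<nu>"

lemma continuous_on_hproj [continuous_intros]: "continuous_on S (hproj \<nu>)"
  unfolding hproj_def by (intro continuous_intros)

lemma measurable_hproj [measurable]: "hproj \<nu> \<in> borel_measurable borel"
  by (intro borel_measurable_continuous_onI continuous_on_hproj)

text \<open>
  Integration over a body of revolution around the axis \<open>\<nu>\<close>: its slice at height \<open>t\<close> is a disc
  of radius \<open>\<rho> t\<close> and codimension one.
\<close>

lemma nn_integral_cylindrical:
  fixes \<nu> :: "'a::euclidean_space"
  assumes nu: "norm \<nu> = 1"
    and g[measurable]: "g \<in> borel_measurable borel" and rho[measurable]: "\<rho> \<in> borel_measurable borel"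
    and pos: "\<And>t. g t = 0 \<or> 0 < \<rho> t"
  shows "(\<integral>\<^sup>+x. g (x \<bullet> \<nu>) * indicator {x. norm (hproj \<nu> x) \<le> \<rho> (x \<bullet> \<nu>)} x \<partial>lborel) =
    (\<integral>\<^sup>+t. g t * ennreal (unit_ball_vol (DIM('a) - 1) * \<rho> t ^ (DIM('a) - 1)) \<partial>lborel)"
proof -
  obtain b w where b: "b \<in> Basis" and wb: "reflection w b = \<nu>" and wi: "\<And>x. reflection w x \<bullet> \<nu> = x \<bullet> b"
    using rotate_to_basis[OF nu] by blast
  let ?F = "\<lambda>x. g (x \<bullet> b) * indicator {x. norm (hproj b x) \<le> \<rho> (x \<bullet> b)} x"
  let ?P = "\<Pi>\<^sub>M i\<in>Basis - {b}. lborel :: real measure"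
  let ?W = "\<lambda>w. \<Sum>i\<in>Basis - {b}. w i *\<^sub>R i"
  have Wb: "?W w \<bullet> b = 0" for w
    using b by (auto simp: inner_sum_left inner_Basis intro!: sum.neutral)
  have nW: "norm (?W w) = sqrt (\<Sum>i\<in>Basis - {b}. (w i)\<^sup>2)" for w
  proof -
    have c: "?W w \<bullet> i = w i" if "i \<in> Basis - {b}" for i
    proof -
      have "?W w \<bullet> i = (\<Sum>j\<in>Basis - {b}. if j = i then w j else 0)"
        unfolding inner_sum_left using that by (intro sum.cong) (auto simp: inner_Basis)
      then show ?thesis using that by simp
    qed
    have "(\<Sum>i\<in>Basis. (?W w \<bullet> i)\<^sup>2) = (\<Sum>i\<in>Basis - {b}. (?W w \<bullet> i)\<^sup>2)"
      by (subst sum.remove[OF _ b]) (simp_all add: Wb)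
    also have "\<dots> = (\<Sum>i\<in>Basis - {b}. (w i)\<^sup>2)"
      by (intro sum.cong) (simp_all only: c)
    finally show ?thesis
      by (simp add: norm_eq_sqrt_inner euclidean_inner[of "?W w" "?W w"] power2_eq_square)
  qed
  have h: "hproj b (t *\<^sub>R b + ?W w) = ?W w" "(t *\<^sub>R b + ?W w) \<bullet> b = t" for t w
    using b by (simp_all add: hproj_def inner_add_left Wb)
  have "hproj \<nu> (reflection w x) = reflection w (hproj b x)" for x
    by (simp add: hproj_def wi wb linear_diff[OF linear_reflection] linear_cmul[OF linear_reflection])
  then have n: "norm (hproj \<nu> (reflection w x)) = norm (hproj b x)" for x
    by (simp add: norm_eq inner_reflection)
  have "(\<integral>\<^sup>+x. g (x \<bullet> \<nu>) * indicator {x. norm (hproj \<nu> x) \<le> \<rho> (x \<bullet> \<nu>)} x \<partial>lborel) =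
     (\<integral>\<^sup>+x. g (reflection w x \<bullet> \<nu>) * indicator {x. norm (hproj \<nu> x) \<le> \<rho> (x \<bullet> \<nu>)} (reflection w x) \<partial>lborel)"
    by (rule nn_integral_reflection[symmetric]) measurable
  also have "\<dots> = (\<integral>\<^sup>+x. ?F x \<partial>lborel)"
    by (intro nn_integral_cong) (simp add: indicator_def wi n)
  also have "\<dots> = (\<integral>\<^sup>+t. (\<integral>\<^sup>+w. ?F (t *\<^sub>R b + ?W w) \<partial>?P) \<partial>lborel)"
    by (rule nn_integral_lborel_coordinate(2)[OF b]) measurable
  also have "\<dots> = (\<integral>\<^sup>+t. g t * ennreal (unit_ball_vol (DIM('a) - 1) * \<rho> t ^ (DIM('a) - 1)) \<partial>lborel)"
  proof (intro nn_integral_cong)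
    fix t :: real
    have S: "{f. sqrt (\<Sum>i\<in>Basis - {b}. (f i)\<^sup>2) \<le> \<rho> t} \<inter> space ?P \<in> sets ?P"
      by measurable
    have "(\<integral>\<^sup>+w. ?F (t *\<^sub>R b + ?W w) \<partial>?P) =
       (\<integral>\<^sup>+w. g t * indicator ({f. sqrt (\<Sum>i\<in>Basis - {b}. (f i)\<^sup>2) \<le> \<rho> t} \<inter> space ?P) w \<partial>?P)"
      by (intro nn_integral_cong) (simp add: indicator_def h nW)
    also have "\<dots> = g t * emeasure ?P ({f. sqrt (\<Sum>i\<in>Basis - {b}. (f i)\<^sup>2) \<le> \<rho> t} \<inter> space ?P)"
      by (rule nn_integral_cmult_indicator[OF S])
    also have "\<dots> = g t * ennreal (unit_ball_vol (DIM('a) - 1) * \<rho> t ^ (DIM('a) - 1))"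
    proof (cases "g t = 0")
      case False
      then have "0 < \<rho> t" using pos by blast
      then show ?thesis
        using emeasure_cball_aux[of "Basis - {b}" "\<rho> t"] b
        by (simp add: card_Diff_singleton of_nat_diff)
    qed simp
    finally show "(\<integral>\<^sup>+w. ?F (t *\<^sub>R b + ?W w) \<partial>?P) = \<dots>" .
  qed
  finally show ?thesis .
qed

lemma emeasure_cylinder:
  fixes \<nu> :: "'a::euclidean_space"
  assumes nu: "norm \<nu> = 1" and r: "0 < r" and "l \<le> u"
  shows "emeasure lborel {x. norm (hproj \<nu> x) \<le> r \<and> l \<le> x \<bullet> \<nu> \<and> x \<bullet> \<nu> \<le> u} =
    ennreal ((u - l) * (unit_ball_vol (DIM('a) - 1) * r ^ (DIM('a) - 1)))"
proof -
  have "emeasure lborel {x. norm (hproj \<nu> x) \<le> r \<and> l \<le> x \<bullet> \<nu> \<and> x \<bullet> \<nu> \<le> u} =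
    (\<integral>\<^sup>+x. indicator {x. norm (hproj \<nu> x) \<le> r \<and> l \<le> x \<bullet> \<nu> \<and> x \<bullet> \<nu> \<le> u} x \<partial>lborel)"
    by (rule nn_integral_indicator[symmetric]) simp
  also have "\<dots> = (\<integral>\<^sup>+x. indicator {l..u} (x \<bullet> \<nu>) * indicator {x. norm (hproj \<nu> x) \<le> r} x \<partial>lborel)"
    by (intro nn_integral_cong) (auto simp: indicator_def)
  also have "\<dots> = (\<integral>\<^sup>+t. indicator {l..u} t * ennreal (unit_ball_vol (DIM('a) - 1) * r ^ (DIM('a) - 1)) \<partial>lborel)"
    using r by (intro nn_integral_cylindrical nu) auto
  also have "\<dots> = ennreal ((u - l) * (unit_ball_vol (DIM('a) - 1) * r ^ (DIM('a) - 1)))"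
    using r \<open>l \<le> u\<close> by (simp add: nn_integral_multc ennreal_mult)
  finally show ?thesis .
qed

text \<open>
  The volume of the \<open>d\<close>-dimensional slice of a ball of radius \<open>r\<close> by a hyperplane at distance
  \<open>|t|\<close> from its centre.
\<close>

definition disc_volume :: "nat \<Rightarrow> real \<Rightarrow> real \<Rightarrow> real" where
  "disc_volume d r t = (if \<bar>t\<bar> < r then unit_ball_vol d * sqrt (r\<^sup>2 - t\<^sup>2) ^ d else 0)"

lemma nn_integral_ball_slices:
  fixes \<nu> :: "'a::euclidean_space"
  assumes nu: "norm \<nu> = 1" and g[measurable]: "g \<in> borel_measurable borel"
  shows "(\<integral>\<^sup>+x. g (x \<bullet> \<nu>) * indicator (ball 0 r) x \<partial>lborel) =
     (\<integral>\<^sup>+t. g t * ennreal (disc_volume (DIM('a) - 1) r t) \<partial>lborel)"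
proof -
  let ?g = "\<lambda>t. g t * indicator {t. \<bar>t\<bar> < r} t"
  let ?\<rho> = "\<lambda>t. sqrt (r\<^sup>2 - t\<^sup>2)"
  have sq: "(norm x)\<^sup>2 = (norm (hproj \<nu> x))\<^sup>2 + (x \<bullet> \<nu>)\<^sup>2" for x
  proof -
    have "\<nu> \<bullet> \<nu> = 1" using nu by (simp add: norm_eq_1)
    then show ?thesis
      unfolding power2_norm_eq_inner
      by (simp add: hproj_def inner_diff_left inner_diff_right inner_commute power2_eq_square)
  qed
  have nul: "AE x in lborel. x \<notin> sphere (0::'a) r"
    using negligible_sphere[of "0::'a" r]
    by (intro AE_not_in) (simp add: negligible_iff_null_sets null_sets_completion_iff)
  have "(\<integral>\<^sup>+x. g (x \<bullet> \<nu>) * indicator (ball 0 r) x \<partial>lborel) =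
     (\<integral>\<^sup>+x. ?g (x \<bullet> \<nu>) * indicator {x. norm (hproj \<nu> x) \<le> ?\<rho> (x \<bullet> \<nu>)} x \<partial>lborel)"
  proof (rule nn_integral_cong_AE)
    show "AE x in lborel. g (x \<bullet> \<nu>) * indicator (ball 0 r) x =
       ?g (x \<bullet> \<nu>) * indicator {x. norm (hproj \<nu> x) \<le> ?\<rho> (x \<bullet> \<nu>)} x"
      using nul
    proof eventually_elim
      case (elim x)
      show ?case
      proof (cases "\<bar>x \<bullet> \<nu>\<bar> < r")
        case True
        then have r: "0 < r" by linarith
        have "norm (hproj \<nu> x) \<le> ?\<rho> (x \<bullet> \<nu>) \<longleftrightarrow> (norm (hproj \<nu> x))\<^sup>2 \<le> r\<^sup>2 - (x \<bullet> \<nu>)\<^sup>2"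
          by (metis abs_norm_cancel real_sqrt_abs real_sqrt_le_iff)
        also have "\<dots> \<longleftrightarrow> norm x \<le> r" using abs_le_square_iff[of "norm x" r] sq[of x] r by (simp add: le_diff_eq add.commute)
        also have "\<dots> \<longleftrightarrow> x \<in> ball 0 r" using elim by auto
        finally show ?thesis using True by (auto simp: indicator_def)
      next
        case False
        then have "\<not> norm x < r" using Cauchy_Schwarz_ineq2[of x \<nu>] nu by auto
        then show ?thesis using False by (auto simp: indicator_def)
      qed
    qed
  qed
  also have "\<dots> = (\<integral>\<^sup>+t. ?g t * ennreal (unit_ball_vol (DIM('a) - 1) * ?\<rho> t ^ (DIM('a) - 1)) \<partial>lborel)"
  proof (rule nn_integral_cylindrical[OF nu])
    show "?g t = 0 \<or> 0 < ?\<rho> t" for t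
      using power_strict_mono[of "\<bar>t\<bar>" r 2] by (auto simp: indicator_def)
  qed measurable
  also have "\<dots> = (\<integral>\<^sup>+t. g t * ennreal (disc_volume (DIM('a) - 1) r t) \<partial>lborel)"
    by (intro nn_integral_cong) (simp add: disc_volume_def indicator_def)
  finally show ?thesis .
qed

lemma emeasure_cball_slices:
  fixes \<nu> :: "'a::euclidean_space"
  assumes nu: "norm \<nu> = 1" and r: "0 \<le> r"
  shows "(\<integral>\<^sup>+t. ennreal (disc_volume (DIM('a) - 1) r (t - c)) \<partial>lborel) = emeasure lborel (cball (x::'a) r)"
proof -
  have [measurable]: "disc_volume n r \<in> borel_measurable borel" for n
    unfolding disc_volume_def by measurable
  have "(\<integral>\<^sup>+t. ennreal (disc_volume (DIM('a) - 1) r (t - c)) \<partial>lborel)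
     = (\<integral>\<^sup>+t. ennreal (disc_volume (DIM('a) - 1) r t) \<partial>lborel)"
    by (subst (2) nn_integral_real_affine[where c=1 and t="-c"]) (simp_all add: add.commute)
  also have "\<dots> = (\<integral>\<^sup>+x. 1 * indicator (ball (0::'a) r) x \<partial>lborel)"
    by (subst nn_integral_ball_slices[OF nu]) simp_all
  also have "\<dots> = emeasure lborel (cball x r)"
    using r by (simp add: emeasure_cball emeasure_ball)
  finally show ?thesis .
qed

text \<open>
  The slice at height \<open>t\<close> has volume proportional to \<open>sqrt (1 - t\<^sup>2) ^ d\<close>, and
  \<open>- sqrt (1 - t\<^sup>2) ^ (d + 2) / (d + 2)\<close> is a primitive of \<open>t * sqrt (1 - t\<^sup>2) ^ d\<close>. Half of the ball
  gives half of the integral. This value is what makes the limit equal to the area itself.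
\<close>

lemma nn_integral_ball_abs_inner:
  fixes \<nu> :: "'a::euclidean_space"
  assumes nu: "norm \<nu> = 1" and dim: "2 \<le> DIM('a)"
  shows "(\<integral>\<^sup>+x. ennreal \<bar>x \<bullet> \<nu>\<bar> * indicator (ball 0 1) x \<partial>lborel) =
     ennreal (2 * unit_ball_vol (DIM('a) - 1) / (DIM('a) + 1))"
proof -
  define d where "d = DIM('a) - 1"
  have d: "0 < d" "DIM('a) = d + 1" using dim by (auto simp: d_def)
  let ?f = "\<lambda>t. t * sqrt (1 - t\<^sup>2) ^ d"
  let ?F = "\<lambda>t::real. - (sqrt (1 - t\<^sup>2) ^ (d + 2)) / (d + 2)"
  have F0: "continuous_on UNIV ?F" by (intro continuous_intros) auto
  have lim: "(?F \<longlongrightarrow> ?F a) (at a within S)" for a S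
    using F0 by (meson continuous_on_def UNIV_I tendsto_within_subset subset_UNIV)
  have DF: "DERIV ?F t :> ?f t" if "0 < t" "t < 1" for t
  proof -
    have p: "0 < 1 - t\<^sup>2" using that by (simp add: power_less_one_iff abs_square_less_1)
    then have s: "0 < sqrt (1 - t\<^sup>2)" by simp
    have "DERIV (\<lambda>t. sqrt (1 - t\<^sup>2)) t :> - (t / sqrt (1 - t\<^sup>2))"
      using p by (auto intro!: derivative_eq_intros simp: field_simps)
    from DERIV_cdivide[OF DERIV_minus[OF DERIV_power[OF this, of "d + 2"]], of "real (d + 2)"]
    have "DERIV ?F t :> - (real (d + 2) * (- (t / sqrt (1 - t\<^sup>2)) * sqrt (1 - t\<^sup>2) ^ (d + 1))) / real (d + 2)"
      by simp
    also have "- (real (d + 2) * (- (t / sqrt (1 - t\<^sup>2)) * sqrt (1 - t\<^sup>2) ^ (d + 1))) / real (d + 2) = ?f t"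
      using s by simp
    finally show ?thesis .
  qed
  have fnn: "0 \<le> ?f t" if "0 < t" "t < 1" for t
    using that by (auto simp: abs_square_le_1)
  have FTC: "set_integrable lborel (einterval (ereal 0) (ereal 1)) ?f" "(LBINT t=ereal 0..ereal 1. ?f t) = ?F 1 - ?F 0"
  proof -
    have A: "((?F \<circ> real_of_ereal) \<longlongrightarrow> ?F 0) (at_right (ereal 0))" "((?F \<circ> real_of_ereal) \<longlongrightarrow> ?F 1) (at_left (ereal 1))"
      by (simp_all only: ereal_tendsto_simps lim)
    show "set_integrable lborel (einterval (ereal 0) (ereal 1)) ?f"
      by (rule interval_integral_FTC_nonneg(1)[OF _ DF _ _ A]) (auto intro!: continuous_intros fnn AE_I2 simp: einterval_def)
    show "(LBINT t=ereal 0..ereal 1. ?f t) = ?F 1 - ?F 0"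
      by (rule interval_integral_FTC_nonneg(2)[OF _ DF _ _ A]) (auto intro!: continuous_intros fnn AE_I2 simp: einterval_def)
  qed
  have half: "(\<integral>\<^sup>+t. ennreal (?f t) * indicator {0<..<1} t \<partial>lborel) = ennreal (1 / (d + 2))"
  proof -
    have "(\<integral>\<^sup>+t. ennreal (?f t) * indicator {0<..<1} t \<partial>lborel) = (\<integral>\<^sup>+t. ennreal (indicator {0<..<1} t * ?f t) \<partial>lborel)"
      by (intro nn_integral_cong) (auto simp: indicator_def)
    also have "\<dots> = ennreal (\<integral>t. indicator {0<..<1} t * ?f t \<partial>lborel)"
    proof (rule nn_integral_eq_integral)
      show "integrable lborel (\<lambda>t. indicator {0<..<1} t * ?f t)"
        using FTC(1) by (simp add: set_integrable_def einterval_def greaterThanLessThan_def greaterThan_def lessThan_def Collect_conj_eq)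
      show "AE t in lborel. 0 \<le> indicator {0<..<1} t * ?f t"
        using fnn by (auto simp: indicator_def)
    qed
    also have "(\<integral>t. indicator {0<..<1} t * ?f t \<partial>lborel) = ?F 1 - ?F 0"
      using FTC(2) by (simp add: interval_lebesgue_integral_def set_lebesgue_integral_def einterval_def greaterThanLessThan_def greaterThan_def lessThan_def Collect_conj_eq)
    finally show ?thesis by simp
  qed
  let ?h = "\<lambda>t. ennreal \<bar>t\<bar> * ennreal (disc_volume d 1 t)"
  have m[measurable]: "disc_volume n r \<in> borel_measurable borel" for n r
    unfolding disc_volume_def by measurable
  let ?V = "ennreal (unit_ball_vol d)"
  have "(\<integral>\<^sup>+x. ennreal \<bar>x \<bullet> \<nu>\<bar> * indicator (ball 0 1) x \<partial>lborel) = (\<integral>\<^sup>+t. ?h t \<partial>lborel)"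
    unfolding d_def by (rule nn_integral_ball_slices[OF nu]) measurable
  also have "\<dots> = (\<integral>\<^sup>+t. ?V * (ennreal (?f t) * indicator {0<..<1} t) + ?V * (ennreal (?f (-t)) * indicator {0<..<1} (-t)) \<partial>lborel)"
    by (intro nn_integral_cong) (auto simp: disc_volume_def indicator_def abs_if mult_ac simp flip: ennreal_mult')
  also have "\<dots> = (\<integral>\<^sup>+t. ?V * (ennreal (?f t) * indicator {0<..<1} t) \<partial>lborel)
      + (\<integral>\<^sup>+t. ?V * (ennreal (?f (-t)) * indicator {0<..<1} (-t)) \<partial>lborel)"
    by (rule nn_integral_add) measurable
  also have "(\<integral>\<^sup>+t. ?V * (ennreal (?f (-t)) * indicator {0<..<1} (-t)) \<partial>lborel)
      = (\<integral>\<^sup>+t. ?V * (ennreal (?f t) * indicator {0<..<1} t) \<partial>lborel)"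
    by (subst (2) nn_integral_real_affine[where c="-1" and t=0]) auto
  also have "(\<integral>\<^sup>+t. ?V * (ennreal (?f t) * indicator {0<..<1} t) \<partial>lborel) = ?V * ennreal (1 / (d + 2))"
    by (subst nn_integral_cmult) (auto simp: half)
  also have "?V * ennreal (1 / (d + 2)) + ?V * ennreal (1 / (d + 2)) = ennreal (2 * unit_ball_vol d / (d + 2))"
    by (simp flip: ennreal_mult ennreal_plus)
  finally show ?thesis unfolding d_def[symmetric] d(2) by (simp add: add.commute)
qed

lemma norm_hproj_le:
  assumes "norm \<nu> = 1" shows "norm (hproj \<nu> x) \<le> norm x"
proof -
  have "\<nu> \<bullet> \<nu> = 1" using assms by (simp add: norm_eq_1)
  then have "hproj \<nu> x \<bullet> hproj \<nu> x = x \<bullet> x - (x \<bullet> \<nu>)\<^sup>2"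
    by (simp add: hproj_def inner_diff_left inner_diff_right inner_commute power2_eq_square)
  then have "hproj \<nu> x \<bullet> hproj \<nu> x \<le> x \<bullet> x" by simp
  then show ?thesis by (simp add: norm_le)
qed

lemma emeasure_ball_strip_le:
  fixes \<nu> :: "'a::euclidean_space"
  assumes nu: "norm \<nu> = 1" and \<beta>: "0 \<le> \<beta>"
  shows "emeasure lborel {x \<in> ball 0 1. \<bar>x \<bullet> \<nu>\<bar> \<le> \<beta>} \<le> ennreal (2 * \<beta> * unit_ball_vol (DIM('a) - 1))"
proof -
  have sub: "{x \<in> ball 0 1. \<bar>x \<bullet> \<nu>\<bar> \<le> \<beta>} \<subseteq> {x. norm (hproj \<nu> x) \<le> 1 \<and> -\<beta> \<le> x \<bullet> \<nu> \<and> x \<bullet> \<nu> \<le> \<beta>}"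
  proof clarify
    fix x :: 'a assume x: "x \<in> ball 0 1" "\<bar>x \<bullet> \<nu>\<bar> \<le> \<beta>"
    have "norm (hproj \<nu> x) \<le> norm x" by (rule norm_hproj_le[OF nu])
    then show "norm (hproj \<nu> x) \<le> 1 \<and> -\<beta> \<le> x \<bullet> \<nu> \<and> x \<bullet> \<nu> \<le> \<beta>" using x by auto
  qed
  have "emeasure lborel {x \<in> ball 0 1. \<bar>x \<bullet> \<nu>\<bar> \<le> \<beta>} \<le> emeasure lborel {x. norm (hproj \<nu> x) \<le> 1 \<and> -\<beta> \<le> x \<bullet> \<nu> \<and> x \<bullet> \<nu> \<le> \<beta>}"
    by (rule emeasure_mono[OF sub]) simp
  also have "\<dots> = ennreal (2 * \<beta> * unit_ball_vol (DIM('a) - 1))"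
    using \<beta> by (subst emeasure_cylinder[OF nu]) (simp_all add: mult.assoc)
  finally show ?thesis .
qed

text \<open>
  The points \<open>x\<close> for which the segment from \<open>x\<close> to \<open>x + v\<close> meets \<open>E\<close>.
\<close>

definition sweep :: "'a::euclidean_space set \<Rightarrow> 'a \<Rightarrow> 'a set" where
  "sweep E v = (\<lambda>(p, t). p - t *\<^sub>R v) ` (E \<times> {0..1})"

text \<open>
  Scaling by \<open>- (v \<bullet> \<nu>)\<close> along \<open>\<nu>\<close> followed by a shear parallel to the hyperplane maps the upright slab
  over \<open>A\<close> to the oblique one.
\<close>

lemma emeasure_sweep_hyperplane:
  fixes \<nu> v :: "'a::euclidean_space"
  assumes nu: "norm \<nu> = 1" and A: "\<And>u. u \<in> A \<Longrightarrow> u \<bullet> \<nu> = 0" and v: "v \<bullet> \<nu> \<noteq> 0"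
    and S[measurable]: "sweep A v \<in> sets borel"
  shows "sweep A (-\<nu>) \<in> sets borel"
    and "emeasure lborel (sweep A v) = ennreal \<bar>v \<bullet> \<nu>\<bar> * emeasure lborel (sweep A (-\<nu>))"
proof -
  define a where "a = v \<bullet> \<nu>"
  define w where "w = v - a *\<^sub>R \<nu>"
  define M where "M x = x - (x \<bullet> \<nu>) *\<^sub>R (\<nu> + v)" for x
  have nn: "\<nu> \<bullet> \<nu> = 1" using nu by (simp add: norm_eq_1)
  have a: "a \<noteq> 0" using v by (simp add: a_def)
  have [measurable]: "M \<in> borel_measurable borel" unfolding M_def by measurable
  have M: "M x \<in> sweep A v \<longleftrightarrow> x \<in> sweep A (-\<nu>)" for x
  proof
    assume "x \<in> sweep A (-\<nu>)"
    then obtain u t where ut: "u \<in> A" "0 \<le> t" "t \<le> 1" "x = u + t *\<^sub>R \<nu>" by (auto simp: sweep_def)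
    then have "M x = u - t *\<^sub>R v" using A[of u] nn by (simp add: M_def inner_add_left algebra_simps)
    then show "M x \<in> sweep A v" using ut by (auto simp: sweep_def)
  next
    assume "M x \<in> sweep A v"
    then obtain u t where ut: "u \<in> A" "0 \<le> t" "t \<le> 1" "M x = u - t *\<^sub>R v" by (auto simp: sweep_def)
    have "M x \<bullet> \<nu> = - (x \<bullet> \<nu>) * a" using nn by (simp add: M_def a_def inner_diff_left inner_add_left algebra_simps)
    moreover have "M x \<bullet> \<nu> = - t * a" using A[OF ut(1)] ut(4) by (simp add: a_def inner_diff_left)
    ultimately have t: "t = x \<bullet> \<nu>" using a by simp
    then have "x = u + t *\<^sub>R \<nu>" using ut(4) by (simp add: M_def algebra_simps)
    then show "x \<in> sweep A (-\<nu>)" using ut by (force simp: sweep_def)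
  qed
  then have "sweep A (-\<nu>) = M -` sweep A v \<inter> space borel" by auto
  then show S': "sweep A (-\<nu>) \<in> sets borel"
    using measurable_sets[of M borel borel "sweep A v"] by simp
  define T where "T y = y + ((y \<bullet> \<nu>) / a) *\<^sub>R w" for y
  have TT: "T (x + ((- a - 1) * (x \<bullet> \<nu>) + 0) *\<^sub>R \<nu>) = M x" for x
    using a nn by (simp add: T_def M_def w_def inner_add_left algebra_simps)
  have [measurable]: "T \<in> borel_measurable borel" unfolding T_def using a by measurable
  have shear: "(\<integral>\<^sup>+x. f x \<partial>lborel) = (\<integral>\<^sup>+x. f (T x) \<partial>lborel)" if [measurable]: "f \<in> borel_measurable borel" for f
  proof (cases "w = 0")
    case False
    have wn: "w \<bullet> \<nu> = 0" by (simp add: w_def inner_diff_left nn a_def)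
    have "(\<integral>\<^sup>+x. f x \<partial>lborel) = ennreal \<bar>1\<bar> * (\<integral>\<^sup>+x. f (x + ((1 - 1) * (x \<bullet> (w /\<^sub>R norm w)) + ((x \<bullet> \<nu>) / a) * norm w) *\<^sub>R (w /\<^sub>R norm w)) \<partial>lborel)"
      using False wn a by (intro nn_integral_affine_along) (auto simp: inner_add_left)
    moreover have "x + ((1 - 1) * (x \<bullet> (w /\<^sub>R norm w)) + ((x \<bullet> \<nu>) / a) * norm w) *\<^sub>R (w /\<^sub>R norm w) = T x" for x
      using False a by (auto simp: T_def field_simps)
    ultimately show ?thesis by simp
  qed (simp add: T_def)
  have "emeasure lborel (sweep A v) = (\<integral>\<^sup>+x. indicator (sweep A v) x \<partial>lborel)"
    by (simp add: nn_integral_indicator)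
  also have "\<dots> = (\<integral>\<^sup>+x. indicator (sweep A v) (T x) \<partial>lborel)" by (rule shear) measurable
  also have "\<dots> = ennreal \<bar>- a\<bar> * (\<integral>\<^sup>+x. indicator (sweep A v) (T (x + ((- a - 1) * (x \<bullet> \<nu>) + 0) *\<^sub>R \<nu>)) \<partial>lborel)"
    using a by (intro nn_integral_affine_along[OF nu]) auto
  also have "\<dots> = ennreal \<bar>a\<bar> * (\<integral>\<^sup>+x. indicator (sweep A (-\<nu>)) x \<partial>lborel)"
    unfolding TT by (simp add: indicator_def M)
  also have "\<dots> = ennreal \<bar>a\<bar> * emeasure lborel (sweep A (-\<nu>))"
    using S' by (simp add: nn_integral_indicator)
  finally show "emeasure lborel (sweep A v) = ennreal \<bar>v \<bullet> \<nu>\<bar> * emeasure lborel (sweep A (-\<nu>))"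
    by (simp add: a_def)
qed

section \<open>The isodiametric inequality\<close>

lemma inner_compact_real:
  fixes A :: "real set"
  assumes A: "A \<in> sets borel" "a \<in> A" and e: "0 < (e::real)"
  obtains K where "compact K" "K \<noteq> {}" "K \<subseteq> A" "emeasure lborel (A \<inter> {-N..N}) \<le> emeasure lborel K + ennreal e"
proof -
  have S: "A \<inter> {-N..N} \<in> sets lebesgue" using A by (intro sets_completionI_sets) auto
  obtain T where T: "closed T" "T \<subseteq> A \<inter> {-N..N}" "emeasure lebesgue (A \<inter> {-N..N} - T) < ennreal e"
    by (rule sets_lebesgue_inner_closed[OF S e])
  have cT: "compact T" using T(1,2) bounded_subset[of "{-N..N}" T] by (auto simp: compact_eq_bounded_closed)
  have Tb: "T \<in> sets borel" using T(1) by auto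
  show ?thesis
  proof
    show "compact (insert a T)" using cT by auto
    have "emeasure lborel (A \<inter> {-N..N}) = emeasure lborel (T \<union> (A \<inter> {-N..N} - T))"
      using T(2) by (metis Un_Diff_cancel sup.absorb2)
    also have "\<dots> \<le> emeasure lborel T + emeasure lborel (A \<inter> {-N..N} - T)"
      using A Tb by (intro emeasure_subadditive) auto
    also have "\<dots> \<le> emeasure lborel (insert a T) + ennreal e"
    proof (intro add_mono)
      show "emeasure lborel T \<le> emeasure lborel (insert a T)" using Tb by (intro emeasure_mono) auto
      have "A \<inter> {-N..N} - T \<in> sets lborel" using A Tb by auto
      then show "emeasure lborel (A \<inter> {-N..N} - T) \<le> ennreal e" using T(3) by simp
    qed
    finally show "emeasure lborel (A \<inter> {-N..N}) \<le> emeasure lborel (insert a T) + ennreal e" .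
  qed (use A T in auto)
qed

lemma emeasure_lborel_translation:
  fixes A :: "real set" assumes "A \<in> sets borel"
  shows "emeasure lborel ((\<lambda>x. x + c) ` A) = emeasure lborel A" "(\<lambda>x. x + c) ` A \<in> sets borel"
proof -
  have eq: "(\<lambda>x. x + c) ` A = (+) (-c) -` A \<inter> space borel"
    by (auto intro: image_eqI[where x="- c + _"])
  show *: "(\<lambda>x. x + c) ` A \<in> sets borel"
    unfolding eq using assms by (intro measurable_sets[of _ borel borel]) auto
  have "emeasure lborel A = emeasure (distr lborel borel ((+) (-c))) A" by (simp add: lborel_distr_plus)
  also have "\<dots> = emeasure lborel ((+) (-c) -` A \<inter> space borel)" using assms by (subst emeasure_distr) auto
  finally show "emeasure lborel ((\<lambda>x. x + c) ` A) = emeasure lborel A" by (simp only: eq)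
qed

lemma emeasure_half_real:
  fixes C :: "real set" assumes [measurable]: "C \<in> sets borel"
  shows "emeasure lborel {x. x / 2 \<in> C} = 2 * emeasure lborel C"
proof -
  have "emeasure lborel {x. x / 2 \<in> C} = (\<integral>\<^sup>+x. indicator {x. x / 2 \<in> C} x \<partial>lborel)"
    by (rule nn_integral_indicator[symmetric]) simp
  also have "\<dots> = ennreal \<bar>2\<bar> * (\<integral>\<^sup>+x. indicator {x. x / 2 \<in> C} (0 + 2 * x) \<partial>lborel)"
    by (rule nn_integral_real_affine) auto
  also have "(\<integral>\<^sup>+x. indicator {x. x / 2 \<in> C} (0 + 2 * x) \<partial>lborel) = (\<integral>\<^sup>+x. indicator C x \<partial>lborel)"
    by (intro nn_integral_cong) (auto simp: indicator_def)
  also have "\<dots> = emeasure lborel C" by (rule nn_integral_indicator) simp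
  finally show ?thesis by simp
qed

text \<open>
  The one-dimensional Brunn-Minkowski inequality: \<open>K\<close> translated by the least element of \<open>L\<close> and
  \<open>L\<close> translated by the greatest element of \<open>K\<close> both lie in \<open>K + L\<close> and meet in at most one point.
\<close>

lemma midpoint_measure_compact_real:
  fixes K L C :: "real set"
  assumes K: "compact K" "K \<noteq> {}" and L: "compact L" "L \<noteq> {}" and C: "C \<in> sets borel"
    and mid: "\<And>a b. a \<in> K \<Longrightarrow> b \<in> L \<Longrightarrow> (a + b) / 2 \<in> C"
  shows "emeasure lborel K + emeasure lborel L \<le> 2 * emeasure lborel C"
proof -
  obtain k where k: "k \<in> K" "\<And>x. x \<in> K \<Longrightarrow> x \<le> k" using compact_attains_sup[OF K] by blast
  obtain l where l: "l \<in> L" "\<And>x. x \<in> L \<Longrightarrow> l \<le> x" using compact_attains_inf[OF L] by blast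
  have KB: "K \<in> sets borel" and LB: "L \<in> sets borel" using K L by (auto intro: borel_compact)
  let ?K = "(\<lambda>x. x + l) ` K" and ?L = "(\<lambda>x. x + k) ` L - {l + k}"
  have "emeasure lborel L = emeasure lborel ((\<lambda>x. x + k) ` L)"
    using emeasure_lborel_translation[OF LB] by simp
  also have "\<dots> \<le> emeasure lborel (?L \<union> {l + k})"
    using emeasure_lborel_translation(2)[OF LB] by (intro emeasure_mono) auto
  also have "\<dots> \<le> emeasure lborel ?L + emeasure lborel {l + k}"
    using emeasure_lborel_translation(2)[OF LB] by (intro emeasure_subadditive) auto
  finally have 1: "emeasure lborel L \<le> emeasure lborel ?L" by simp
  have "emeasure lborel K + emeasure lborel L \<le> emeasure lborel ?K + emeasure lborel ?L"
    using 1 emeasure_lborel_translation[OF KB] by (intro add_mono) auto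
  also have "\<dots> = emeasure lborel (?K \<union> ?L)"
  proof (rule plus_emeasure)
    show "?K \<inter> ?L = {}" using k(2) l(2) by fastforce
  qed (use emeasure_lborel_translation(2) KB LB in auto)
  also have "\<dots> \<le> emeasure lborel {x. x / 2 \<in> C}"
  proof (rule emeasure_mono)
    show "?K \<union> ?L \<subseteq> {x. x / 2 \<in> C}" using mid[OF _ l(1)] mid[OF k(1)] by (auto simp: add.commute)
    have "(\<lambda>x::real. x / 2) -` C \<inter> space borel \<in> sets borel" using C by (intro measurable_sets[of _ borel borel]) auto
    then show "{x. x / 2 \<in> C} \<in> sets lborel" by (simp add: vimage_def)
  qed
  also have "\<dots> = 2 * emeasure lborel C" by (rule emeasure_half_real[OF C])
  finally show ?thesis .
qed

lemma emeasure_real_exhaust: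
  fixes A :: "real set" assumes "A \<in> sets borel"
  shows "emeasure lborel A = (SUP N::nat. emeasure lborel (A \<inter> {-real N..real N}))"
proof -
  have "(SUP N::nat. emeasure lborel (A \<inter> {-real N..real N})) = emeasure lborel (\<Union>N::nat. A \<inter> {-real N..real N})"
    using assms by (intro SUP_emeasure_incseq) (auto simp: incseq_def)
  also have "(\<Union>N::nat. A \<inter> {-real N..real N}) = A"
  proof (intro equalityI subsetI)
    fix x assume "x \<in> A"
    moreover obtain N :: nat where "\<bar>x\<bar> \<le> real N" using real_arch_simple by blast
    ultimately show "x \<in> (\<Union>N::nat. A \<inter> {-real N..real N})" by (auto intro!: exI[of _ N])
  qed auto
  finally show ?thesis by simp
qed

lemma midpoint_measure_real:
  fixes A B C :: "real set"
  assumes A: "A \<in> sets borel" "A \<noteq> {}" and B: "B \<in> sets borel" "B \<noteq> {}" and C: "C \<in> sets borel"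
    and mid: "\<And>a b. a \<in> A \<Longrightarrow> b \<in> B \<Longrightarrow> (a + b) / 2 \<in> C"
  shows "emeasure lborel A + emeasure lborel B \<le> 2 * emeasure lborel C"
proof -
  obtain a b where ab: "a \<in> A" "b \<in> B" using A B by auto
  have 1: "emeasure lborel (A \<inter> {-N..N}) + emeasure lborel (B \<inter> {-N..N}) \<le> 2 * emeasure lborel C" for N
  proof (rule ennreal_le_epsilon)
    fix e :: real assume e: "0 < e"
    obtain K where K: "compact K" "K \<noteq> {}" "K \<subseteq> A" "emeasure lborel (A \<inter> {-N..N}) \<le> emeasure lborel K + ennreal (e / 2)"
      using inner_compact_real[OF A(1) ab(1), of "e / 2" N] e by auto
    obtain L where L: "compact L" "L \<noteq> {}" "L \<subseteq> B" "emeasure lborel (B \<inter> {-N..N}) \<le> emeasure lborel L + ennreal (e / 2)"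
      using inner_compact_real[OF B(1) ab(2), of "e / 2" N] e by auto
    have "emeasure lborel (A \<inter> {-N..N}) + emeasure lborel (B \<inter> {-N..N})
       \<le> (emeasure lborel K + ennreal (e / 2)) + (emeasure lborel L + ennreal (e / 2))"
      using K(4) L(4) by (rule add_mono)
    also have "\<dots> = (emeasure lborel K + emeasure lborel L) + (ennreal (e / 2) + ennreal (e / 2))"
      by (simp add: ac_simps)
    also have "\<dots> \<le> 2 * emeasure lborel C + ennreal e"
    proof (intro add_mono)
      show "emeasure lborel K + emeasure lborel L \<le> 2 * emeasure lborel C"
        using mid K(3) L(3) by (intro midpoint_measure_compact_real K(1,2) L(1,2) C) auto
    qed (use e in \<open>simp flip: ennreal_plus\<close>)
    finally show "emeasure lborel (A \<inter> {-N..N}) + emeasure lborel (B \<inter> {-N..N}) \<le> 2 * emeasure lborel C + ennreal e" .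
  qed
  have "emeasure lborel A + emeasure lborel B =
     (SUP N::nat. emeasure lborel (A \<inter> {-real N..real N}) + emeasure lborel (B \<inter> {-real N..real N}))"
    unfolding emeasure_real_exhaust[OF A(1)] emeasure_real_exhaust[OF B(1)]
    using A B by (intro ennreal_SUP_add[symmetric]) (auto simp: incseq_def intro!: emeasure_mono)
  also have "\<dots> \<le> 2 * emeasure lborel C" by (intro SUP_least 1)
  finally show ?thesis .
qed

lemma ennreal_eq_nn_integral_levels:
  assumes "x \<le> (1::ennreal)"
  shows "x = (\<integral>\<^sup>+t. indicator {0<..<1} t * indicator {t. ennreal t < x} t \<partial>lborel)"
proof -
  obtain r where r: "x = ennreal r" "0 \<le> r" "r \<le> 1"
    using assms by (cases x) (auto simp: top_unique)
  have "(\<integral>\<^sup>+t. indicator {0<..<1} t * indicator {t. ennreal t < x} t \<partial>lborel) = (\<integral>\<^sup>+t. indicator {0<..<r} t \<partial>lborel)"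
    using r by (intro nn_integral_cong) (auto simp: indicator_def ennreal_less_iff)
  also have "\<dots> = x" using r by simp
  finally show ?thesis by simp
qed

lemma ennreal_ge_nn_integral_levels:
  "(\<integral>\<^sup>+t. indicator {0<..<1} t * indicator {t. ennreal t < x} t \<partial>lborel) \<le> x"
proof (cases "x \<le> 1")
  case True
  then show ?thesis using ennreal_eq_nn_integral_levels by simp
next
  case False
  have "(\<integral>\<^sup>+t. indicator {0<..<1} t * indicator {t. ennreal t < x} t \<partial>lborel) \<le> (\<integral>\<^sup>+t. indicator {0<..<1::real} t \<partial>lborel)"
    by (intro nn_integral_mono) (auto simp: indicator_def)
  also have "\<dots> \<le> x" using False by simp
  finally show ?thesis .
qed

lemma nn_integral_levels:
  fixes F :: "real \<Rightarrow> ennreal"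
  assumes [measurable]: "F \<in> borel_measurable borel"
  shows "(\<integral>\<^sup>+x. (\<integral>\<^sup>+t. indicator {0<..<1} t * indicator {t. ennreal t < F x} t \<partial>lborel) \<partial>lborel) =
    (\<integral>\<^sup>+t. indicator {0<..<1} t * emeasure lborel {x. ennreal t < F x} \<partial>lborel)"
proof -
  have "(\<integral>\<^sup>+x. (\<integral>\<^sup>+t. indicator {0<..<1} t * indicator {t. ennreal t < F x} t \<partial>lborel) \<partial>lborel) =
    (\<integral>\<^sup>+t. (\<integral>\<^sup>+x. indicator {0<..<1} t * indicator {t. ennreal t < F x} t \<partial>lborel) \<partial>lborel)"
    by (rule lborel_pair.Fubini'[symmetric]) measurable
  also have "\<dots> = (\<integral>\<^sup>+t. indicator {0<..<1} t * (\<integral>\<^sup>+x. indicator {x. ennreal t < F x} x \<partial>lborel) \<partial>lborel)"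
    by (intro nn_integral_cong) (auto simp: indicator_def)
  also have "\<dots> = (\<integral>\<^sup>+t. indicator {0<..<1} t * emeasure lborel {x. ennreal t < F x} \<partial>lborel)"
    by (intro nn_integral_cong) (subst nn_integral_indicator, auto)
  finally show ?thesis .
qed

text \<open>
  For \<open>t < 1\<close> the superlevel sets of \<open>F\<close> and \<open>G\<close> at height \<open>t\<close> are nonempty, and all midpoints
  between them lie in the superlevel set of \<open>H\<close>. Integrating the one-dimensional
  Brunn-Minkowski inequality over \<open>t\<close> gives the claim.
\<close>

lemma prekopa_leindler_normalized:
  fixes F G H :: "real \<Rightarrow> ennreal"
  assumes [measurable]: "F \<in> borel_measurable borel" "G \<in> borel_measurable borel" "H \<in> borel_measurable borel"
    and F1: "(SUP x. F x) = 1" and G1: "(SUP x. G x) = 1"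
    and le: "\<And>a b. F a * G b \<le> (H ((a + b) / 2))\<^sup>2"
  shows "(\<integral>\<^sup>+x. F x \<partial>lborel) + (\<integral>\<^sup>+x. G x \<partial>lborel) \<le> 2 * (\<integral>\<^sup>+x. H x \<partial>lborel)"
proof -
  have Fle: "F x \<le> 1" "G x \<le> 1" for x using SUP_upper[of x UNIV F] SUP_upper[of x UNIV G] F1 G1 by auto
  let ?I = "indicator {0<..<1::real} :: real \<Rightarrow> ennreal"
  let ?m = "\<lambda>F t. emeasure lborel {x. ennreal t < F x}"
  have "(\<integral>\<^sup>+x. F x \<partial>lborel) + (\<integral>\<^sup>+x. G x \<partial>lborel) = (\<integral>\<^sup>+t. ?I t * ?m F t \<partial>lborel) + (\<integral>\<^sup>+t. ?I t * ?m G t \<partial>lborel)"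
    by (simp add: nn_integral_levels[symmetric] ennreal_eq_nn_integral_levels[OF Fle(1), symmetric] ennreal_eq_nn_integral_levels[OF Fle(2), symmetric])
  also have "\<dots> = (\<integral>\<^sup>+t. ?I t * ?m F t + ?I t * ?m G t \<partial>lborel)"
    by (rule nn_integral_add[symmetric]) measurable
  also have "\<dots> \<le> (\<integral>\<^sup>+t. 2 * (?I t * ?m H t) \<partial>lborel)"
  proof (intro nn_integral_mono)
    fix t :: real
    show "?I t * ?m F t + ?I t * ?m G t \<le> 2 * (?I t * ?m H t)"
    proof (cases "0 < t \<and> t < 1")
      case True
      then have t1: "ennreal t < 1" by (simp add: ennreal_less_iff flip: ennreal_1)
      obtain a b where ab: "ennreal t < F a" "ennreal t < G b"
        using t1 F1 G1 less_SUP_iff[of "ennreal t" F UNIV] less_SUP_iff[of "ennreal t" G UNIV] by auto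
      have "?m F t + ?m G t \<le> 2 * ?m H t"
      proof (rule midpoint_measure_real)
        fix a b assume "a \<in> {x. ennreal t < F x}" "b \<in> {x. ennreal t < G x}"
        then have ab: "ennreal t < F a" "ennreal t < G b" by auto
        have "(ennreal t)\<^sup>2 < F a * G b"
        proof -
          obtain p q where pq: "F a = ennreal p" "0 \<le> p" "G b = ennreal q" "0 \<le> q"
            using Fle(1)[of a] Fle(2)[of b] by (metis ennreal_cases ennreal_one_neq_top top.extremum_uniqueI)
          have "t < p" "t < q" using ab pq True by (auto simp: ennreal_less_iff)
          then have "t * t < p * q" using True by (intro mult_strict_mono) auto
          then show ?thesis using True pq by (simp add: power2_eq_square ennreal_less_iff flip: ennreal_mult)
        qed
        then have "(ennreal t)\<^sup>2 < (H ((a + b) / 2))\<^sup>2" using le by (rule less_le_trans)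
        then show "(a + b) / 2 \<in> {x. ennreal t < H x}"
          using power_mono[of "H ((a + b) / 2)" "ennreal t" 2] by (auto simp: not_less[symmetric])
      qed (use ab in auto)
      then show ?thesis using True by simp
    qed (auto simp: indicator_def)
  qed
  also have "\<dots> = 2 * (\<integral>\<^sup>+t. ?I t * ?m H t \<partial>lborel)"
    by (rule nn_integral_cmult) measurable
  also have "\<dots> \<le> 2 * (\<integral>\<^sup>+x. H x \<partial>lborel)"
    by (intro mult_left_mono) (auto simp: nn_integral_levels[symmetric] intro!: nn_integral_mono ennreal_ge_nn_integral_levels)
  finally show ?thesis .
qed

text \<open>
  After normalising the suprema to 1 the previous bound compares \<open>\<integral>H\<close> with an arithmetic mean, and
  the inequality between the arithmetic and the geometric mean makes the statement homogeneous.
\<close>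

lemma prekopa_leindler_bounded:
  fixes F G H :: "real \<Rightarrow> ennreal"
  assumes [measurable]: "F \<in> borel_measurable borel" "G \<in> borel_measurable borel" "H \<in> borel_measurable borel"
    and F: "\<And>x. F x \<le> ennreal k" and G: "\<And>x. G x \<le> ennreal k"
    and le: "\<And>a b. F a * G b \<le> (H ((a + b) / 2))\<^sup>2"
  shows "(\<integral>\<^sup>+x. F x \<partial>lborel) * (\<integral>\<^sup>+x. G x \<partial>lborel) \<le> (\<integral>\<^sup>+x. H x \<partial>lborel)\<^sup>2"
proof -
  let ?X = "\<integral>\<^sup>+x. F x \<partial>lborel" and ?Y = "\<integral>\<^sup>+x. G x \<partial>lborel" and ?Z = "\<integral>\<^sup>+x. H x \<partial>lborel"
  have fin: "(SUP x. F x) < top" "(SUP x. G x) < top"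
    using SUP_least[of UNIV F "ennreal k"] SUP_least[of UNIV G "ennreal k"] F G
    by (auto intro: le_less_trans[OF _ ennreal_less_top])
  obtain p q where p: "(SUP x. F x) = ennreal p" "0 \<le> p" and q: "(SUP x. G x) = ennreal q" "0 \<le> q"
    using fin by (metis ennreal_cases less_irrefl)
  show ?thesis
  proof (cases "p = 0 \<or> q = 0 \<or> ?Z = top")
    case True
    have "F x = 0" if "p = 0" for x using that p SUP_upper[of x UNIV F] by simp
    moreover have "G x = 0" if "q = 0" for x using that q SUP_upper[of x UNIV G] by simp
    ultimately show ?thesis using True by auto
  next
    case False
    then have pq: "0 < p" "0 < q" "?Z \<noteq> top" using p q by auto
    define s where "s = sqrt (p * q)"
    have s: "0 < s" "s * s = p * q" using pq by (auto simp: s_def)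
    have "(\<integral>\<^sup>+x. ennreal (1/p) * F x \<partial>lborel) + (\<integral>\<^sup>+x. ennreal (1/q) * G x \<partial>lborel) \<le> 2 * (\<integral>\<^sup>+x. ennreal (1/s) * H x \<partial>lborel)"
    proof (rule prekopa_leindler_normalized)
      show "(SUP x. ennreal (1/p) * F x) = 1" "(SUP x. ennreal (1/q) * G x) = 1"
        using pq p q by (simp_all add: SUP_mult_left_ennreal[symmetric] flip: ennreal_mult)
      show "ennreal (1/p) * F a * (ennreal (1/q) * G b) \<le> (ennreal (1/s) * H ((a + b) / 2))\<^sup>2" for a b
      proof -
        have "ennreal (1/p * (1/q)) = ennreal (1/p) * ennreal (1/q)"
          using pq by (intro ennreal_mult) auto
        then have "ennreal (1/p) * F a * (ennreal (1/q) * G b) = ennreal (1/p * (1/q)) * (F a * G b)"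
          by (simp only: ac_simps)
        also have "\<dots> \<le> ennreal (1/p * (1/q)) * (H ((a + b) / 2))\<^sup>2" by (intro mult_left_mono le) auto
        also have "1/p * (1/q) = (1/s) * (1/s)" using s by simp
        also have "ennreal (1/s * (1/s)) = ennreal (1/s) * ennreal (1/s)"
          using s by (intro ennreal_mult) auto
        finally show ?thesis by (simp only: power2_eq_square ac_simps)
      qed
    qed measurable
    then have *: "ennreal (1/p) * ?X + ennreal (1/q) * ?Y \<le> 2 * (ennreal (1/s) * ?Z)"
      by (simp add: nn_integral_cmult)
    obtain z where z: "?Z = ennreal z" "0 \<le> z" using pq(3) by (cases ?Z) auto
    have "2 * (ennreal (1/s) * ?Z) < top" using z by (simp add: ennreal_mult_less_top)
    with * have "ennreal (1/p) * ?X + ennreal (1/q) * ?Y < top" by (rule le_less_trans)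
    then have "ennreal (1/p) * ?X < top" "ennreal (1/q) * ?Y < top"
      by (simp_all add: ennreal_add_less_top)
    then obtain x y where x: "?X = ennreal x" "0 \<le> x" and y: "?Y = ennreal y" "0 \<le> y"
      using pq by (cases ?X; cases ?Y) (auto simp: ennreal_mult_top)
    have e: "ennreal (1/p) * ?X = ennreal (x/p)" "ennreal (1/q) * ?Y = ennreal (y/q)"
      using x y pq by (simp_all flip: ennreal_mult)
    have "ennreal (2 * (z/s)) = ennreal 2 * ennreal (z/s)"
      using z s by (intro ennreal_mult) auto
    then have "2 * (ennreal (1/s) * ?Z) = ennreal (2 * (z/s))"
      using z s by (simp flip: ennreal_mult)
    moreover have "ennreal (x/p + y/q) = ennreal (x/p) + ennreal (y/q)"
      using x y pq by (intro ennreal_plus) auto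
    ultimately have "ennreal (x/p + y/q) \<le> ennreal (2 * (z/s))"
      using * unfolding e by simp
    then have r: "x/p + y/q \<le> 2 * (z/s)" using z s by (subst (asm) ennreal_le_iff) auto
    have "(a + b)\<^sup>2 - 4 * (a * b) = (a - b)\<^sup>2" for a b :: real
      by (simp add: power2_eq_square algebra_simps)
    then have "4 * (a * b) \<le> (a + b)\<^sup>2" for a b :: real
      by (metis diff_ge_0_iff_ge zero_le_power2)
    then have "4 * ((x/p) * (y/q)) \<le> (x/p + y/q)\<^sup>2" .
    also have "\<dots> \<le> (2 * (z/s))\<^sup>2" using r x y pq by (intro power_mono) auto
    finally have "(x * y) / (p * q) \<le> z\<^sup>2 / (p * q)" using s by (simp add: power2_eq_square)
    then have "x * y \<le> z\<^sup>2" using pq by (simp add: divide_le_cancel)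
    then have "ennreal (x * y) \<le> ennreal (z\<^sup>2)" by (rule ennreal_leI)
    then show ?thesis using x y z by (simp add: ennreal_mult power2_eq_square)
  qed
qed

text \<open>
  Truncation at height \<open>k\<close> reduces this to bounded functions, because it only decreases \<open>F\<close> and \<open>G\<close>.
\<close>

lemma prekopa_leindler_real:
  fixes F G H :: "real \<Rightarrow> ennreal"
  assumes [measurable]: "F \<in> borel_measurable borel" "G \<in> borel_measurable borel" "H \<in> borel_measurable borel"
    and le: "\<And>a b. F a * G b \<le> (H ((a + b) / 2))\<^sup>2"
  shows "(\<integral>\<^sup>+x. F x \<partial>lborel) * (\<integral>\<^sup>+x. G x \<partial>lborel) \<le> (\<integral>\<^sup>+x. H x \<partial>lborel)\<^sup>2"
proof -
  let ?F = "\<lambda>k x. min (F x) (of_nat k)" and ?G = "\<lambda>k x. min (G x) (of_nat k)"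
  have sup: "(SUP k. \<integral>\<^sup>+x. min (F x) (of_nat k) \<partial>lborel) = (\<integral>\<^sup>+x. F x \<partial>lborel)"
    if [measurable]: "F \<in> borel_measurable borel" for F :: "real \<Rightarrow> ennreal"
  proof -
    have "(SUP k. \<integral>\<^sup>+x. min (F x) (of_nat k) \<partial>lborel) = (\<integral>\<^sup>+x. (SUP k. min (F x) (of_nat k)) \<partial>lborel)"
      by (rule nn_integral_monotone_convergence_SUP[symmetric])
         (auto simp: incseq_def le_fun_def min.coboundedI2 intro: min.mono)
    moreover have "(SUP k. min (F x) (of_nat k)) = F x" for x
    proof -
      have "(SUP k. inf (F x) (of_nat k)) = inf (F x) (SUP k. of_nat k)" by (rule inf_SUP[symmetric])
      then show ?thesis by (simp add: ennreal_SUP_of_nat_eq_top inf_min)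
    qed
    ultimately show ?thesis by simp
  qed
  have b: "(\<integral>\<^sup>+x. ?F k x \<partial>lborel) * (\<integral>\<^sup>+x. ?G k x \<partial>lborel) \<le> (\<integral>\<^sup>+x. H x \<partial>lborel)\<^sup>2" for k
  proof (rule prekopa_leindler_bounded[where k="real k"])
    show "?F k a * ?G k b \<le> (H ((a + b) / 2))\<^sup>2" for a b
      by (rule order_trans[OF mult_mono le]) auto
  qed (auto simp: ennreal_of_nat_eq_real_of_nat)
  have mono: "(\<integral>\<^sup>+x. min (F x) (of_nat k) \<partial>lborel) \<le> (\<integral>\<^sup>+x. min (F x) (of_nat l) \<partial>lborel)" if "k \<le> l" for k l and F :: "real \<Rightarrow> ennreal"
    using that by (intro nn_integral_mono min.mono) auto
  have "(\<integral>\<^sup>+x. F x \<partial>lborel) * (\<integral>\<^sup>+x. G x \<partial>lborel) = (SUP l. SUP k. (\<integral>\<^sup>+x. ?F k x \<partial>lborel) * (\<integral>\<^sup>+x. ?G l x \<partial>lborel))"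
    unfolding sup[OF assms(1), symmetric] sup[OF assms(2), symmetric]
    by (simp only: SUP_mult_right_ennreal SUP_mult_left_ennreal)
  also have "\<dots> \<le> (\<integral>\<^sup>+x. H x \<partial>lborel)\<^sup>2"
  proof (intro SUP_least)
    fix k l :: nat
    have "(\<integral>\<^sup>+x. ?F k x \<partial>lborel) * (\<integral>\<^sup>+x. ?G l x \<partial>lborel) \<le> (\<integral>\<^sup>+x. ?F (max k l) x \<partial>lborel) * (\<integral>\<^sup>+x. ?G (max k l) x \<partial>lborel)"
      by (intro mult_mono mono) auto
    also note b
    finally show "(\<integral>\<^sup>+x. ?F k x \<partial>lborel) * (\<integral>\<^sup>+x. ?G l x \<partial>lborel) \<le> (\<integral>\<^sup>+x. H x \<partial>lborel)\<^sup>2" .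
  qed
  finally show ?thesis .
qed

text \<open>
  The product form of the inequality passes to the marginals: for fixed values \<open>a\<close> and \<open>b\<close> of the new
  coordinate the induction hypothesis applies to the sections of \<open>f\<close>, \<open>g\<close> and \<open>h\<close> at \<open>a\<close>, \<open>b\<close>
  and \<open>(a + b) / 2\<close>, and its conclusion is the hypothesis of the one-dimensional inequality.
\<close>

lemma prekopa_leindler_PiM:
  fixes f g h :: "('i \<Rightarrow> real) \<Rightarrow> ennreal"
  assumes "finite I"
    and "f \<in> borel_measurable (\<Pi>\<^sub>M i\<in>I. lborel)" "g \<in> borel_measurable (\<Pi>\<^sub>M i\<in>I. lborel)" "h \<in> borel_measurable (\<Pi>\<^sub>M i\<in>I. lborel)"
    and "\<And>x y. x \<in> extensional I \<Longrightarrow> y \<in> extensional I \<Longrightarrow> f x * g y \<le> (h (\<lambda>i\<in>I. (x i + y i) / 2))\<^sup>2"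
  shows "(\<integral>\<^sup>+x. f x \<partial>(\<Pi>\<^sub>M i\<in>I. lborel)) * (\<integral>\<^sup>+x. g x \<partial>(\<Pi>\<^sub>M i\<in>I. lborel)) \<le> (\<integral>\<^sup>+x. h x \<partial>(\<Pi>\<^sub>M i\<in>I. lborel))\<^sup>2"
  using assms
proof (induction I arbitrary: f g h rule: finite_induct)
  case empty
  have "f (\<lambda>_. undefined) * g (\<lambda>_. undefined) \<le> (h (\<lambda>i\<in>{}. (undefined + undefined) / 2))\<^sup>2"
    using empty.prems(4)[of "\<lambda>_. undefined" "\<lambda>_. undefined"] by simp
  then show ?case by (simp add: lborel_product.nn_integral_empty restrict_def)
next
  case (insert i I)
  note [measurable] = insert.prems(1-3)
  let ?P = "\<Pi>\<^sub>M i\<in>I. lborel :: real measure"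
  have m: "(\<lambda>x. f (x(i := a))) \<in> borel_measurable ?P" if "f \<in> borel_measurable (\<Pi>\<^sub>M i\<in>insert i I. lborel)" for f :: "('i \<Rightarrow> real) \<Rightarrow> ennreal" and a
    using that by measurable
  have m2: "(\<lambda>a. \<integral>\<^sup>+x. f (x(i := a)) \<partial>?P) \<in> borel_measurable borel"
    if [measurable]: "f \<in> borel_measurable (\<Pi>\<^sub>M i\<in>insert i I. lborel)" for f :: "('i \<Rightarrow> real) \<Rightarrow> ennreal"
  proof -
    interpret finite_product_sigma_finite "\<lambda>_. lborel :: real measure" I by standard (rule insert.hyps(1))
    have "(\<lambda>a. \<integral>\<^sup>+x. f (x(i := a)) \<partial>?P) \<in> borel_measurable lborel" by measurable
    then show ?thesis by simp
  qed
  have "(\<integral>\<^sup>+a. (\<integral>\<^sup>+x. f (x(i := a)) \<partial>?P) \<partial>lborel) * (\<integral>\<^sup>+a. (\<integral>\<^sup>+x. g (x(i := a)) \<partial>?P) \<partial>lborel) \<le> (\<integral>\<^sup>+a. (\<integral>\<^sup>+x. h (x(i := a)) \<partial>?P) \<partial>lborel)\<^sup>2"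
  proof (rule prekopa_leindler_real)
    fix a b :: real
    show "(\<integral>\<^sup>+x. f (x(i := a)) \<partial>?P) * (\<integral>\<^sup>+x. g (x(i := b)) \<partial>?P) \<le> (\<integral>\<^sup>+x. h (x(i := (a + b) / 2)) \<partial>?P)\<^sup>2"
    proof (rule insert.IH)
      fix x y :: "'i \<Rightarrow> real" assume xy: "x \<in> extensional I" "y \<in> extensional I"
      have "x(i := a) \<in> extensional (insert i I)" "y(i := b) \<in> extensional (insert i I)"
        using xy by (auto simp: extensional_def)
      note insert.prems(4)[OF this]
      also have "(\<lambda>j\<in>insert i I. ((x(i := a)) j + (y(i := b)) j) / 2) = (\<lambda>j\<in>I. (x j + y j) / 2)(i := (a + b) / 2)"
        using insert.hyps(2) by (auto simp: fun_eq_iff)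
      finally show "f (x(i := a)) * g (y(i := b)) \<le> (h ((\<lambda>j\<in>I. (x j + y j) / 2)(i := (a + b) / 2)))\<^sup>2" .
    qed (intro m insert.prems)+
  qed (intro m2 insert.prems)+
  then show ?case
    using insert.hyps insert.prems(1-3) by (simp add: lborel_product.product_nn_integral_insert_rev)
qed

lemma brunn_minkowski_half:
  fixes X Y Z :: "'a::euclidean_space set"
  assumes [measurable]: "X \<in> sets borel" "Y \<in> sets borel" "Z \<in> sets borel"
    and mid: "\<And>x y. x \<in> X \<Longrightarrow> y \<in> Y \<Longrightarrow> (1/2) *\<^sub>R (x + y) \<in> Z"
  shows "emeasure lborel X * emeasure lborel Y \<le> (emeasure lborel Z)\<^sup>2"
proof -
  let ?P = "\<Pi>\<^sub>M i\<in>(Basis::'a set). lborel :: real measure" and ?v = "\<lambda>f. \<Sum>b\<in>Basis. f b *\<^sub>R (b::'a)"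
  have e: "emeasure lborel A = (\<integral>\<^sup>+f. indicator A (?v f) \<partial>?P)" if [measurable]: "A \<in> sets borel" for A :: "'a set"
  proof -
    have "emeasure lborel A = (\<integral>\<^sup>+x. indicator A x \<partial>lborel)" by (simp add: nn_integral_indicator)
    also have "\<dots> = (\<integral>\<^sup>+f. indicator A (?v f) \<partial>?P)" by (subst lborel_eq, subst nn_integral_distr) simp_all
    finally show ?thesis .
  qed
  show ?thesis
    unfolding e[OF assms(1)] e[OF assms(2)] e[OF assms(3)]
  proof (rule prekopa_leindler_PiM)
    fix x y :: "'a \<Rightarrow> real"
    have "?v (\<lambda>i\<in>Basis. (x i + y i) / 2) = (1/2) *\<^sub>R (?v x + ?v y)"
      by (simp add: scaleR_sum_right sum.distrib[symmetric] scaleR_left_distrib add_divide_distrib scaleR_right_distrib)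
    then show "indicator X (?v x) * indicator Y (?v y) \<le> (indicator Z (?v (\<lambda>i\<in>Basis. (x i + y i) / 2)) :: ennreal)\<^sup>2"
      using mid[of "?v x" "?v y"] by (auto simp: indicator_def)
  qed simp_all
qed

lemma compact_sweep: "compact E \<Longrightarrow> compact (sweep E v)"
  unfolding sweep_def by (intro compact_continuous_image compact_Times) (auto intro!: continuous_intros simp: case_prod_unfold)

lemma hproj_diff: "hproj \<nu> (x - y) = hproj \<nu> x - hproj \<nu> y"
  by (simp add: hproj_def inner_diff_left algebra_simps)

lemma hproj_inner [simp]: "norm \<nu> = 1 \<Longrightarrow> hproj \<nu> x \<bullet> \<nu> = 0"
  by (simp add: hproj_def inner_diff_left norm_eq_1)

lemma ennreal_power2_le_imp_le:
  fixes a b :: ennreal assumes "a\<^sup>2 \<le> b\<^sup>2" shows "a \<le> b"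
proof (cases "b = top")
  case False
  then obtain s where s: "b = ennreal s" "0 \<le> s" by (cases b) auto
  have "a \<noteq> top"
  proof
    assume "a = top"
    then have "top \<le> ennreal (s\<^sup>2)" using assms s by (simp add: ennreal_power power2_eq_square ennreal_mult)
    then show False by (simp add: top_unique)
  qed
  then obtain r where r: "a = ennreal r" "0 \<le> r" by (cases a) auto
  have "ennreal (r\<^sup>2) \<le> ennreal (s\<^sup>2)" using assms r s by (simp add: ennreal_power)
  then have "r\<^sup>2 \<le> s\<^sup>2" by (subst (asm) ennreal_le_iff) auto
  then have "r \<le> s" using s(2) by (rule power2_le_imp_le)
  then show ?thesis using r s by (simp add: ennreal_leI)
qed simp

text \<open>
  Let \<open>P\<close> be the projection of \<open>D\<close>. The Brunn-Minkowski inequality, applied to the slabs over \<open>P\<close> and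
  over \<open>- P\<close>, shows that the slab over \<open>(P - P) / 2\<close> has at least the volume of the slab over \<open>P\<close>. But
  \<open>(P - P) / 2\<close> is contained in the disc of radius \<open>diameter D / 2\<close> around 0.
\<close>

theorem isodiametric_projection:
  fixes D :: "'a::euclidean_space set"
  assumes D: "compact D" and nu: "norm \<nu> = 1"
  shows "emeasure lborel (sweep (hproj \<nu> ` D) (-\<nu>)) \<le>
    ennreal (unit_ball_vol (DIM('a) - 1) * (diameter D / 2) ^ (DIM('a) - 1))"
proof -
  define P where "P = hproj \<nu> ` D"
  have P: "compact P" unfolding P_def by (intro compact_continuous_image continuous_on_hproj D)
  have Pn: "u \<bullet> \<nu> = 0" if "u \<in> P" for u using that nu by (auto simp: P_def)
  have nn: "\<nu> \<bullet> \<nu> = 1" using nu by (simp add: norm_eq_1)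
  define Q where "Q = (\<lambda>(u, v). (1/2) *\<^sub>R (u - v)) ` (P \<times> P)"
  have Q: "compact Q" unfolding Q_def
    by (intro compact_continuous_image compact_Times P) (auto intro!: continuous_intros simp: case_prod_unfold)
  let ?X = "sweep P (-\<nu>)" and ?Y = "sweep (uminus ` P) (-\<nu>)" and ?Z = "sweep Q (-\<nu>)"
  have bX: "?X \<in> sets borel" and bY: "?Y \<in> sets borel" and bZ: "?Z \<in> sets borel"
    using P Q by (auto intro!: borel_compact compact_sweep compact_continuous_image continuous_intros)
  have "?X \<subseteq> (\<lambda>x. \<nu> - x) ` ?Y"
  proof
    fix x assume "x \<in> ?X"
    then obtain u t where ut: "u \<in> P" "0 \<le> t" "t \<le> 1" "x = u + t *\<^sub>R \<nu>" by (auto simp: sweep_def)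
    then have "- u + (1 - t) *\<^sub>R \<nu> \<in> ?Y"
      unfolding sweep_def by (intro image_eqI[where x="(- u, 1 - t)"]) auto
    then show "x \<in> (\<lambda>x. \<nu> - x) ` ?Y"
      using ut by (intro image_eqI[where x="- u + (1 - t) *\<^sub>R \<nu>"]) (auto simp: algebra_simps)
  qed
  moreover have "(\<lambda>x. \<nu> - x) ` ?Y \<in> sets borel"
    using P by (auto intro!: borel_compact compact_sweep compact_continuous_image continuous_intros)
  ultimately have "emeasure lborel ?X \<le> emeasure lborel ((\<lambda>x. \<nu> - x) ` ?Y)"
    by (intro emeasure_mono) auto
  also have "\<dots> \<le> ennreal (1 ^ DIM('a)) * emeasure lborel ?Y"
  proof (rule emeasure_lipschitz_image_le[OF bY])
    show "norm (\<nu> - x - (\<nu> - y)) \<le> 1 * norm (x - y)" for x y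
      by (simp add: norm_minus_commute[of x y])
  qed simp
  finally have "emeasure lborel ?X \<le> emeasure lborel ?Y" by simp
  then have "(emeasure lborel ?X)\<^sup>2 \<le> emeasure lborel ?X * emeasure lborel ?Y"
    by (simp add: power2_eq_square mult_left_mono)
  also have "\<dots> \<le> (emeasure lborel ?Z)\<^sup>2"
  proof (rule brunn_minkowski_half[OF bX bY bZ])
    fix x y assume "x \<in> ?X" "y \<in> ?Y"
    then obtain u s v t where x: "x = u + s *\<^sub>R \<nu>" "u \<in> P" "0 \<le> s" "s \<le> 1"
      and y: "y = - v + t *\<^sub>R \<nu>" "v \<in> P" "0 \<le> t" "t \<le> 1"
      by (auto simp: sweep_def)
    have "(1/2) *\<^sub>R (x + y) = (1/2) *\<^sub>R (u - v) - ((s + t) / 2) *\<^sub>R (-\<nu>)"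
      unfolding x(1) y(1) by (simp add: algebra_simps add_divide_distrib)
    then show "(1/2) *\<^sub>R (x + y) \<in> ?Z"
      using x y unfolding sweep_def Q_def
      by (intro image_eqI[where x="((1/2) *\<^sub>R (u - v), (s + t) / 2)"]) auto
  qed
  finally have XZ: "emeasure lborel ?X \<le> emeasure lborel ?Z"
    by (rule ennreal_power2_le_imp_le)
  \<comment> \<open>The radius is enlarged by \<open>e\<close> because the diameter of \<open>D\<close> may be 0.\<close>
  have Zle: "emeasure lborel ?Z \<le> ennreal (unit_ball_vol (DIM('a) - 1) * (diameter D / 2 + e) ^ (DIM('a) - 1))" if e: "0 < e" for e
  proof -
    have r: "0 < diameter D / 2 + e" using e diameter_ge_0[OF compact_imp_bounded[OF D]] by simp
    have "emeasure lborel ?Z \<le> emeasure lborel {x. norm (hproj \<nu> x) \<le> diameter D / 2 + e \<and> 0 \<le> x \<bullet> \<nu> \<and> x \<bullet> \<nu> \<le> 1}"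
    proof (rule emeasure_mono)
      show "?Z \<subseteq> {x. norm (hproj \<nu> x) \<le> diameter D / 2 + e \<and> 0 \<le> x \<bullet> \<nu> \<and> x \<bullet> \<nu> \<le> 1}"
      proof
        fix z assume "z \<in> ?Z"
        then obtain u v t where z: "z = (1/2) *\<^sub>R (u - v) + t *\<^sub>R \<nu>" "u \<in> P" "v \<in> P" "0 \<le> t" "t \<le> 1"
          by (auto simp: sweep_def Q_def)
        then have zn: "z \<bullet> \<nu> = t" using Pn by (simp add: inner_add_left inner_diff_left nn)
        then have "hproj \<nu> z = (1/2) *\<^sub>R (u - v)" using z by (simp add: hproj_def)
        moreover obtain p q where "p \<in> D" "q \<in> D" "u = hproj \<nu> p" "v = hproj \<nu> q" using z by (auto simp: P_def)
        then have "norm (u - v) \<le> diameter D"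
          using norm_hproj_le[OF nu, of "p - q"] diameter_bounded_bound[OF compact_imp_bounded[OF D], of p q]
          by (simp add: hproj_diff dist_norm)
        ultimately show "z \<in> {x. norm (hproj \<nu> x) \<le> diameter D / 2 + e \<and> 0 \<le> x \<bullet> \<nu> \<and> x \<bullet> \<nu> \<le> 1}"
          using zn z e by simp
      qed
    qed simp
    also have "\<dots> = ennreal (unit_ball_vol (DIM('a) - 1) * (diameter D / 2 + e) ^ (DIM('a) - 1))"
      using emeasure_cylinder[OF nu r, of 0 1] by simp
    finally show ?thesis .
  qed
  have "((\<lambda>e. ennreal (unit_ball_vol (DIM('a) - 1) * (diameter D / 2 + e) ^ (DIM('a) - 1))) \<longlongrightarrow>
     ennreal (unit_ball_vol (DIM('a) - 1) * (diameter D / 2 + 0) ^ (DIM('a) - 1))) (at_right 0)"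
    by (intro tendsto_intros tendsto_ennrealI)
  then have "emeasure lborel ?Z \<le> ennreal (unit_ball_vol (DIM('a) - 1) * (diameter D / 2 + 0) ^ (DIM('a) - 1))"
    by (rule tendsto_lowerbound[OF _ eventually_at_rightI[of 0 1]]) (rule Zle, auto)
  then show ?thesis using XZ by (simp add: P_def)
qed

lemma sweep_mono: "A \<subseteq> B \<Longrightarrow> sweep A v \<subseteq> sweep B v"
  by (auto simp: sweep_def)

lemma sweep_UN: "sweep (\<Union>i\<in>I. A i) v = (\<Union>i\<in>I. sweep (A i) v)"
  by (auto simp: sweep_def)

text \<open>
  The isodiametric inequality bounds the shadow of each set of a cover by the value of this set.
\<close>

theorem projection_measure_le_hausdorff:
  fixes E :: "'a::euclidean_space set"
  assumes nu: "norm \<nu> = 1"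
  shows "emeasure lborel (sweep (hproj \<nu> ` E) (-\<nu>)) \<le> hausdorff_measure (DIM('a) - 1) E"
proof -
  let ?d = "DIM('a) - 1"
  have "emeasure lborel (sweep (hproj \<nu> ` E) (-\<nu>)) \<le> hausdorff_content ?d 1 E"
    unfolding hausdorff_content_def
  proof (intro INF_greatest, clarify)
    fix C :: "nat \<Rightarrow> 'a set"
    assume cov: "E \<subseteq> (\<Union>i. C i)" and C: "\<forall>i. bounded (C i) \<and> diameter (C i) \<le> 1"
    let ?S = "\<lambda>i. sweep (hproj \<nu> ` closure (C i)) (-\<nu>)"
    have cc: "compact (closure (C i))" for i using C by (simp add: compact_closure)
    have "E \<subseteq> (\<Union>i. closure (C i))" using cov closure_subset by blast
    then have sub: "sweep (hproj \<nu> ` E) (-\<nu>) \<subseteq> (\<Union>i. ?S i)"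
      unfolding sweep_UN[symmetric] image_UN[symmetric] by (intro sweep_mono image_mono)
    have bS: "?S i \<in> sets borel" for i
      by (intro borel_compact compact_sweep compact_continuous_image continuous_on_hproj cc)
    have "emeasure lborel (sweep (hproj \<nu> ` E) (-\<nu>)) \<le> emeasure lborel (\<Union>i. ?S i)"
      using bS by (intro emeasure_mono sub) auto
    also have "\<dots> \<le> (\<Sum>i. emeasure lborel (?S i))"
      using bS by (intro emeasure_subadditive_countably) auto
    also have "\<dots> \<le> (\<Sum>i. if C i = {} then 0 else ennreal (unit_ball_vol (real ?d) * (diameter (C i) / 2) ^ ?d))"
    proof (rule suminf_le)
      show "emeasure lborel (?S i) \<le> (if C i = {} then 0 else ennreal (unit_ball_vol (real ?d) * (diameter (C i) / 2) ^ ?d))" for i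
        using isodiametric_projection[OF cc[of i] nu] C by (auto simp: sweep_def diameter_closure)
    qed auto
    finally show "emeasure lborel (sweep (hproj \<nu> ` E) (-\<nu>)) \<le>
      (\<Sum>i. if C i = {} then 0 else ennreal (unit_ball_vol (real ?d) * (diameter (C i) / 2) ^ ?d))" .
  qed
  also have "\<dots> \<le> hausdorff_measure ?d E"
    unfolding hausdorff_measure_def by (rule SUP_upper) simp
  finally show ?thesis .
qed

section \<open>Radial integrals\<close>

lemma nn_integral_set_has_integral:
  fixes f :: "real \<Rightarrow> real"
  assumes [measurable]: "f \<in> borel_measurable borel" "S \<in> sets borel"
    and "\<And>x. x \<in> S \<Longrightarrow> 0 \<le> f x" "(f has_integral I) S"
  shows "(\<integral>\<^sup>+x. ennreal (f x) * indicator S x \<partial>lborel) = ennreal I"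
proof -
  have "(\<integral>\<^sup>+x. ennreal (f x) * indicator S x \<partial>lborel) = (\<integral>\<^sup>+x. ennreal (if x \<in> S then f x else 0) \<partial>lborel)"
    by (intro nn_integral_cong) (auto simp: indicator_def)
  also have "\<dots> = ennreal I"
    using assms by (intro nn_integral_has_integral_lborel) (auto simp: has_integral_restrict_UNIV)
  finally show ?thesis .
qed

text \<open>
  This represents a power of \<open>norm v\<close> as an integral over \<open>t > norm v\<close>, which reduces radial
  integrals to the volumes of balls.
\<close>

lemma nn_integral_powr_tail:
  assumes a: "0 < a" and r: "0 < r"
  shows "(\<integral>\<^sup>+t. ennreal (a * t powr (- a - 1)) * indicator {r<..} t \<partial>lborel) = ennreal (r powr (- a))"
proof -
  have "((\<lambda>t. a * t powr (- a - 1)) has_integral a * (- (r powr (- a - 1 + 1)) / (- a - 1 + 1))) {r..}"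
    using a r by (intro has_integral_mult_right has_integral_powr_to_inf) auto
  then have "((\<lambda>t. a * t powr (- a - 1)) has_integral r powr (- a)) {r..}"
    using a by simp
  then have "(\<integral>\<^sup>+t. ennreal (a * t powr (- a - 1)) * indicator {r..} t \<partial>lborel) = ennreal (r powr (- a))"
    using a by (intro nn_integral_set_has_integral) auto
  moreover have "(\<integral>\<^sup>+t. ennreal (a * t powr (- a - 1)) * indicator {r..} t \<partial>lborel)
      = (\<integral>\<^sup>+t. ennreal (a * t powr (- a - 1)) * indicator {r<..} t \<partial>lborel)"
    using AE_lborel_singleton[of r] by (intro nn_integral_cong_AE) (auto simp: indicator_def elim!: eventually_mono)
  ultimately show ?thesis by simp
qed

lemma measurable_indicator_norm_less [measurable]:
  "(\<lambda>x. indicator {norm (snd x)<..} (fst x) :: ennreal) \<in> borel_measurable (lborel \<Otimes>\<^sub>M (lborel :: 'a::euclidean_space measure))"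
proof -
  have "(\<lambda>x. indicator {norm (snd x :: 'a)<..} (fst x) :: ennreal) = (\<lambda>x. if norm (snd x) < fst x then 1 else 0)"
    by (auto simp: indicator_def)
  then show ?thesis by simp
qed

lemma measurable_indicator_norm_less_const [measurable]:
  "(\<lambda>v. indicator {norm v<..} t :: ennreal) \<in> borel_measurable (borel :: 'a::euclidean_space measure)"
proof -
  have "(\<lambda>v::'a. indicator {norm v<..} t :: ennreal) = (\<lambda>v. if norm v < t then 1 else 0)"
    by (auto simp: indicator_def)
  then show ?thesis by simp
qed

lemma measurable_ball [measurable]: "ball c r \<in> sets (borel :: 'a::euclidean_space measure)"
  by simp

lemma nn_integral_lborel_scale:
  fixes f :: "'a::euclidean_space \<Rightarrow> ennreal"
  assumes [measurable]: "f \<in> borel_measurable borel" and c: "0 < c"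
  shows "(\<integral>\<^sup>+x. f x \<partial>lborel) = ennreal (c ^ DIM('a)) * (\<integral>\<^sup>+x. f (c *\<^sub>R x) \<partial>lborel)"
proof -
  have "(\<integral>\<^sup>+x. f x \<partial>lborel) = (\<integral>\<^sup>+x. f x \<partial>density (distr lborel borel (\<lambda>x. 0 + c *\<^sub>R x)) (\<lambda>_. \<bar>c\<bar> ^ DIM('a)))"
    using c by (subst lborel_affine[of c 0]) simp_all
  also have "\<dots> = ennreal (c ^ DIM('a)) * (\<integral>\<^sup>+x. f (c *\<^sub>R x) \<partial>lborel)"
    using c by (simp add: nn_integral_density nn_integral_distr nn_integral_cmult)
  finally show ?thesis .
qed

lemma nn_integral_ball_homogeneous:
  fixes g :: "'a::euclidean_space \<Rightarrow> real"
  assumes [measurable]: "g \<in> borel_measurable borel"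
    and hom: "\<And>t v. 0 < t \<Longrightarrow> g (t *\<^sub>R v) = t * g v" and r: "0 < r"
  shows "(\<integral>\<^sup>+v. ennreal (g v) * indicator (ball 0 r) v \<partial>lborel)
    = ennreal (r ^ (DIM('a) + 1)) * (\<integral>\<^sup>+v. ennreal (g v) * indicator (ball 0 1) v \<partial>lborel)"
proof -
  have "(\<integral>\<^sup>+v. ennreal (g v) * indicator (ball 0 r) v \<partial>lborel)
     = ennreal (r ^ DIM('a)) * (\<integral>\<^sup>+v. ennreal (g (r *\<^sub>R v)) * indicator (ball 0 r) (r *\<^sub>R v) \<partial>lborel)"
    by (rule nn_integral_lborel_scale) (measurable, rule r)
  also have "(\<integral>\<^sup>+v. ennreal (g (r *\<^sub>R v)) * indicator (ball 0 r) (r *\<^sub>R v) \<partial>lborel)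
     = (\<integral>\<^sup>+v. ennreal r * (ennreal (g v) * indicator (ball 0 1) v) \<partial>lborel)"
    using r by (intro nn_integral_cong) (auto simp: hom indicator_def ennreal_mult')
  also have "\<dots> = ennreal r * (\<integral>\<^sup>+v. ennreal (g v) * indicator (ball 0 1) v \<partial>lborel)"
    by (rule nn_integral_cmult) auto
  finally show ?thesis using r by (simp add: ennreal_mult mult_ac)
qed

text \<open>
  The radial factor of \<open>nn_integral_radial_kernel\<close>, where \<open>min t \<delta> ^ (n + 1)\<close> is the growth of the
  integral of a function that is homogeneous of degree 1 over balls truncated at radius \<open>\<delta>\<close>. The
  part with \<open>t \<le> \<delta>\<close> and the part with \<open>t > \<delta>\<close> are integrals of powers.
\<close>

lemma nn_integral_min_power:
  assumes a: "0 < a" "a < real n + 1" and \<delta>: "0 < \<delta>"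
  shows "(\<integral>\<^sup>+t. ennreal (a * t powr (- a - 1)) * (indicator {0<..} t * ennreal (min t \<delta> ^ (n + 1))) \<partial>lborel)
     = ennreal (\<delta> powr (real n + 1 - a) * (real n + 1) / (real n + 1 - a))"
proof -
  let ?c = "real n + 1 - a"
  have "(\<integral>\<^sup>+t. ennreal (a * t powr (- a - 1)) * (indicator {0<..} t * ennreal (min t \<delta> ^ (n + 1))) \<partial>lborel)
     = (\<integral>\<^sup>+t. ennreal (a * t powr (?c - 1)) * indicator {0..\<delta>} t
          + ennreal (\<delta> ^ (n + 1)) * (ennreal (a * t powr (- a - 1)) * indicator {\<delta><..} t) \<partial>lborel)"
  proof (intro nn_integral_cong)
    fix t :: real
    have "t powr (- a - 1) * t ^ (n + 1) = t powr (?c - 1)" if "0 < t"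
      using that by (simp add: powr_realpow[symmetric] powr_add[symmetric] algebra_simps del: power_Suc)
    then have "ennreal (a * t powr (- a - 1)) * ennreal (t ^ (n + 1)) = ennreal (a * t powr (?c - 1))" if "0 < t"
      using that a by (simp add: mult.assoc del: power_Suc flip: ennreal_mult)
    then show "ennreal (a * t powr (- a - 1)) * (indicator {0<..} t * ennreal (min t \<delta> ^ (n + 1))) =
      ennreal (a * t powr (?c - 1)) * indicator {0..\<delta>} t
          + ennreal (\<delta> ^ (n + 1)) * (ennreal (a * t powr (- a - 1)) * indicator {\<delta><..} t)"
      using \<delta> by (cases "0 < t"; cases "t \<le> \<delta>") (auto simp: indicator_def min_def mult.commute simp del: power_Suc)
  qed
  also have "\<dots> = (\<integral>\<^sup>+t. ennreal (a * t powr (?c - 1)) * indicator {0..\<delta>} t \<partial>lborel)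
      + ennreal (\<delta> ^ (n + 1)) * (\<integral>\<^sup>+t. ennreal (a * t powr (- a - 1)) * indicator {\<delta><..} t \<partial>lborel)"
    by (subst nn_integral_add) (simp_all add: nn_integral_cmult del: power_Suc)
  also have "(\<integral>\<^sup>+t. ennreal (a * t powr (?c - 1)) * indicator {0..\<delta>} t \<partial>lborel) = ennreal (a * (\<delta> powr (?c - 1 + 1) / (?c - 1 + 1)))"
    using a \<delta> by (intro nn_integral_set_has_integral has_integral_mult_right has_integral_powr_from_0) auto
  also have "(\<integral>\<^sup>+t. ennreal (a * t powr (- a - 1)) * indicator {\<delta><..} t \<partial>lborel) = ennreal (\<delta> powr (- a))"
    by (rule nn_integral_powr_tail[OF a(1) \<delta>])
  also have "ennreal (\<delta> ^ (n + 1)) * ennreal (\<delta> powr (- a)) = ennreal (\<delta> powr ?c)"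
    using \<delta> by (simp add: powr_realpow[symmetric] powr_add[symmetric] algebra_simps del: power_Suc flip: ennreal_mult)
  also have "ennreal (a * (\<delta> powr (?c - 1 + 1) / (?c - 1 + 1))) + ennreal (\<delta> powr ?c) = ennreal (a * (\<delta> powr ?c / ?c) + \<delta> powr ?c)"
    unfolding diff_add_cancel using a by (subst ennreal_plus) auto
  also have "a * (\<delta> powr ?c / ?c) + \<delta> powr ?c = \<delta> powr ?c * (real n + 1) / ?c"
    using a by (simp add: field_simps)
  finally show ?thesis .
qed

text \<open>
  Writing the power as an integral over its tail and exchanging the integrals leaves the integral
  of \<open>g\<close> over balls of radius \<open>min t \<delta>\<close>, which homogeneity reduces to the unit ball. The pole at
  \<open>a = n + 1\<close> is the source of the factor \<open>1 / (1 - 2 s)\<close>.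
\<close>

lemma nn_integral_radial_kernel:
  fixes g :: "'a::euclidean_space \<Rightarrow> real"
  assumes [measurable]: "g \<in> borel_measurable borel"
    and hom: "\<And>t v. 0 < t \<Longrightarrow> g (t *\<^sub>R v) = t * g v"
    and a: "0 < a" "a < real DIM('a) + 1" and \<delta>: "0 < \<delta>"
  shows "(\<integral>\<^sup>+v. ennreal (g v) * ennreal (norm v powr (- a)) * indicator (ball 0 \<delta>) v \<partial>lborel) =
     ennreal (\<delta> powr (real DIM('a) + 1 - a) * (real DIM('a) + 1) / (real DIM('a) + 1 - a)) *
     (\<integral>\<^sup>+v. ennreal (g v) * indicator (ball 0 1) v \<partial>lborel)"
proof -
  let ?J = "\<integral>\<^sup>+v. ennreal (g v) * indicator (ball 0 1) v \<partial>lborel"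
  let ?k = "\<lambda>t. ennreal (a * t powr (- a - 1))"
  have "(\<integral>\<^sup>+v. ennreal (g v) * ennreal (norm v powr (- a)) * indicator (ball 0 \<delta>) v \<partial>lborel) =
     (\<integral>\<^sup>+v. (\<integral>\<^sup>+t. ?k t * (ennreal (g v) * indicator (ball 0 \<delta>) v * indicator {norm v<..} t) \<partial>lborel) \<partial>lborel)"
  proof (rule nn_integral_cong_AE)
    show "AE v in lborel. ennreal (g v) * ennreal (norm v powr (- a)) * indicator (ball 0 \<delta>) v =
       (\<integral>\<^sup>+t. ?k t * (ennreal (g v) * indicator (ball 0 \<delta>) v * indicator {norm v<..} t) \<partial>lborel)"
      using AE_lborel_singleton[of "0::'a"]
    proof eventually_elim
      case (elim v)
      have "(\<integral>\<^sup>+t. ?k t * (ennreal (g v) * indicator (ball 0 \<delta>) v * indicator {norm v<..} t) \<partial>lborel)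
         = (\<integral>\<^sup>+t. (ennreal (g v) * indicator (ball 0 \<delta>) v) * (?k t * indicator {norm v<..} t) \<partial>lborel)"
        by (intro nn_integral_cong) (simp add: ac_simps)
      also have "\<dots> = (ennreal (g v) * indicator (ball 0 \<delta>) v) * (\<integral>\<^sup>+t. ?k t * indicator {norm v<..} t \<partial>lborel)"
        by (rule nn_integral_cmult) measurable
      also have "(\<integral>\<^sup>+t. ?k t * indicator {norm v<..} t \<partial>lborel) = ennreal (norm v powr (- a))"
        using elim by (intro nn_integral_powr_tail a) auto
      finally show ?case by (simp add: ac_simps)
    qed
  qed
  also have "\<dots> = (\<integral>\<^sup>+t. (\<integral>\<^sup>+v. ?k t * (ennreal (g v) * indicator (ball 0 \<delta>) v * indicator {norm v<..} t) \<partial>lborel) \<partial>lborel)"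
    by (rule lborel_pair.Fubini') (measurable, auto)
  also have "\<dots> = (\<integral>\<^sup>+t. ?k t * (indicator {0<..} t * ennreal (min t \<delta> ^ (DIM('a) + 1))) * ?J \<partial>lborel)"
  proof (intro nn_integral_cong)
    fix t :: real
    have "(\<integral>\<^sup>+v. ?k t * (ennreal (g v) * indicator (ball 0 \<delta>) v * indicator {norm v<..} t) \<partial>lborel)
       = ?k t * (\<integral>\<^sup>+v. ennreal (g v) * indicator (ball 0 \<delta>) v * indicator {norm v<..} t \<partial>lborel)"
      by (rule nn_integral_cmult) measurable
    also have "(\<integral>\<^sup>+v. ennreal (g v) * indicator (ball 0 \<delta>) v * indicator {norm v<..} t \<partial>lborel) =
       (\<integral>\<^sup>+v. ennreal (g v) * indicator (ball 0 (min t \<delta>)) v \<partial>lborel)"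
      by (intro nn_integral_cong) (auto simp: indicator_def)
    also have "\<dots> = indicator {0<..} t * ennreal (min t \<delta> ^ (DIM('a) + 1)) * ?J"
    proof (cases "0 < t")
      case True
      then show ?thesis using \<delta> by (subst nn_integral_ball_homogeneous[OF assms(1) hom]) auto
    next
      case False
      then have e: "ball 0 (min t \<delta>) = ({} :: 'a set)" by auto
      show ?thesis unfolding e using False by simp
    qed
    finally show "(\<integral>\<^sup>+v. ?k t * (ennreal (g v) * indicator (ball 0 \<delta>) v * indicator {norm v<..} t) \<partial>lborel)
       = ?k t * (indicator {0<..} t * ennreal (min t \<delta> ^ (DIM('a) + 1))) * ?J" by (simp add: ac_simps)
  qed
  also have "\<dots> = (\<integral>\<^sup>+t. ?k t * (indicator {0<..} t * ennreal (min t \<delta> ^ (DIM('a) + 1))) \<partial>lborel) * ?J"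
    by (rule nn_integral_multc) measurable
  also have "(\<integral>\<^sup>+t. ?k t * (indicator {0<..} t * ennreal (min t \<delta> ^ (DIM('a) + 1))) \<partial>lborel)
     = ennreal (\<delta> powr (real DIM('a) + 1 - a) * (real DIM('a) + 1) / (real DIM('a) + 1 - a))"
    by (rule nn_integral_min_power[OF a \<delta>])
  finally show ?thesis .
qed

lemma nn_integral_far_kernel_finite:
  assumes a: "real DIM('a) < a"
  shows "(\<integral>\<^sup>+v. ennreal (norm v powr (- a)) * indicator (- ball (0::'a::euclidean_space) 1) v \<partial>lborel) < top"
proof -
  let ?k = "\<lambda>t. ennreal (a * t powr (- a - 1))"
  have a0: "0 < a" using a by (meson of_nat_0_le_iff le_less_trans)
  have "(\<integral>\<^sup>+v. ennreal (norm v powr (- a)) * indicator (- ball (0::'a) 1) v \<partial>lborel) =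
     (\<integral>\<^sup>+v. (\<integral>\<^sup>+t. ?k t * (indicator (- ball (0::'a) 1) v * indicator {norm v<..} t) \<partial>lborel) \<partial>lborel)"
  proof (intro nn_integral_cong)
    fix v :: 'a
    have "(\<integral>\<^sup>+t. ?k t * (indicator (- ball (0::'a) 1) v * indicator {norm v<..} t) \<partial>lborel)
       = (\<integral>\<^sup>+t. indicator (- ball (0::'a) 1) v * (?k t * indicator {norm v<..} t) \<partial>lborel)"
      by (intro nn_integral_cong) (simp add: ac_simps)
    also have "\<dots> = indicator (- ball (0::'a) 1) v * (\<integral>\<^sup>+t. ?k t * indicator {norm v<..} t \<partial>lborel)"
      by (rule nn_integral_cmult) measurable
    also have "\<dots> = ennreal (norm v powr (- a)) * indicator (- ball (0::'a) 1) v"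
    proof (cases "norm v < 1")
      case False
      then have "0 < norm v" by linarith
      then show ?thesis by (subst nn_integral_powr_tail[OF a0]) (simp_all add: mult.commute)
    qed simp
    finally show "ennreal (norm v powr (- a)) * indicator (- ball (0::'a) 1) v =
       (\<integral>\<^sup>+t. ?k t * (indicator (- ball (0::'a) 1) v * indicator {norm v<..} t) \<partial>lborel)" by simp
  qed
  also have "\<dots> = (\<integral>\<^sup>+t. (\<integral>\<^sup>+v. ?k t * (indicator (- ball (0::'a) 1) v * indicator {norm v<..} t) \<partial>lborel) \<partial>lborel)"
    by (rule lborel_pair.Fubini') measurable
  also have "\<dots> \<le> (\<integral>\<^sup>+t. ennreal (a * unit_ball_vol DIM('a) * t powr (real DIM('a) - a - 1)) * indicator {1..} t \<partial>lborel)"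
  proof (intro nn_integral_mono)
    fix t :: real
    have "(\<integral>\<^sup>+v. ?k t * (indicator (- ball (0::'a) 1) v * indicator {norm v<..} t) \<partial>lborel)
       \<le> (\<integral>\<^sup>+v. (?k t * indicator {1..} t) * indicator (ball (0::'a) t) v \<partial>lborel)"
      by (intro nn_integral_mono) (auto simp: indicator_def)
    also have "\<dots> = (?k t * indicator {1..} t) * emeasure lborel (ball (0::'a) t)"
      by (rule nn_integral_cmult_indicator) simp
    also have "\<dots> = ennreal (a * unit_ball_vol DIM('a) * t powr (real DIM('a) - a - 1)) * indicator {1..} t"
    proof (cases "1 \<le> t")
      case True
      have "t powr (- a - 1) * t ^ DIM('a) = t powr (real DIM('a) - a - 1)"
        using True by (simp add: powr_realpow[symmetric] powr_add[symmetric] algebra_simps)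
      then have "a * t powr (- a - 1) * (unit_ball_vol DIM('a) * t ^ DIM('a)) = a * unit_ball_vol DIM('a) * t powr (real DIM('a) - a - 1)"
        by (simp add: mult_ac)
      then show ?thesis using True a0 by (simp add: emeasure_ball flip: ennreal_mult)
    qed simp
    finally show "(\<integral>\<^sup>+v. ?k t * (indicator (- ball (0::'a) 1) v * indicator {norm v<..} t) \<partial>lborel) \<le> \<dots>" .
  qed
  also have "\<dots> = ennreal (a * unit_ball_vol DIM('a) * (- (1 powr (real DIM('a) - a - 1 + 1)) / (real DIM('a) - a - 1 + 1)))"
    using a a0 by (intro nn_integral_set_has_integral has_integral_mult_right has_integral_powr_to_inf) auto
  also have "\<dots> < top" by simp
  finally show ?thesis .
qed

section \<open>Hausdorff measure\<close>

lemma hausdorff_content_Un_le: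
  "hausdorff_content d \<delta> (A \<union> B) \<le> hausdorff_content d \<delta> A + hausdorff_content d \<delta> B"
proof -
  let ?v = "\<lambda>C. if C = {} then 0 else ennreal (unit_ball_vol (real d) * (diameter C / 2) ^ d)"
  have "hausdorff_content d \<delta> (A \<union> B) \<le> (\<Sum>i. ?v (C i)) + (\<Sum>i. ?v (D i))"
    if C: "A \<subseteq> (\<Union>i. C i)" "\<forall>i. bounded (C i) \<and> diameter (C i) \<le> \<delta>"
      and D: "B \<subseteq> (\<Union>i. D i)" "\<forall>i. bounded (D i) \<and> diameter (D i) \<le> \<delta>"
    for C D :: "nat \<Rightarrow> 'a set"
  proof -
    let ?E = "\<lambda>i. if even i then C (i div 2) else D (i div 2)"
    have "A \<union> B \<subseteq> (\<Union>i. ?E i)"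
    proof
      fix x assume "x \<in> A \<union> B"
      then consider i where "x \<in> C i" | i where "x \<in> D i" using C D by blast
      then show "x \<in> (\<Union>i. ?E i)"
      proof cases
        case 1 then show ?thesis by (intro UN_I[of "2 * i"]) auto
      next
        case 2 then show ?thesis by (intro UN_I[of "2 * i + 1"]) auto
      qed
    qed
    then have "hausdorff_content d \<delta> (A \<union> B) \<le> (\<Sum>i. ?v (?E i))"
      unfolding hausdorff_content_def using C D by (intro INF_lower) auto
    also have "\<dots> = (\<Sum>i. if even i then ?v (C (i div 2)) else ?v (D (i div 2)))"
      by (intro suminf_cong) auto
    also have "\<dots> \<le> (\<Sum>i. ?v (C i)) + (\<Sum>i. ?v (D i))" by (rule suminf_interleave_le)
    finally show ?thesis .
  qed
  note Un = this
  have near: "\<exists>C. A \<subseteq> (\<Union>i. C i) \<and> (\<forall>i. bounded (C i) \<and> diameter (C i) \<le> \<delta>) \<and>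
      (\<Sum>i. ?v (C i)) \<le> hausdorff_content d \<delta> A + ennreal e"
    if "hausdorff_content d \<delta> A < top" "0 < e" for A :: "'a set" and e
  proof -
    have "hausdorff_content d \<delta> A < hausdorff_content d \<delta> A + ennreal e"
      using that by (cases "hausdorff_content d \<delta> A") (auto simp: ennreal_less_iff simp flip: ennreal_plus)
    then show ?thesis
      unfolding hausdorff_content_def[of d \<delta> A] INF_less_iff
      by (elim bexE) (auto intro: less_imp_le)
  qed
  show ?thesis
  proof (rule ennreal_le_epsilon)
    fix e :: real
    assume "hausdorff_content d \<delta> A + hausdorff_content d \<delta> B < top" "0 < e"
    then have fin: "hausdorff_content d \<delta> A < top" "hausdorff_content d \<delta> B < top" and e: "0 < e / 2" by auto
    obtain C where C: "A \<subseteq> (\<Union>i. C i)" "\<forall>i. bounded (C i) \<and> diameter (C i) \<le> \<delta>"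
      "(\<Sum>i. ?v (C i)) \<le> hausdorff_content d \<delta> A + ennreal (e / 2)"
      using near[OF fin(1) e] by blast
    obtain D where D: "B \<subseteq> (\<Union>i. D i)" "\<forall>i. bounded (D i) \<and> diameter (D i) \<le> \<delta>"
      "(\<Sum>i. ?v (D i)) \<le> hausdorff_content d \<delta> B + ennreal (e / 2)"
      using near[OF fin(2) e] by blast
    have "hausdorff_content d \<delta> (A \<union> B) \<le> (\<Sum>i. ?v (C i)) + (\<Sum>i. ?v (D i))"
      by (rule Un[OF C(1,2) D(1,2)])
    also have "\<dots> \<le> (hausdorff_content d \<delta> A + ennreal (e / 2)) + (hausdorff_content d \<delta> B + ennreal (e / 2))"
      using C(3) D(3) by (rule add_mono)
    also have "\<dots> = (hausdorff_content d \<delta> A + hausdorff_content d \<delta> B) + (ennreal (e / 2) + ennreal (e / 2))"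
      by (simp only: ac_simps)
    also have "ennreal (e / 2) + ennreal (e / 2) = ennreal e"
      using e by (simp flip: ennreal_plus)
    finally show "hausdorff_content d \<delta> (A \<union> B) \<le> hausdorff_content d \<delta> A + hausdorff_content d \<delta> B + ennreal e" .
  qed
qed

lemma hausdorff_measure_Un_le:
  "hausdorff_measure d (A \<union> B) \<le> hausdorff_measure d A + hausdorff_measure d B"
  unfolding hausdorff_measure_def[of d "A \<union> B"]
proof (rule SUP_least)
  fix \<delta> :: real assume "\<delta> \<in> {0<..}"
  then have "hausdorff_content d \<delta> A \<le> hausdorff_measure d A" "hausdorff_content d \<delta> B \<le> hausdorff_measure d B"
    unfolding hausdorff_measure_def by (auto intro: SUP_upper)
  then show "hausdorff_content d \<delta> (A \<union> B) \<le> hausdorff_measure d A + hausdorff_measure d B"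
    using hausdorff_content_Un_le[of d \<delta> A B] by (meson add_mono order_trans)
qed

lemma hausdorff_measure_empty [simp]: "hausdorff_measure d ({} :: 'a::metric_space set) = 0"
proof -
  have "hausdorff_content d \<delta> ({} :: 'a set) \<le> 0" if "0 < \<delta>" for \<delta>
    unfolding hausdorff_content_def
    by (rule INF_lower2[of "\<lambda>_. {}"]) (use that in auto)
  then show ?thesis unfolding hausdorff_measure_def
    by (metis SUP_least greaterThan_iff le_zero_eq)
qed

lemma hausdorff_measure_UN_le:
  "finite I \<Longrightarrow> hausdorff_measure d (\<Union>i\<in>I. A i) \<le> (\<Sum>i\<in>I. hausdorff_measure d (A i))"
proof (induction I rule: finite_induct)
  case (insert i I)
  have "hausdorff_measure d (A i \<union> (\<Union>i\<in>I. A i)) \<le> hausdorff_measure d (A i) + hausdorff_measure d (\<Union>i\<in>I. A i)"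
    by (rule hausdorff_measure_Un_le)
  also have "\<dots> \<le> hausdorff_measure d (A i) + (\<Sum>i\<in>I. hausdorff_measure d (A i))"
    by (intro add_left_mono insert.IH)
  finally show ?case using insert.hyps by simp
qed simp

lemma hausdorff_measure_mono: "A \<subseteq> B \<Longrightarrow> hausdorff_measure d A \<le> hausdorff_measure d B"
  unfolding hausdorff_measure_def hausdorff_content_def
  by (rule SUP_mono'[OF INF_superset_mono]) auto

lemma hausdorff_measure_lipschitz_image_le:
  fixes f :: "'a::real_normed_vector \<Rightarrow> 'b::real_normed_vector"
  assumes L: "0 < L" and lip: "\<And>x y. x \<in> A \<Longrightarrow> y \<in> A \<Longrightarrow> norm (f x - f y) \<le> L * norm (x - y)"
  shows "hausdorff_measure d (f ` A) \<le> ennreal (L ^ d) * hausdorff_measure d A"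
proof -
  let ?v = "\<lambda>C. if C = {} then 0 else ennreal (unit_ball_vol (real d) * (diameter C / 2) ^ d)"
  have "hausdorff_content d \<delta> (f ` A) \<le> ennreal (L ^ d) * hausdorff_content d (\<delta> / L) A" if \<delta>: "0 < \<delta>" for \<delta>
  proof -
    have "hausdorff_content d \<delta> (f ` A) \<le> ennreal (L ^ d) * (\<Sum>i. ?v (C i))"
      if C: "A \<subseteq> (\<Union>i. C i)" "\<forall>i. bounded (C i) \<and> diameter (C i) \<le> \<delta> / L" for C :: "nat \<Rightarrow> 'a set"
    proof -
      let ?D = "\<lambda>i. f ` (C i \<inter> A)"
      have nrm: "norm (f x - f y) \<le> L * diameter (C i)" if "x \<in> C i \<inter> A" "y \<in> C i \<inter> A" for x y i
      proof -
        have "norm (f x - f y) \<le> L * norm (x - y)" using lip that by auto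
        also have "\<dots> \<le> L * diameter (C i)"
          using diameter_bounded_bound[of "C i" x y] C that L by (intro mult_left_mono) (auto simp: dist_norm)
        finally show ?thesis .
      qed
      have nn: "0 \<le> L * diameter (C i)" for i using C L diameter_ge_0[of "C i"] by auto
      have dia: "diameter (?D i) \<le> L * diameter (C i)" for i
        using nn nrm by (intro diameter_le) auto
      have bd: "bounded (?D i)" for i
      proof (cases "C i \<inter> A = {}")
        case False
        then obtain x where "x \<in> C i \<inter> A" by auto
        then have "?D i \<subseteq> cball (f x) (L * diameter (C i))" using nrm by (auto simp: dist_norm)
        then show ?thesis using bounded_cball bounded_subset by blast
      qed auto
      have "hausdorff_content d \<delta> (f ` A) \<le> (\<Sum>i. ?v (?D i))"
        unfolding hausdorff_content_def
      proof (rule INF_lower, clarify, intro conjI allI)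
        show "f ` A \<subseteq> (\<Union>i. ?D i)" using C(1) by blast
        show "diameter (?D i) \<le> \<delta>" for i
        proof -
          have "L * diameter (C i) \<le> L * (\<delta> / L)" using C(2) L by (intro mult_left_mono) auto
          then show ?thesis using dia[of i] L by simp
        qed
      qed (rule bd)
      also have "\<dots> \<le> (\<Sum>i. ennreal (L ^ d) * ?v (C i))"
      proof (rule suminf_le)
        fix i
        show "?v (?D i) \<le> ennreal (L ^ d) * ?v (C i)"
        proof (cases "C i \<inter> A = {}")
          case False
          have "(diameter (?D i) / 2) ^ d \<le> (L * diameter (C i) / 2) ^ d"
            using dia[of i] diameter_ge_0[OF bd] by (intro power_mono) auto
          also have "\<dots> = L ^ d * (diameter (C i) / 2) ^ d" by (simp add: power_mult_distrib power_divide)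
          finally have "unit_ball_vol (real d) * (diameter (?D i) / 2) ^ d
              \<le> L ^ d * (unit_ball_vol (real d) * (diameter (C i) / 2) ^ d)"
            by (simp add: mult.left_commute mult_left_mono)
          then have "ennreal (unit_ball_vol (real d) * (diameter (?D i) / 2) ^ d)
              \<le> ennreal (L ^ d) * ennreal (unit_ball_vol (real d) * (diameter (C i) / 2) ^ d)"
            using L by (subst ennreal_mult'[symmetric]) (auto intro: ennreal_leI)
          then show ?thesis using False by auto
        qed simp
      qed auto
      also have "\<dots> = ennreal (L ^ d) * (\<Sum>i. ?v (C i))" by (rule ennreal_suminf_cmult)
      finally show ?thesis .
    qed
    then have "hausdorff_content d \<delta> (f ` A) / ennreal (L ^ d) \<le> hausdorff_content d (\<delta> / L) A"
      unfolding hausdorff_content_def[of d "\<delta> / L" A] using L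
      by (intro INF_greatest) (auto simp: divide_le_posI_ennreal mult.commute)
    then have "ennreal (L ^ d) * (hausdorff_content d \<delta> (f ` A) / ennreal (L ^ d)) \<le> ennreal (L ^ d) * hausdorff_content d (\<delta> / L) A"
      by (rule mult_left_mono) simp
    then show ?thesis using L by (simp add: ennreal_times_divide ennreal_mult_divide_eq mult.commute[of "ennreal (L ^ d)"])
  qed
  then have "hausdorff_content d \<delta> (f ` A) \<le> ennreal (L ^ d) * hausdorff_measure d A" if "0 < \<delta>" for \<delta>
    using that L unfolding hausdorff_measure_def
    by (meson SUP_upper divide_pos_pos greaterThan_iff mult_left_mono order_trans zero_le)
  then show ?thesis unfolding hausdorff_measure_def[of d "f ` A"] by (intro SUP_least) auto
qed

lemma hausdorff_content_antimono:
  assumes "\<delta> \<le> \<delta>'" shows "hausdorff_content d \<delta>' A \<le> hausdorff_content d \<delta> A"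
proof -
  have "x \<le> \<delta> \<Longrightarrow> x \<le> \<delta>'" for x using assms by linarith
  then show ?thesis
    unfolding hausdorff_content_def by (intro INF_superset_mono) (blast, simp)
qed

text \<open>
  A covering set of diameter at most \<open>\<delta>\<close> cannot meet both \<open>A\<close> and \<open>B\<close>, so a cover of the union
  splits into a cover of \<open>A\<close> and a cover of \<open>B\<close>.
\<close>

lemma hausdorff_content_separated:
  assumes sep: "\<And>x y. x \<in> A \<Longrightarrow> y \<in> B \<Longrightarrow> \<delta> < dist x y"
  shows "hausdorff_content d \<delta> A + hausdorff_content d \<delta> B \<le> hausdorff_content d \<delta> (A \<union> B)"
  unfolding hausdorff_content_def[of d \<delta> "A \<union> B"]
proof (rule INF_greatest, clarify)
  let ?v = "\<lambda>C. if C = {} then 0 else ennreal (unit_ball_vol (real d) * (diameter C / 2) ^ d)"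
  fix C :: "nat \<Rightarrow> 'a set"
  assume cov: "A \<union> B \<subseteq> (\<Union>i. C i)" and C: "\<forall>i. bounded (C i) \<and> diameter (C i) \<le> \<delta>"
  have sub: "bounded (C i \<inter> X) \<and> diameter (C i \<inter> X) \<le> diameter (C i)" for i X
    using C diameter_subset[of "C i \<inter> X" "C i"] by (auto intro: bounded_subset)
  have sub2: "diameter (C i \<inter> X) \<le> \<delta>" for i X using sub C order_trans by blast
  have le: "hausdorff_content d \<delta> X \<le> (\<Sum>i. ?v (C i \<inter> X))" if "X \<subseteq> A \<union> B" for X
    unfolding hausdorff_content_def
    by (rule INF_lower) (use that cov sub sub2 in auto)
  have "hausdorff_content d \<delta> A + hausdorff_content d \<delta> B \<le> (\<Sum>i. ?v (C i \<inter> A)) + (\<Sum>i. ?v (C i \<inter> B))"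
    by (intro add_mono le) auto
  also have "\<dots> = (\<Sum>i. ?v (C i \<inter> A) + ?v (C i \<inter> B))" by (rule suminf_add) auto
  also have "\<dots> \<le> (\<Sum>i. ?v (C i))"
  proof (rule suminf_le)
    fix i
    have mono: "?v (C i \<inter> X) \<le> ?v (C i)" for X
    proof (cases "C i \<inter> X = {}")
      case False
      have "unit_ball_vol (real d) * (diameter (C i \<inter> X) / 2) ^ d \<le> unit_ball_vol (real d) * (diameter (C i) / 2) ^ d"
        using sub[of i X] diameter_ge_0[of "C i \<inter> X"] by (intro mult_left_mono power_mono) auto
      then show ?thesis using False by (auto intro: ennreal_leI)
    qed simp
    have "C i \<inter> A = {} \<or> C i \<inter> B = {}"
    proof (rule ccontr)
      assume "\<not> ?thesis"
      then obtain x y where xy: "x \<in> C i" "x \<in> A" "y \<in> C i" "y \<in> B" by auto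
      then have "dist x y \<le> diameter (C i)" using C by (intro diameter_bounded_bound) auto
      then show False using sep[of x y] xy C by (meson leD order_trans)
    qed
    then show "?v (C i \<inter> A) + ?v (C i \<inter> B) \<le> ?v (C i)"
    proof
      assume e: "C i \<inter> A = {}"
      show ?thesis using mono[of B] by (simp only: e simp_thms if_True add_0_left)
    next
      assume e: "C i \<inter> B = {}"
      show ?thesis using mono[of A] by (simp only: e simp_thms if_True add_0_right)
    qed
  qed auto
  finally show "hausdorff_content d \<delta> A + hausdorff_content d \<delta> B \<le> (\<Sum>i. ?v (C i))" .
qed

lemma hausdorff_measure_disjoint_compact:
  fixes A B :: "'a::euclidean_space set"
  assumes "compact A" "compact B" "A \<inter> B = {}"
  shows "hausdorff_measure d A + hausdorff_measure d B \<le> hausdorff_measure d (A \<union> B)"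
proof -
  obtain e where e: "0 < e" "\<And>x y. x \<in> A \<Longrightarrow> y \<in> B \<Longrightarrow> e \<le> dist x y"
    using separate_compact_closed[OF assms(1) compact_imp_closed[OF assms(2)] assms(3)] by blast
  have pair: "hausdorff_content d \<delta> A + hausdorff_content d \<delta>' B \<le> hausdorff_measure d (A \<union> B)"
    if "0 < \<delta>" "0 < \<delta>'" for \<delta> \<delta>'
  proof -
    define m where "m = min (e / 2) (min \<delta> \<delta>')"
    have m: "0 < m" "m < e" "m \<le> \<delta>" "m \<le> \<delta>'" using e(1) that by (auto simp: m_def)
    have "hausdorff_content d \<delta> A + hausdorff_content d \<delta>' B \<le> hausdorff_content d m A + hausdorff_content d m B"
      using m by (intro add_mono hausdorff_content_antimono)
    also have "\<dots> \<le> hausdorff_content d m (A \<union> B)"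
      using e(2) m(2) by (intro hausdorff_content_separated) (auto intro: less_le_trans)
    also have "\<dots> \<le> hausdorff_measure d (A \<union> B)" unfolding hausdorff_measure_def using m by (intro SUP_upper) auto
    finally show ?thesis .
  qed
  have "hausdorff_content d \<delta> A + hausdorff_measure d B \<le> hausdorff_measure d (A \<union> B)" if "0 < \<delta>" for \<delta>
    unfolding hausdorff_measure_def[of d B] using that pair
    by (subst ennreal_SUP_add_right) (auto intro!: SUP_least)
  then show ?thesis
    unfolding hausdorff_measure_def[of d A]
    by (subst ennreal_SUP_add_left[symmetric]) (auto intro!: SUP_least)
qed

lemma hausdorff_measure_disjoint_compacts:
  fixes K :: "'i \<Rightarrow> 'a::euclidean_space set"
  assumes "finite I" "\<And>i. i \<in> I \<Longrightarrow> compact (K i)" "disjoint_family_on K I"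
  shows "(\<Sum>i\<in>I. hausdorff_measure d (K i)) \<le> hausdorff_measure d (\<Union>i\<in>I. K i)"
  using assms
proof (induction I rule: finite_induct)
  case (insert i I)
  have "(\<Sum>i\<in>insert i I. hausdorff_measure d (K i)) \<le> hausdorff_measure d (K i) + hausdorff_measure d (\<Union>i\<in>I. K i)"
    using insert by (auto intro!: add_left_mono insert.IH simp: disjoint_family_on_def)
  also have "\<dots> \<le> hausdorff_measure d (K i \<union> (\<Union>i\<in>I. K i))"
  proof (rule hausdorff_measure_disjoint_compact)
    show "compact (\<Union>i\<in>I. K i)" using insert by auto
    show "K i \<inter> (\<Union>i\<in>I. K i) = {}" using insert by (fastforce simp: disjoint_family_on_def)
  qed (use insert in auto)
  finally show ?case by simp
qed simp

text \<open>
  Cover the slab over \<open>A\<close> efficiently by small balls. Each slice of the slab at a height \<open>t\<close> between 0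
  and 1 is a copy of \<open>A\<close>, covered by slices of the balls, which are discs. The average over \<open>t\<close> of the
  total volume of these discs is the total volume of the balls, hence close to that of the slab.
\<close>

lemma hausdorff_measure_hyperplane_le:
  fixes A :: "'a::euclidean_space set"
  assumes nu: "norm \<nu> = 1" and A: "\<And>u. u \<in> A \<Longrightarrow> u \<bullet> \<nu> = 0" and dim: "2 \<le> DIM('a)"
    and bB: "sweep A (-\<nu>) \<in> sets borel"
  shows "hausdorff_measure (DIM('a) - 1) A \<le> emeasure lborel (sweep A (-\<nu>))"
proof (cases "A = {}")
  case False
  let ?d = "DIM('a) - 1" and ?B = "sweep A (-\<nu>)"
  let ?v = "\<lambda>C. if C = {} then 0 else ennreal (unit_ball_vol (real ?d) * (diameter C / 2) ^ ?d)"
  have nn: "\<nu> \<bullet> \<nu> = 1" using nu by (simp add: norm_eq_1)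
  have ne: "?B \<noteq> {}" using False by (auto simp: sweep_def)
  have "hausdorff_content ?d \<delta> A \<le> emeasure lborel ?B" if \<delta>: "0 < \<delta>" for \<delta>
  proof (rule ennreal_le_epsilon)
    fix e :: real assume e: "0 < e"
    obtain x r where xr: "\<And>i::nat. x i \<in> ?B \<and> 0 \<le> r i \<and> r i \<le> \<delta> / 2"
      "?B \<subseteq> (\<Union>i. cball (x i) (r i))"
      "(\<Sum>i. emeasure lborel (cball (x i) (r i))) \<le> emeasure lborel ?B + ennreal e"
      using ball_cover[OF bB ne e, of "\<delta> / 2"] \<delta> by auto
    let ?D = "\<lambda>t i. ennreal (disc_volume ?d (r i) (t - x i \<bullet> \<nu>))"
    have [measurable]: "disc_volume n q \<in> borel_measurable borel" for n q
      unfolding disc_volume_def by measurable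
    have slice: "hausdorff_content ?d \<delta> A \<le> (\<Sum>i. ?D t i)" if t: "0 \<le> t" "t \<le> 1" for t
    proof -
      define C where "C i = {u. u \<bullet> \<nu> = 0 \<and> u + t *\<^sub>R \<nu> \<in> cball (x i) (r i)}" for i
      define \<rho> where "\<rho> i = sqrt ((r i)\<^sup>2 - (t - x i \<bullet> \<nu>)\<^sup>2)" for i
      have key: "norm (u - hproj \<nu> (x i)) \<le> \<rho> i" "\<bar>t - x i \<bullet> \<nu>\<bar> \<le> r i" if "u \<in> C i" for u i
      proof -
        have u: "u \<bullet> \<nu> = 0" "norm (u + t *\<^sub>R \<nu> - x i) \<le> r i"
          using that by (auto simp: C_def dist_norm norm_minus_commute)
        have "u + t *\<^sub>R \<nu> - x i = (u - hproj \<nu> (x i)) + (t - x i \<bullet> \<nu>) *\<^sub>R \<nu>"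
          by (simp add: hproj_def algebra_simps)
        moreover have "(u - hproj \<nu> (x i)) \<bullet> \<nu> = 0" using u nu by (simp add: inner_diff_left)
        moreover have "(norm (p + c *\<^sub>R \<nu>))\<^sup>2 = (norm p)\<^sup>2 + c\<^sup>2" if "p \<bullet> \<nu> = 0" for p c
          using that unfolding power2_norm_eq_inner
          by (simp add: inner_add_left inner_add_right inner_commute nn power2_eq_square)
        ultimately have "(norm (u + t *\<^sub>R \<nu> - x i))\<^sup>2 = (norm (u - hproj \<nu> (x i)))\<^sup>2 + (t - x i \<bullet> \<nu>)\<^sup>2"
          by metis
        moreover have "(norm (u + t *\<^sub>R \<nu> - x i))\<^sup>2 \<le> (r i)\<^sup>2" using u by (intro power_mono) auto
        ultimately have le: "(norm (u - hproj \<nu> (x i)))\<^sup>2 + (t - x i \<bullet> \<nu>)\<^sup>2 \<le> (r i)\<^sup>2" by simp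
        then show "norm (u - hproj \<nu> (x i)) \<le> \<rho> i" unfolding \<rho>_def by (intro real_le_rsqrt) simp
        have "(t - x i \<bullet> \<nu>)\<^sup>2 \<le> (r i)\<^sup>2" using le by (smt (verit) zero_le_power2)
        then show "\<bar>t - x i \<bullet> \<nu>\<bar> \<le> r i" using xr(1)[of i] by (simp add: abs_le_square_iff[symmetric])
      qed
      have nrm: "norm (u - w) \<le> 2 * \<rho> i" if "u \<in> C i" "w \<in> C i" for u w i
        using key(1)[OF that(1)] key(1)[OF that(2)] norm_triangle_ineq4[of "u - hproj \<nu> (x i)" "w - hproj \<nu> (x i)"] by simp
      have rho: "0 \<le> \<rho> i" if "C i \<noteq> {}" for i using that key(1) norm_ge_zero order_trans by blast
      have dia: "diameter (C i) \<le> 2 * \<rho> i" if "C i \<noteq> {}" for i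
        using that nrm by (intro diameter_le) auto
      have bd: "bounded (C i)" for i
      proof (rule bounded_subset)
        show "C i \<subseteq> cball (x i - t *\<^sub>R \<nu>) (r i)" by (auto simp: C_def dist_norm algebra_simps)
      qed simp
      \<comment> \<open>A ball that only touches the hyperplane leaves a single point, of value 0 since the dimension of the slice is positive.\<close>
      have "hausdorff_content ?d \<delta> A \<le> (\<Sum>i. ?v (C i))"
        unfolding hausdorff_content_def
      proof (rule INF_lower, clarify, intro conjI allI)
        show "A \<subseteq> (\<Union>i. C i)"
        proof
          fix u assume u: "u \<in> A"
          then have "u + t *\<^sub>R \<nu> \<in> ?B" unfolding sweep_def using t by (intro image_eqI[where x="(u, t)"]) auto
          then obtain i where "u + t *\<^sub>R \<nu> \<in> cball (x i) (r i)" using xr(2) by blast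
          then show "u \<in> (\<Union>i. C i)" using A[OF u] by (auto simp: C_def)
        qed
        show "diameter (C i) \<le> \<delta>" for i
        proof (cases "C i = {}")
          case False
          have "\<rho> i \<le> r i" unfolding \<rho>_def using xr(1)[of i] by (intro real_le_lsqrt) auto
          then show ?thesis using dia[OF False] xr(1)[of i] by simp
        qed (use \<delta> in simp)
      qed (rule bd)
      also have "\<dots> \<le> (\<Sum>i. ?D t i)"
      proof (rule suminf_le)
        fix i
        show "?v (C i) \<le> ?D t i"
        proof (cases "C i = {}")
          case False
          have "(diameter (C i) / 2) ^ ?d \<le> \<rho> i ^ ?d"
            using dia[OF False] diameter_ge_0[OF bd] by (intro power_mono) auto
          also have "\<rho> i ^ ?d = (if \<bar>t - x i \<bullet> \<nu>\<bar> < r i then \<rho> i ^ ?d else 0)"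
          proof (cases "\<bar>t - x i \<bullet> \<nu>\<bar> < r i")
            case F: False
            obtain u where "u \<in> C i" using False by auto
            then have "\<bar>t - x i \<bullet> \<nu>\<bar> = r i" using F key(2) by fastforce
            then have "(t - x i \<bullet> \<nu>)\<^sup>2 = (r i)\<^sup>2" by (metis power2_abs)
            then have "\<rho> i = 0" by (simp add: \<rho>_def)
            then show ?thesis using dim F by simp
          qed simp
          finally have "unit_ball_vol (real ?d) * (diameter (C i) / 2) ^ ?d
              \<le> unit_ball_vol (real ?d) * (if \<bar>t - x i \<bullet> \<nu>\<bar> < r i then \<rho> i ^ ?d else 0)"
            by (rule mult_left_mono) simp
          also have "\<dots> = disc_volume ?d (r i) (t - x i \<bullet> \<nu>)"
            by (simp only: disc_volume_def \<rho>_def) simp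
          finally have "unit_ball_vol (real ?d) * (diameter (C i) / 2) ^ ?d \<le> disc_volume ?d (r i) (t - x i \<bullet> \<nu>)" .
          then show ?thesis using False by (simp only: if_False ennreal_leI)
        qed simp
      qed auto
      finally show ?thesis .
    qed
    have "hausdorff_content ?d \<delta> A = (\<integral>\<^sup>+t. hausdorff_content ?d \<delta> A * indicator {0..1::real} t \<partial>lborel)"
      by (subst nn_integral_cmult_indicator) auto
    also have "\<dots> \<le> (\<integral>\<^sup>+t. (\<Sum>i. ?D t i) \<partial>lborel)"
      using slice by (intro nn_integral_mono) (auto simp: indicator_def)
    also have "\<dots> = (\<Sum>i. \<integral>\<^sup>+t. ?D t i \<partial>lborel)"
      by (rule nn_integral_suminf) measurable
    also have "\<dots> = (\<Sum>i. emeasure lborel (cball (x i) (r i)))"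
      using xr(1) by (intro suminf_cong emeasure_cball_slices[OF nu]) auto
    also note xr(3)
    finally show "hausdorff_content ?d \<delta> A \<le> emeasure lborel ?B + ennreal e" .
  qed
  then show ?thesis unfolding hausdorff_measure_def by (intro SUP_least) auto
qed simp

section \<open>Flat sets\<close>

text \<open>
  The pieces of the hypersurface are of this kind. The class is closed under continuous images
  and sweeps, which settles all questions of measurability.
\<close>

definition sigma_compact :: "'a::topological_space set \<Rightarrow> bool" where
  "sigma_compact E \<longleftrightarrow> (\<exists>K::nat \<Rightarrow> 'a set. (\<forall>i. compact (K i)) \<and> incseq K \<and> E = (\<Union>i. K i))"

lemma sigma_compact_borel: "sigma_compact (E :: 'a::t2_space set) \<Longrightarrow> E \<in> sets borel"
  by (auto simp: sigma_compact_def borel_compact)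

lemma sigma_compact_image:
  assumes "sigma_compact E" "continuous_on UNIV f"
  shows "sigma_compact (f ` E)"
proof -
  obtain K where K: "\<forall>i::nat. compact (K i)" "incseq K" "E = (\<Union>i. K i)"
    using assms(1) by (auto simp: sigma_compact_def)
  have "compact (f ` K i)" for i
    using K(1) assms(2) by (intro compact_continuous_image) (auto intro: continuous_on_subset)
  moreover have "incseq (\<lambda>i. f ` K i)" using K(2) by (auto simp: incseq_def intro!: image_mono)
  ultimately show ?thesis unfolding sigma_compact_def K(3)
    by (intro exI[of _ "\<lambda>i. f ` K i"]) (auto simp: image_UN)
qed

lemma sigma_compact_sweep:
  assumes "sigma_compact E" shows "sigma_compact (sweep E v)"
proof -
  obtain K where K: "\<forall>i::nat. compact (K i)" "incseq K" "E = (\<Union>i. K i)"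
    using assms(1) by (auto simp: sigma_compact_def)
  then show ?thesis unfolding sigma_compact_def K(3)
    by (intro exI[of _ "\<lambda>i. sweep (K i) v"]) (auto simp: sweep_UN compact_sweep incseq_def intro!: sweep_mono)
qed

lemma sigma_compact_compact_Int_open:
  fixes K U :: "'a::euclidean_space set"
  assumes K: "compact K" and U: "open U"
  shows "sigma_compact (K \<inter> U)"
proof (cases "U = UNIV")
  case True
  then show ?thesis using K unfolding sigma_compact_def by (intro exI[of _ "\<lambda>_. K"]) auto
next
  case False
  let ?F = "\<lambda>i::nat. K \<inter> {x. inverse (real (Suc i)) \<le> infdist x (- U)}"
  have "compact (?F i)" for i
    by (intro compact_Int_closed K closed_Collect_le continuous_intros)
  moreover have "incseq ?F"
  proof (rule incseq_SucI)
    fix i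
    have "inverse (real (Suc (Suc i))) \<le> inverse (real (Suc i))" by (simp add: field_simps)
    then show "?F i \<subseteq> ?F (Suc i)" using order_trans by blast
  qed
  moreover have "K \<inter> U = (\<Union>i. ?F i)"
  proof (intro equalityI subsetI)
    fix x assume x: "x \<in> K \<inter> U"
    have "infdist x (- U) \<noteq> 0"
      using in_closed_iff_infdist_zero[of "- U" x] U False x by auto
    then have "0 < infdist x (- U)" using infdist_nonneg[of x "- U"] by linarith
    then obtain n where "inverse (real (Suc n)) < infdist x (- U)" using reals_Archimedean by blast
    then show "x \<in> (\<Union>i. ?F i)" using x by (auto intro!: exI[of _ n])
  next
    fix x assume "x \<in> (\<Union>i. ?F i)"
    then obtain i where x: "x \<in> K" "inverse (real (Suc i)) \<le> infdist x (- U)" by auto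
    moreover have "0 < inverse (real (Suc i))" by simp
    ultimately have "infdist x (- U) \<noteq> 0" by linarith
    then have "x \<in> U" using infdist_zero[of x "- U"] by blast
    then show "x \<in> K \<inter> U" using x by simp
  qed
  ultimately show ?thesis unfolding sigma_compact_def by (intro exI[of _ ?F] conjI allI)
qed

text \<open>
  The map is \<open>(1 + \<eta>)\<close>-Lipschitz and its inverse is \<open>1 / (1 - \<eta>)\<close>-Lipschitz.
\<close>

lemma emeasure_near_identity_image:
  fixes f :: "'a::euclidean_space \<Rightarrow> 'a"
  assumes X: "X \<in> sets borel" and fX: "f ` X \<in> sets borel" and \<eta>: "0 \<le> \<eta>" "\<eta> < 1"
    and near: "\<And>x y. x \<in> X \<Longrightarrow> y \<in> X \<Longrightarrow> norm ((f x - f y) - (x - y)) \<le> \<eta> * norm (x - y)"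
  shows "emeasure lborel (f ` X) \<le> ennreal ((1 + \<eta>) ^ DIM('a)) * emeasure lborel X"
    and "ennreal ((1 - \<eta>) ^ DIM('a)) * emeasure lborel X \<le> emeasure lborel (f ` X)"
proof -
  show "emeasure lborel (f ` X) \<le> ennreal ((1 + \<eta>) ^ DIM('a)) * emeasure lborel X"
  proof (rule emeasure_lipschitz_image_le[OF X])
    show "norm (f x - f y) \<le> (1 + \<eta>) * norm (x - y)" if "x \<in> X" "y \<in> X" for x y
      using near[OF that] norm_triangle_sub[of "f x - f y" "x - y"] by (simp add: distrib_right)
  qed (use \<eta> in simp)
  have lower: "(1 - \<eta>) * norm (x - y) \<le> norm (f x - f y)" if "x \<in> X" "y \<in> X" for x y
    using near[OF that] norm_triangle_sub[of "x - y" "f x - f y"] by (simp add: left_diff_distrib norm_minus_commute)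
  have inj: "inj_on f X"
  proof (rule inj_onI)
    fix x y assume xy: "x \<in> X" "y \<in> X" "f x = f y"
    then have "(1 - \<eta>) * norm (x - y) \<le> 0" using lower[of x y] by simp
    then show "x = y" using \<eta> by (simp add: mult_le_0_iff)
  qed
  let ?g = "inv_into X f"
  have "emeasure lborel (?g ` f ` X) \<le> ennreal ((1 / (1 - \<eta>)) ^ DIM('a)) * emeasure lborel (f ` X)"
  proof (rule emeasure_lipschitz_image_le[OF fX])
    fix a b assume "a \<in> f ` X" "b \<in> f ` X"
    then obtain x y where "x \<in> X" "y \<in> X" "a = f x" "b = f y" by auto
    then show "norm (?g a - ?g b) \<le> 1 / (1 - \<eta>) * norm (a - b)"
      using lower[of x y] inj \<eta> by (simp add: inv_into_f_f pos_le_divide_eq mult.commute)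
  qed (use \<eta> in simp)
  also have "?g ` f ` X = X" using inj by (simp add: inv_into_image_cancel)
  finally have "ennreal ((1 - \<eta>) ^ DIM('a)) * emeasure lborel X
     \<le> ennreal ((1 - \<eta>) ^ DIM('a)) * (ennreal ((1 / (1 - \<eta>)) ^ DIM('a)) * emeasure lborel (f ` X))"
    by (rule mult_left_mono) simp
  also have "\<dots> = emeasure lborel (f ` X)"
    using \<eta> by (simp add: mult.assoc[symmetric] power_mult_distrib[symmetric] flip: ennreal_mult)
  finally show "ennreal ((1 - \<eta>) ^ DIM('a)) * emeasure lborel X \<le> emeasure lborel (f ` X)" .
qed

text \<open>
  Every secant of \<open>E\<close> makes at most the angle \<open>arcsin \<epsilon>\<close> with the hyperplane orthogonal to \<open>\<nu>\<close>.
\<close>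

definition flat :: "'a::euclidean_space \<Rightarrow> real \<Rightarrow> 'a set \<Rightarrow> bool" where
  "flat \<nu> \<epsilon> E \<longleftrightarrow> (\<forall>p\<in>E. \<forall>q\<in>E. \<bar>(p - q) \<bullet> \<nu>\<bar> \<le> \<epsilon> * norm (p - q))"

text \<open>
  The \<open>(n - 1)\<close>-dimensional Lebesgue measure of the projection of \<open>E\<close>, written as the volume of the slab
  of height 1 above it.
\<close>

definition projected_area :: "'a::euclidean_space \<Rightarrow> 'a set \<Rightarrow> ennreal" where
  "projected_area \<nu> E = emeasure lborel (sweep (hproj \<nu> ` E) (-\<nu>))"

lemma hproj_decomposition: "hproj \<nu> x + (x \<bullet> \<nu>) *\<^sub>R \<nu> = x"
  by (simp add: hproj_def)

lemma flat_height_le: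
  assumes nu: "norm \<nu> = 1" and fl: "flat \<nu> \<epsilon> E" and \<epsilon>: "0 \<le> \<epsilon>" "\<epsilon> \<le> 1/2" and pq: "p \<in> E" "q \<in> E"
  shows "\<bar>(p - q) \<bullet> \<nu>\<bar> \<le> 2 * \<epsilon> * norm (hproj \<nu> p - hproj \<nu> q)"
proof -
  let ?h = "\<bar>(p - q) \<bullet> \<nu>\<bar>" and ?u = "norm (hproj \<nu> p - hproj \<nu> q)"
  have "p - q = (hproj \<nu> p - hproj \<nu> q) + ((p - q) \<bullet> \<nu>) *\<^sub>R \<nu>"
    by (simp add: hproj_diff[symmetric] hproj_decomposition)
  then have "norm (p - q) \<le> ?u + ?h"
    using norm_triangle_ineq[of "hproj \<nu> p - hproj \<nu> q" "((p - q) \<bullet> \<nu>) *\<^sub>R \<nu>"] nu by simp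
  then have "\<epsilon> * norm (p - q) \<le> \<epsilon> * (?u + ?h)" using \<epsilon> by (intro mult_left_mono) auto
  then have "?h \<le> \<epsilon> * ?u + \<epsilon> * ?h" using fl pq unfolding flat_def by (force simp: distrib_left)
  also have "\<epsilon> * ?h \<le> (1/2) * ?h" using \<epsilon> by (intro mult_right_mono) auto
  finally show ?thesis by simp
qed

lemma flat_norm_le:
  assumes nu: "norm \<nu> = 1" and fl: "flat \<nu> \<epsilon> E" and \<epsilon>: "0 \<le> \<epsilon>" "\<epsilon> \<le> 1/2" and pq: "p \<in> E" "q \<in> E"
  shows "norm (p - q) \<le> (1 + 2 * \<epsilon>) * norm (hproj \<nu> p - hproj \<nu> q)"
proof -
  have "p - q = (hproj \<nu> p - hproj \<nu> q) + ((p - q) \<bullet> \<nu>) *\<^sub>R \<nu>"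
    by (simp add: hproj_diff[symmetric] hproj_decomposition)
  then have "norm (p - q) \<le> norm (hproj \<nu> p - hproj \<nu> q) + \<bar>(p - q) \<bullet> \<nu>\<bar>"
    using norm_triangle_ineq[of "hproj \<nu> p - hproj \<nu> q" "((p - q) \<bullet> \<nu>) *\<^sub>R \<nu>"] nu by simp
  then show ?thesis using flat_height_le[OF assms] by (simp add: distrib_right)
qed

lemma flat_inj_on_hproj:
  assumes "norm \<nu> = 1" "flat \<nu> \<epsilon> E" "0 \<le> \<epsilon>" "\<epsilon> \<le> 1/2"
  shows "inj_on (hproj \<nu>) E"
proof (rule inj_onI)
  fix p q assume "p \<in> E" "q \<in> E" "hproj \<nu> p = hproj \<nu> q"
  then show "p = q" using flat_norm_le[OF assms, of p q] by simp
qed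

lemma sigma_compact_shadow:
  "sigma_compact E \<Longrightarrow> sweep (hproj \<nu> ` E) v \<in> sets borel"
  by (intro sigma_compact_borel sigma_compact_sweep sigma_compact_image continuous_on_hproj)

lemma projected_area_finite:
  assumes "bounded E" shows "projected_area \<nu> E < top"
proof -
  have "compact (closure E)" using assms by (simp add: compact_closure)
  then have c: "compact (sweep (hproj \<nu> ` closure E) (-\<nu>))"
    by (intro compact_sweep compact_continuous_image continuous_on_hproj)
  have "projected_area \<nu> E \<le> emeasure lborel (sweep (hproj \<nu> ` closure E) (-\<nu>))"
    unfolding projected_area_def
    by (intro emeasure_mono sweep_mono image_mono closure_subset) (use borel_compact[OF c] in simp)
  also have "\<dots> < top" using emeasure_bounded_finite[OF compact_imp_bounded[OF c]] by simp
  finally show ?thesis .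
qed

lemma image_sweep:
  assumes "\<And>p t. p \<in> E \<Longrightarrow> f (g p - t *\<^sub>R w) = p - t *\<^sub>R v"
  shows "f ` sweep (g ` E) w = sweep E v"
proof -
  have "sweep (g ` E) w = (\<lambda>(p, t). g p - t *\<^sub>R w) ` (E \<times> {0..1})"
    unfolding sweep_def by force
  then have "f ` sweep (g ` E) w = (\<lambda>z. f (case z of (p, t) \<Rightarrow> g p - t *\<^sub>R w)) ` (E \<times> {0..1})"
    by (simp only: image_image)
  also have "\<dots> = sweep E v"
    unfolding sweep_def by (intro image_cong) (auto simp only: assms split: prod.split)
  finally show ?thesis .
qed

text \<open>
  Moving each point of the sweep of the projection in the direction of \<open>\<nu>\<close> by the height of the point
  of \<open>E\<close> above its foot maps it onto the sweep of \<open>E\<close>. The feet depend on the points with Lipschitz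
  constant \<open>2 / \<beta>\<close> and the heights on the feet with constant \<open>2 \<epsilon>\<close>, so this map is close
  to the identity when \<open>\<epsilon>\<close> is small compared with \<open>\<beta>\<close>.
\<close>

lemma sweep_flat_bounds:
  fixes E :: "'a::euclidean_space set"
  assumes nu: "norm \<nu> = 1" and fl: "flat \<nu> \<epsilon> E" and \<epsilon>: "0 \<le> \<epsilon>" "\<epsilon> \<le> 1/2" and E: "sigma_compact E"
    and \<beta>: "0 < \<beta>" "\<beta> \<le> 1" and \<eta>: "4 * \<epsilon> \<le> \<beta> * \<eta>" "\<eta> < 1"
    and v: "v \<noteq> 0" "\<beta> * norm v \<le> \<bar>v \<bullet> \<nu>\<bar>"
  shows "emeasure lborel (sweep E v) \<le> ennreal ((1 + \<eta>) ^ DIM('a)) * (ennreal \<bar>v \<bullet> \<nu>\<bar> * projected_area \<nu> E)"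
    and "ennreal ((1 - \<eta>) ^ DIM('a)) * (ennreal \<bar>v \<bullet> \<nu>\<bar> * projected_area \<nu> E) \<le> emeasure lborel (sweep E v)"
proof -
  let ?A = "hproj \<nu> ` E" and ?G = "inv_into E (hproj \<nu>)"
  have inj: "inj_on (hproj \<nu>) E" by (rule flat_inj_on_hproj[OF nu fl \<epsilon>])
  have vn: "v \<bullet> \<nu> \<noteq> 0" using v \<beta> by (metis abs_zero mult_pos_pos not_le zero_less_norm_iff)
  have "0 \<le> \<beta> * \<eta>" using \<epsilon>(1) \<eta>(1) by linarith
  then have \<eta>0: "0 \<le> \<eta>" using \<beta>(1) by (simp add: zero_le_mult_iff)
  define base where "base x = x - ((x \<bullet> \<nu>) / (v \<bullet> \<nu>)) *\<^sub>R v" for x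
  define f where "f x = x + (?G (base x) \<bullet> \<nu>) *\<^sub>R \<nu>" for x
  have base: "base (hproj \<nu> p - t *\<^sub>R v) = hproj \<nu> p" for p t
    using vn nu by (simp add: base_def inner_diff_left)
  have fval: "f (hproj \<nu> p - t *\<^sub>R v) = p - t *\<^sub>R v" if "p \<in> E" for p t
    using that inj hproj_decomposition[of \<nu> p] by (simp add: f_def base inv_into_f_f algebra_simps)
  have img: "f ` sweep ?A v = sweep E v"
    by (rule image_sweep[OF fval])
  have bA: "sweep ?A v \<in> sets borel" by (rule sigma_compact_shadow[OF E])
  have bE: "sweep E v \<in> sets borel" by (intro sigma_compact_borel sigma_compact_sweep E)
  have near: "norm ((f x - f y) - (x - y)) \<le> \<eta> * norm (x - y)" if xy: "x \<in> sweep ?A v" "y \<in> sweep ?A v" for x y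
  proof -
    obtain p t where p: "p \<in> E" "x = hproj \<nu> p - t *\<^sub>R v" using xy(1) by (auto simp: sweep_def)
    obtain q s where q: "q \<in> E" "y = hproj \<nu> q - s *\<^sub>R v" using xy(2) by (auto simp: sweep_def)
    have b: "base x = hproj \<nu> p" "base y = hproj \<nu> q" by (simp_all add: p q base)
    have "(f x - f y) - (x - y) = ((p - q) \<bullet> \<nu>) *\<^sub>R \<nu>"
      using inj p(1) q(1) by (simp add: f_def b inv_into_f_f inner_diff_left algebra_simps)
    then have "norm ((f x - f y) - (x - y)) = \<bar>(p - q) \<bullet> \<nu>\<bar>" using nu by simp
    also have "\<dots> \<le> 2 * \<epsilon> * norm (base x - base y)"
      unfolding b by (rule flat_height_le[OF nu fl \<epsilon> p(1) q(1)])
    also have "norm (base x - base y) \<le> (2 / \<beta>) * norm (x - y)"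
    proof -
      have "base x - base y = (x - y) - (((x - y) \<bullet> \<nu>) / (v \<bullet> \<nu>)) *\<^sub>R v"
        by (simp add: base_def inner_diff_left diff_divide_distrib algebra_simps)
      then have "norm (base x - base y) \<le> norm (x - y) + \<bar>(x - y) \<bullet> \<nu>\<bar> * (norm v / \<bar>v \<bullet> \<nu>\<bar>)"
        using norm_triangle_ineq4[of "x - y" "(((x - y) \<bullet> \<nu>) / (v \<bullet> \<nu>)) *\<^sub>R v"] by (simp add: abs_divide)
      also have "\<dots> \<le> norm (x - y) + norm (x - y) * (1 / \<beta>)"
      proof (intro add_left_mono mult_mono)
        show "\<bar>(x - y) \<bullet> \<nu>\<bar> \<le> norm (x - y)" using Cauchy_Schwarz_ineq2[of "x - y" \<nu>] nu by simp
        show "norm v / \<bar>v \<bullet> \<nu>\<bar> \<le> 1 / \<beta>" using v \<beta> vn by (simp add: field_simps)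
      qed auto
      also have "\<dots> \<le> norm (x - y) * (1 / \<beta>) + norm (x - y) * (1 / \<beta>)"
        using \<beta> mult_left_mono[of 1 "1 / \<beta>" "norm (x - y)"] by simp
      finally show ?thesis by simp
    qed
    then have "2 * \<epsilon> * norm (base x - base y) \<le> 2 * \<epsilon> * ((2 / \<beta>) * norm (x - y))"
      using \<epsilon> by (intro mult_left_mono) auto
    also have "\<dots> = (4 * \<epsilon> / \<beta>) * norm (x - y)" by simp
    also have "\<dots> \<le> \<eta> * norm (x - y)"
      using \<eta> \<beta> by (intro mult_right_mono) (auto simp: field_simps)
    finally show ?thesis .
  qed
  have hyp: "emeasure lborel (sweep ?A v) = ennreal \<bar>v \<bullet> \<nu>\<bar> * projected_area \<nu> E"
    unfolding projected_area_def using nu vn bA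
    by (intro emeasure_sweep_hyperplane) auto
  note im = emeasure_near_identity_image[OF bA _ \<eta>0 \<eta>(2) near, unfolded img hyp]
  show "emeasure lborel (sweep E v) \<le> ennreal ((1 + \<eta>) ^ DIM('a)) * (ennreal \<bar>v \<bullet> \<nu>\<bar> * projected_area \<nu> E)"
    using bE by (rule im(1))
  show "ennreal ((1 - \<eta>) ^ DIM('a)) * (ennreal \<bar>v \<bullet> \<nu>\<bar> * projected_area \<nu> E) \<le> emeasure lborel (sweep E v)"
    using bE by (rule im(2))
qed

text \<open>
  The previous map degenerates near tangency. Here the upright slab of height \<open>norm v\<close> over the
  projection is mapped to the sweep; this map is 3-Lipschitz whatever the direction of \<open>v\<close> is.
\<close>

lemma sweep_flat_crude:
  fixes E :: "'a::euclidean_space set"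
  assumes nu: "norm \<nu> = 1" and fl: "flat \<nu> \<epsilon> E" and \<epsilon>: "0 \<le> \<epsilon>" "\<epsilon> \<le> 1/2" and E: "sigma_compact E" and v: "v \<noteq> 0"
  shows "emeasure lborel (sweep E v) \<le> ennreal (3 ^ DIM('a)) * (ennreal (norm v) * projected_area \<nu> E)"
proof -
  let ?A = "hproj \<nu> ` E" and ?G = "inv_into E (hproj \<nu>)"
  have inj: "inj_on (hproj \<nu>) E" by (rule flat_inj_on_hproj[OF nu fl \<epsilon>])
  have nn: "\<nu> \<bullet> \<nu> = 1" using nu by (simp add: norm_eq_1)
  let ?X = "sweep ?A (- (norm v) *\<^sub>R \<nu>)"
  define f where "f x = ?G (hproj \<nu> x) - (x \<bullet> \<nu>) *\<^sub>R (v /\<^sub>R norm v)" for x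
  have "hproj \<nu> (hproj \<nu> p + c *\<^sub>R \<nu>) = hproj \<nu> p" for p c
    using nu nn by (simp add: hproj_def[of \<nu> "hproj \<nu> p + c *\<^sub>R \<nu>"] inner_add_left)
  then have hp: "hproj \<nu> (hproj \<nu> p - t *\<^sub>R (- norm v *\<^sub>R \<nu>)) = hproj \<nu> p"
    "(hproj \<nu> p - t *\<^sub>R (- norm v *\<^sub>R \<nu>)) \<bullet> \<nu> = t * norm v" for p t
    using nu nn by (simp_all add: inner_add_left)
  have fval: "f (hproj \<nu> p - t *\<^sub>R (- norm v *\<^sub>R \<nu>)) = p - t *\<^sub>R v" if "p \<in> E" for p t
    unfolding f_def hp using that inj v by (simp add: inv_into_f_f)
  have img: "f ` ?X = sweep E v"
    by (rule image_sweep[OF fval])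
  have bX: "?X \<in> sets borel" by (rule sigma_compact_shadow[OF E])
  have "emeasure lborel (f ` ?X) \<le> ennreal (3 ^ DIM('a)) * emeasure lborel ?X"
  proof (rule emeasure_lipschitz_image_le[OF bX])
    fix x y assume "x \<in> ?X" "y \<in> ?X"
    then obtain p t q s where p: "p \<in> E" "hproj \<nu> x = hproj \<nu> p" and q: "q \<in> E" "hproj \<nu> y = hproj \<nu> q"
      using hp unfolding sweep_def by force
    have "f x - f y = (p - q) - ((x - y) \<bullet> \<nu>) *\<^sub>R (v /\<^sub>R norm v)"
      using inj p q by (simp add: f_def inv_into_f_f inner_diff_left algebra_simps)
    then have "norm (f x - f y) \<le> norm (p - q) + norm (((x - y) \<bullet> \<nu>) *\<^sub>R (v /\<^sub>R norm v))"
      by (simp only: norm_triangle_ineq4)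
    also have "norm (((x - y) \<bullet> \<nu>) *\<^sub>R (v /\<^sub>R norm v)) = \<bar>(x - y) \<bullet> \<nu>\<bar>"
      using v by (simp add: abs_mult)
    finally have "norm (f x - f y) \<le> norm (p - q) + \<bar>(x - y) \<bullet> \<nu>\<bar>" .
    also have "\<dots> \<le> (1 + 2 * \<epsilon>) * norm (hproj \<nu> (x - y)) + norm (x - y)"
      using flat_norm_le[OF nu fl \<epsilon> p(1) q(1)] Cauchy_Schwarz_ineq2[of "x - y" \<nu>] nu
      by (intro add_mono) (auto simp: hproj_diff p q)
    also have "(1 + 2 * \<epsilon>) * norm (hproj \<nu> (x - y)) \<le> 2 * norm (x - y)"
      using \<epsilon> norm_hproj_le[OF nu] by (intro mult_mono) auto
    finally show "norm (f x - f y) \<le> 3 * norm (x - y)" by simp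
  qed simp
  also have "emeasure lborel ?X = ennreal (norm v) * projected_area \<nu> E"
    unfolding projected_area_def using nu nn v bX
    by (subst emeasure_sweep_hyperplane[of \<nu>]) auto
  finally show ?thesis unfolding img .
qed

text \<open>
  The Lipschitz image of a subset of a hyperplane is a null set.
\<close>

lemma flat_null:
  fixes E :: "'a::euclidean_space set"
  assumes nu: "norm \<nu> = 1" and fl: "flat \<nu> \<epsilon> E" and \<epsilon>: "0 \<le> \<epsilon>" "\<epsilon> \<le> 1/2" and E: "sigma_compact E"
  shows "emeasure lborel E = 0"
proof -
  let ?A = "hproj \<nu> ` E" and ?G = "inv_into E (hproj \<nu>)"
  have inj: "inj_on (hproj \<nu>) E" by (rule flat_inj_on_hproj[OF nu fl \<epsilon>])
  have bA: "?A \<in> sets borel" by (intro sigma_compact_borel sigma_compact_image E continuous_on_hproj)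
  have "negligible {x. \<nu> \<bullet> x = 0}" using nu by (intro negligible_hyperplane) auto
  moreover have "?A \<subseteq> {x. \<nu> \<bullet> x = 0}" using nu by (auto simp: inner_commute[of \<nu>])
  ultimately have "negligible ?A" by (rule negligible_subset)
  then have A0: "emeasure lborel ?A = 0"
    using bA by (simp add: negligible_iff_null_sets null_sets_completion_iff null_sets_def)
  have "emeasure lborel (?G ` ?A) \<le> ennreal ((1 + 2 * \<epsilon>) ^ DIM('a)) * emeasure lborel ?A"
    using flat_norm_le[OF nu fl \<epsilon>] inj \<epsilon> by (intro emeasure_lipschitz_image_le[OF bA]) (auto simp: inv_into_f_f)
  then show ?thesis using A0 inj by (simp add: inv_into_image_cancel)
qed

text \<open>
  By flatness \<open>E\<close> is the image of its projection under a \<open>(1 + 2 * \<epsilon>)\<close>-Lipschitz map.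
\<close>

lemma hausdorff_measure_flat_le:
  fixes E :: "'a::euclidean_space set"
  assumes nu: "norm \<nu> = 1" and fl: "flat \<nu> \<epsilon> E" and \<epsilon>: "0 \<le> \<epsilon>" "\<epsilon> \<le> 1/2" and E: "sigma_compact E" and dim: "2 \<le> DIM('a)"
  shows "hausdorff_measure (DIM('a) - 1) E \<le> ennreal ((1 + 2 * \<epsilon>) ^ (DIM('a) - 1)) * projected_area \<nu> E"
proof -
  let ?A = "hproj \<nu> ` E" and ?G = "inv_into E (hproj \<nu>)"
  have inj: "inj_on (hproj \<nu>) E" by (rule flat_inj_on_hproj[OF nu fl \<epsilon>])
  have "hausdorff_measure (DIM('a) - 1) (?G ` ?A) \<le> ennreal ((1 + 2 * \<epsilon>) ^ (DIM('a) - 1)) * hausdorff_measure (DIM('a) - 1) ?A"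
    using flat_norm_le[OF nu fl \<epsilon>] inj \<epsilon> by (intro hausdorff_measure_lipschitz_image_le) (auto simp: inv_into_f_f)
  also have "\<dots> \<le> ennreal ((1 + 2 * \<epsilon>) ^ (DIM('a) - 1)) * projected_area \<nu> E"
    unfolding projected_area_def using nu dim
    by (intro mult_left_mono hausdorff_measure_hyperplane_le sigma_compact_shadow E) auto
  also have "?G ` ?A = E" using inj by (simp add: inv_into_image_cancel)
  finally show ?thesis .
qed

text \<open>
  The sets \<open>E i\<close> are exhausted by compact sets. On disjoint compact sets, which have positive
  distance, the Hausdorff measure is additive.
\<close>

lemma sum_projected_area_le_hausdorff:
  fixes E :: "'i \<Rightarrow> 'a::euclidean_space set"
  assumes I: "finite I" and E: "\<And>i. i \<in> I \<Longrightarrow> sigma_compact (E i)" and dis: "disjoint_family_on E I"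
    and nu: "\<And>i. i \<in> I \<Longrightarrow> norm (\<nu> i) = 1"
  shows "(\<Sum>i\<in>I. projected_area (\<nu> i) (E i)) \<le> hausdorff_measure (DIM('a) - 1) (\<Union>i\<in>I. E i)"
proof -
  let ?d = "DIM('a) - 1"
  have "\<forall>i\<in>I. \<exists>K::nat \<Rightarrow> 'a set. (\<forall>m. compact (K m)) \<and> incseq K \<and> E i = (\<Union>m. K m)"
    using E by (auto simp: sigma_compact_def)
  then obtain K where K: "\<And>i m. i \<in> I \<Longrightarrow> compact (K i m)" "\<And>i. i \<in> I \<Longrightarrow> incseq (K i)" "\<And>i. i \<in> I \<Longrightarrow> E i = (\<Union>m::nat. K i m)"
    by metis
  have bK: "sweep (hproj (\<nu> i) ` K i m) (- \<nu> i) \<in> sets borel" if "i \<in> I" for i m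
    using K(1)[OF that] by (intro borel_compact compact_sweep compact_continuous_image continuous_on_hproj)
  have "(\<Sum>i\<in>I. projected_area (\<nu> i) (E i)) = (\<Sum>i\<in>I. SUP m. projected_area (\<nu> i) (K i m))"
  proof (intro sum.cong refl)
    fix i assume i: "i \<in> I"
    have "(SUP m. projected_area (\<nu> i) (K i m)) = emeasure lborel (\<Union>m. sweep (hproj (\<nu> i) ` K i m) (- \<nu> i))"
      unfolding projected_area_def
    proof (rule SUP_emeasure_incseq)
      show "incseq (\<lambda>m. sweep (hproj (\<nu> i) ` K i m) (- \<nu> i))"
        using K(2)[OF i] by (auto simp: incseq_def intro!: sweep_mono image_mono)
    qed (use bK[OF i] in auto)
    also have "(\<Union>m. sweep (hproj (\<nu> i) ` K i m) (- \<nu> i)) = sweep (hproj (\<nu> i) ` E i) (- \<nu> i)"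
      by (simp add: sweep_UN[symmetric] K(3)[OF i] image_UN)
    finally show "projected_area (\<nu> i) (E i) = (SUP m. projected_area (\<nu> i) (K i m))"
      by (simp add: projected_area_def)
  qed
  also have "\<dots> = (SUP m. \<Sum>i\<in>I. projected_area (\<nu> i) (K i m))"
  proof (rule ennreal_SUP_sum[symmetric])
    show "incseq (\<lambda>m. projected_area (\<nu> i) (K i m))" if "i \<in> I" for i
      using K(2)[OF that] bK[OF that] unfolding projected_area_def
      by (auto simp: incseq_def intro!: emeasure_mono sweep_mono image_mono)
  qed
  also have "\<dots> \<le> hausdorff_measure ?d (\<Union>i\<in>I. E i)"
  proof (rule SUP_least)
    fix m
    have "(\<Sum>i\<in>I. projected_area (\<nu> i) (K i m)) \<le> (\<Sum>i\<in>I. hausdorff_measure ?d (K i m))"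
      unfolding projected_area_def using nu by (intro sum_mono projection_measure_le_hausdorff)
    also have "\<dots> \<le> hausdorff_measure ?d (\<Union>i\<in>I. K i m)"
    proof (rule hausdorff_measure_disjoint_compacts[OF I])
      show "disjoint_family_on (\<lambda>i. K i m) I"
        using dis K(3) by (fastforce simp: disjoint_family_on_def)
    qed (rule K(1))
    also have "\<dots> \<le> hausdorff_measure ?d (\<Union>i\<in>I. E i)"
      using K(3) by (intro hausdorff_measure_mono) auto
    finally show "(\<Sum>i\<in>I. projected_area (\<nu> i) (K i m)) \<le> hausdorff_measure ?d (\<Union>i\<in>I. E i)" .
  qed
  finally show ?thesis .
qed

section \<open>Hypersurfaces are locally flat\<close>

lemma C1_diffeomorphism_inverse_derivatives:
  assumes diff: "C1_diffeomorphism U V \<phi> \<psi>" and p: "p \<in> U"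
  shows "\<exists>D. (\<psi> has_derivative D) (at (\<phi> p)) \<and>
    (\<forall>v. D (frechet_derivative \<phi> (at p) v) = v) \<and> (\<forall>w. frechet_derivative \<phi> (at p) (D w) = w)"
proof -
  have U: "open U" and V: "open V" and hom: "homeomorphism U V \<phi> \<psi>" and C1: "C1_on \<phi> U" "C1_on \<psi> V"
    using diff unfolding C1_diffeomorphism_def by blast+
  have zV: "\<phi> p \<in> V" and bk: "\<psi> (\<phi> p) = p" using hom p by (auto simp: homeomorphism_def)
  obtain \<phi>' where \<phi>': "(\<phi> has_derivative blinfun_apply (\<phi>' p)) (at p)"
    using C1(1) p unfolding C1_on_def by blast
  obtain \<psi>' where \<psi>': "(\<psi> has_derivative blinfun_apply (\<psi>' (\<phi> p))) (at (\<phi> p))"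
    using C1(2) zV unfolding C1_on_def by blast
  have fr: "frechet_derivative \<phi> (at p) = blinfun_apply (\<phi>' p)"
    by (rule frechet_derivative_at[OF \<phi>', symmetric])
  have "(\<psi> \<circ> \<phi> has_derivative blinfun_apply (\<psi>' (\<phi> p)) \<circ> blinfun_apply (\<phi>' p)) (at p)"
    by (rule diff_chain_at[OF \<phi>' \<psi>'])
  moreover have "(\<psi> \<circ> \<phi> has_derivative id) (at p)"
    by (rule has_derivative_transform_within_open[OF has_derivative_id U p])
       (use hom in \<open>auto simp: homeomorphism_def\<close>)
  ultimately have 1: "blinfun_apply (\<psi>' (\<phi> p)) \<circ> blinfun_apply (\<phi>' p) = id" by (rule has_derivative_unique)
  have "(\<phi> \<circ> \<psi> has_derivative blinfun_apply (\<phi>' p) \<circ> blinfun_apply (\<psi>' (\<phi> p))) (at (\<phi> p))"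
    by (rule diff_chain_at[OF \<psi>']) (simp add: bk \<phi>')
  moreover have "(\<phi> \<circ> \<psi> has_derivative id) (at (\<phi> p))"
    by (rule has_derivative_transform_within_open[OF has_derivative_id V zV])
       (use hom in \<open>auto simp: homeomorphism_def\<close>)
  ultimately have 2: "blinfun_apply (\<phi>' p) \<circ> blinfun_apply (\<psi>' (\<phi> p)) = id" by (rule has_derivative_unique)
  show ?thesis
    by (intro exI[of _ "blinfun_apply (\<psi>' (\<phi> p))"] conjI \<psi>') (use 1 2 in \<open>auto simp: fr fun_eq_iff\<close>)
qed

text \<open>
  The chart sends \<open>S\<close> into the hyperplane orthogonal to \<open>b\<close>, so \<open>\<nu>\<close> is the normalised gradient at \<open>p\<close> of
  the component of the chart along \<open>b\<close>. By the mean value inequality and the continuity of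
  the derivative, this component differs from its linearisation at \<open>p\<close> by a map with small
  Lipschitz constant near \<open>p\<close>.
\<close>

lemma hypersurface_chart_flat:
  fixes S :: "'a::euclidean_space set"
  assumes chart: "hypersurface_chart S U \<phi> b" and p: "p \<in> U" and \<epsilon>: "0 < \<epsilon>"
  obtains \<nu> \<delta> where "norm \<nu> = 1" "0 < \<delta>" "flat \<nu> \<epsilon> (S \<inter> ball p \<delta>)"
proof -
  obtain V \<psi> where b: "b \<in> Basis" and diff: "C1_diffeomorphism U V \<phi> \<psi>"
    and img: "\<phi> ` (S \<inter> U) = {z \<in> V. z \<bullet> b = 0} \<or> (\<exists>c \<in> Basis - {b}. \<phi> ` (S \<inter> U) = {z \<in> V. z \<bullet> b = 0 \<and> z \<bullet> c \<ge> 0})"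
    using chart unfolding hypersurface_chart_def by blast
  have zero: "\<phi> x \<bullet> b = 0" if "x \<in> S" "x \<in> U" for x
    using img that by blast
  have U: "open U" and C1: "C1_on \<phi> U" using diff unfolding C1_diffeomorphism_def by blast+
  obtain \<phi>' where \<phi>': "\<And>x. x \<in> U \<Longrightarrow> (\<phi> has_derivative blinfun_apply (\<phi>' x)) (at x)" "continuous_on U \<phi>'"
    using C1 unfolding C1_on_def by blast
  let ?D = "blinfun_apply (\<phi>' p)"
  have lin: "linear ?D" using blinfun.bounded_linear_right bounded_linear.linear by blast
  define m where "m = adjoint ?D b"
  have m: "v \<bullet> m = ?D v \<bullet> b" for v unfolding m_def by (rule adjoint_works[OF lin])
  obtain D where "\<forall>w. frechet_derivative \<phi> (at p) (D w) = w"
    using C1_diffeomorphism_inverse_derivatives[OF diff p] by blast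
  then have "?D (D b) = b" using frechet_derivative_at[OF \<phi>'(1)[OF p]] by simp
  then have "D b \<bullet> m = 1" using m[of "D b"] b by simp
  then have m0: "0 < norm m" by auto
  define e where "e = \<epsilon> * norm m"
  have e: "0 < e" using \<epsilon> m0 by (simp add: e_def)
  have "continuous (at p) \<phi>'" using \<phi>'(2) U p by (simp add: continuous_on_eq_continuous_at)
  then obtain d where d: "0 < d" "\<And>x. dist x p < d \<Longrightarrow> dist (\<phi>' x) (\<phi>' p) < e"
    using e unfolding continuous_at_eps_delta by (metis dist_commute)
  obtain r where r: "0 < r" "ball p r \<subseteq> U" by (rule openE[OF U p])
  define \<delta> where "\<delta> = min d r"
  have \<delta>: "0 < \<delta>" using d(1) r(1) by (simp add: \<delta>_def)
  have \<delta>U: "x \<in> U" if "x \<in> ball p \<delta>" for x using that r(2) by (auto simp: \<delta>_def)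
  have key: "norm ((\<phi> x - ?D x) - (\<phi> y - ?D y)) \<le> e * norm (x - y)" if "x \<in> ball p \<delta>" "y \<in> ball p \<delta>" for x y
  proof (rule differentiable_bound[where f="\<lambda>x. \<phi> x - ?D x" and S="ball p \<delta>" and f'="\<lambda>x h. \<phi>' x h - ?D h"])
    fix x assume x: "x \<in> ball p \<delta>"
    have "((\<lambda>x. \<phi> x - ?D x) has_derivative (\<lambda>h. \<phi>' x h - ?D h)) (at x)"
      by (intro has_derivative_diff \<phi>'(1) \<delta>U x bounded_linear_imp_has_derivative blinfun.bounded_linear_right)
    then show "((\<lambda>x. \<phi> x - ?D x) has_derivative (\<lambda>h. \<phi>' x h - ?D h)) (at x within ball p \<delta>)"
      by (rule has_derivative_at_withinI)
    have "onorm (\<lambda>h. \<phi>' x h - ?D h) = norm (\<phi>' x - \<phi>' p)"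
      by (simp add: norm_blinfun.rep_eq minus_blinfun.rep_eq)
    also have "\<dots> \<le> e" using d(2)[of x] x by (auto simp: \<delta>_def dist_norm norm_minus_commute)
    finally show "onorm (\<lambda>h. \<phi>' x h - ?D h) \<le> e" .
  qed (use that in auto)
  show ?thesis
  proof
    show "norm (m /\<^sub>R norm m) = 1" using m0 by simp
    show "0 < \<delta>" by (rule \<delta>)
    show "flat (m /\<^sub>R norm m) \<epsilon> (S \<inter> ball p \<delta>)"
      unfolding flat_def
    proof (intro ballI)
      fix x y assume x: "x \<in> S \<inter> ball p \<delta>" and y: "y \<in> S \<inter> ball p \<delta>"
      have "(x - y) \<bullet> m = - (((\<phi> x - ?D x) - (\<phi> y - ?D y)) \<bullet> b)"
        using zero x y \<delta>U by (simp add: m linear_diff[OF lin] inner_diff_left)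
      then have "\<bar>(x - y) \<bullet> m\<bar> \<le> norm ((\<phi> x - ?D x) - (\<phi> y - ?D y))"
        using Cauchy_Schwarz_ineq2[of "(\<phi> x - ?D x) - (\<phi> y - ?D y)" b] b by simp
      also have "\<dots> \<le> e * norm (x - y)" using key x y by auto
      finally have "\<bar>(x - y) \<bullet> m\<bar> / norm m \<le> \<epsilon> * norm (x - y)"
        using m0 by (simp add: e_def field_simps)
      then show "\<bar>(x - y) \<bullet> (m /\<^sub>R norm m)\<bar> \<le> \<epsilon> * norm (x - y)"
        using m0 by (simp add: abs_mult divide_inverse mult.commute)
    qed
  qed
qed

text \<open>
  Pulling back a straight line in the image of the chart gives a curve in \<open>S\<close> with velocity \<open>v\<close> or
  \<open>- v\<close>, so \<open>v\<close> is a limit of directions of secants. In particular the estimate is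
  independent of the chart that witnesses tangency.
\<close>

lemma tangent_space_flat:
  fixes S :: "'a::euclidean_space set"
  assumes v: "v \<in> tangent_space S p" and p: "p \<in> S" and nu: "norm \<nu> = 1" and \<epsilon>: "0 < \<epsilon>" and \<delta>: "0 < \<delta>"
    and fl: "flat \<nu> \<epsilon> (S \<inter> ball p \<delta>)"
  shows "\<bar>v \<bullet> \<nu>\<bar> \<le> \<epsilon> * norm v"
proof -
  obtain U \<phi> b where pU: "p \<in> U" and chart: "hypersurface_chart S U \<phi> b"
    and wb: "frechet_derivative \<phi> (at p) v \<bullet> b = 0"
    using v unfolding tangent_space_def by blast
  obtain V \<psi> where diff: "C1_diffeomorphism U V \<phi> \<psi>"
    and img: "\<phi> ` (S \<inter> U) = {z \<in> V. z \<bullet> b = 0} \<or> (\<exists>c \<in> Basis - {b}. \<phi> ` (S \<inter> U) = {z \<in> V. z \<bullet> b = 0 \<and> z \<bullet> c \<ge> 0})"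
    using chart unfolding hypersurface_chart_def by blast
  have hom: "homeomorphism U V \<phi> \<psi>" and V: "open V" using diff unfolding C1_diffeomorphism_def by blast+
  define w where "w = frechet_derivative \<phi> (at p) v"
  obtain D where "(\<psi> has_derivative D) (at (\<phi> p))" "\<forall>v. D (frechet_derivative \<phi> (at p) v) = v"
    using C1_diffeomorphism_inverse_derivatives[OF diff pU] by blast
  then have D: "(\<psi> has_derivative D) (at (\<phi> p))" "D w = v" by (simp_all add: w_def)
  have Dlin: "linear D" using D(1) has_derivative_linear by blast
  have zV: "\<phi> p \<in> V" and bk: "\<psi> (\<phi> p) = p" using hom pU by (auto simp: homeomorphism_def)
  have zimg: "\<phi> p \<in> \<phi> ` (S \<inter> U)" using p pU by auto
  \<comment> \<open>At a boundary point the line is followed in the direction in which it stays in the half-space.\<close>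
  obtain \<sigma> :: real where \<sigma>: "\<sigma> = 1 \<or> \<sigma> = -1"
    and stay: "\<And>t. 0 \<le> t \<Longrightarrow> \<phi> p + (t * \<sigma>) *\<^sub>R w \<in> V \<Longrightarrow> \<phi> p + (t * \<sigma>) *\<^sub>R w \<in> \<phi> ` (S \<inter> U)"
  proof (cases "\<phi> ` (S \<inter> U) = {z \<in> V. z \<bullet> b = 0}")
    case True
    then show ?thesis using zimg wb by (intro that[of 1]) (auto simp: w_def inner_add_left)
  next
    case False
    then obtain c where c: "\<phi> ` (S \<inter> U) = {z \<in> V. z \<bullet> b = 0 \<and> z \<bullet> c \<ge> 0}" using img by blast
    define \<sigma> where "\<sigma> = (if 0 \<le> w \<bullet> c then 1 else -1::real)"
    have "0 \<le> \<sigma> * (w \<bullet> c)" by (simp add: \<sigma>_def)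
    then have "0 \<le> \<phi> p \<bullet> c + t * (\<sigma> * (w \<bullet> c))" if "0 \<le> t" for t
      using zimg that unfolding c by simp
    then show ?thesis using zimg wb unfolding c
      by (intro that[of \<sigma>], unfold c) (auto simp: w_def[symmetric] \<sigma>_def inner_add_left mult.assoc)
  qed
  have "\<bar>v \<bullet> \<nu>\<bar> \<le> \<epsilon> * norm v + e" if e: "0 < e" for e
  proof -
    define e' where "e' = e / (1 + \<epsilon>) / (norm w + 1)"
    have "0 < norm w + 1" by (simp add: add_nonneg_pos)
    then have e': "0 < e'" using e \<epsilon> unfolding e'_def by (intro divide_pos_pos) auto
    obtain d1 where d1: "0 < d1" "\<And>y. norm (y - \<phi> p) < d1 \<Longrightarrow> norm (\<psi> y - \<psi> (\<phi> p) - D (y - \<phi> p)) \<le> e' * norm (y - \<phi> p)"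
      using D(1) e' unfolding has_derivative_at_alt by blast
    obtain d2 where d2: "0 < d2" "ball (\<phi> p) d2 \<subseteq> V" by (rule openE[OF V zV])
    have "isCont \<psi> (\<phi> p)" using D(1) has_derivative_continuous by blast
    then obtain d3 where d3: "0 < d3" "\<And>y. dist y (\<phi> p) < d3 \<Longrightarrow> dist (\<psi> y) (\<psi> (\<phi> p)) < \<delta>"
      using \<delta> unfolding continuous_at_eps_delta by blast
    define t where "t = min d1 (min d2 d3) / (norm w + 1) / 2"
    have t: "0 < t" using d1(1) d2(1) d3(1) by (simp add: t_def add_nonneg_pos)
    define y where "y = \<phi> p + (t * \<sigma>) *\<^sub>R w"
    have sg: "\<bar>\<sigma>\<bar> = 1" using \<sigma> by auto
    have ny: "norm (y - \<phi> p) = t * norm w" using t sg by (simp add: y_def abs_mult)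
    have half_lt: "m / 2 < m" if "0 < m" for m :: real using that by simp
    have "t * norm w \<le> t * (norm w + 1)" using t by simp
    also have "\<dots> = min d1 (min d2 d3) / 2"
    proof -
      have "m / c / 2 * c = m / 2" if "0 < c" for m c :: real using that by simp
      then show ?thesis unfolding t_def using norm_ge_zero[of w] by (simp only: add_nonneg_pos zero_less_one)
    qed
    also have "\<dots> < min d1 (min d2 d3)" using d1(1) d2(1) d3(1) by (intro half_lt) auto
    finally have lt: "norm (y - \<phi> p) < d1" "norm (y - \<phi> p) < d2" "norm (y - \<phi> p) < d3" unfolding ny by auto
    have "y \<in> V" using lt(2) d2(2) by (auto simp: dist_norm norm_minus_commute)
    then have "y \<in> \<phi> ` (S \<inter> U)" using stay[of t] t by (simp add: y_def)
    then obtain x where x: "x \<in> S" "x \<in> U" "y = \<phi> x" by auto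
    have xy: "\<psi> y = x" using x hom by (simp add: homeomorphism_def)
    have xb: "x \<in> S \<inter> ball p \<delta>" using d3(2)[of y] lt(3) x xy bk by (simp add: dist_norm norm_minus_commute)
    have Dy: "D (y - \<phi> p) = (t * \<sigma>) *\<^sub>R v" using D(2) by (simp add: y_def linear_cmul[OF Dlin])
    have err: "norm (x - p - (t * \<sigma>) *\<^sub>R v) \<le> e' * (t * norm w)"
      using d1(2)[OF lt(1)] unfolding ny Dy xy bk .
    have "\<bar>(x - p) \<bullet> \<nu>\<bar> \<le> \<epsilon> * norm (x - p)"
      using fl xb p \<delta> by (auto simp: flat_def)
    also have "norm (x - p) \<le> t * norm v + e' * (t * norm w)"
      using err norm_triangle_sub[of "x - p" "(t * \<sigma>) *\<^sub>R v"] t sg by (simp add: abs_mult)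
    finally have A: "\<bar>(x - p) \<bullet> \<nu>\<bar> \<le> \<epsilon> * (t * norm v + e' * (t * norm w))" using \<epsilon> by simp
    have "(t * \<sigma>) *\<^sub>R v \<bullet> \<nu> = (x - p) \<bullet> \<nu> - (x - p - (t * \<sigma>) *\<^sub>R v) \<bullet> \<nu>"
      by (simp add: inner_diff_left)
    then have "\<bar>(t * \<sigma>) *\<^sub>R v \<bullet> \<nu>\<bar> \<le> \<bar>(x - p) \<bullet> \<nu>\<bar> + \<bar>(x - p - (t * \<sigma>) *\<^sub>R v) \<bullet> \<nu>\<bar>" by linarith
    moreover have "\<bar>(x - p - (t * \<sigma>) *\<^sub>R v) \<bullet> \<nu>\<bar> \<le> e' * (t * norm w)"
      using Cauchy_Schwarz_ineq2[of "x - p - (t * \<sigma>) *\<^sub>R v" \<nu>] nu err by simp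
    moreover have "\<bar>(t * \<sigma>) *\<^sub>R v \<bullet> \<nu>\<bar> = t * \<bar>v \<bullet> \<nu>\<bar>" using t sg by (simp add: abs_mult)
    ultimately have "t * \<bar>v \<bullet> \<nu>\<bar> \<le> t * (\<epsilon> * norm v + (1 + \<epsilon>) * (e' * norm w))"
      using A by (simp add: algebra_simps)
    then have "\<bar>v \<bullet> \<nu>\<bar> \<le> \<epsilon> * norm v + (1 + \<epsilon>) * (e' * norm w)" using t by simp
    also have "(1 + \<epsilon>) * (e' * norm w) \<le> (1 + \<epsilon>) * (e' * (norm w + 1))"
      using \<epsilon> e' by (intro mult_left_mono) auto
    also have "\<dots> = e"
    proof -
      have "norm w + 1 \<noteq> 0" "1 + \<epsilon> \<noteq> 0" using \<epsilon> norm_ge_zero[of w] by linarith+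
      then show ?thesis by (simp add: e'_def)
    qed
    finally show ?thesis by simp
  qed
  then show ?thesis by (rule field_le_epsilon)
qed

text \<open>
  Finitely many balls around points of \<open>S\<close>, on whose doubles \<open>S\<close> is flat, cover \<open>S\<close>, and each piece
  is what one of them adds to its predecessors. Doubling the radii leaves room for a
  neighbourhood of uniform size around every point of a piece.
\<close>

lemma C1_hypersurface_flat_partition:
  fixes S :: "'a::euclidean_space set"
  assumes S: "compact S" "C1_hypersurface S" and \<epsilon>: "0 < \<epsilon>"
  obtains \<delta> and N :: nat and E :: "nat \<Rightarrow> 'a set" and \<nu> where
    "0 < \<delta>" "S = (\<Union>j<N. E j)" "disjoint_family_on E {..<N}"
    "\<And>j. j < N \<Longrightarrow> norm (\<nu> j) = 1" "\<And>j. j < N \<Longrightarrow> sigma_compact (E j)" "\<And>j. j < N \<Longrightarrow> flat (\<nu> j) \<epsilon> (E j)"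
    "\<And>j p q. j < N \<Longrightarrow> p \<in> E j \<Longrightarrow> q \<in> S \<Longrightarrow> norm (q - p) < \<delta> \<Longrightarrow> \<bar>(q - p) \<bullet> \<nu> j\<bar> \<le> \<epsilon> * norm (q - p)"
    "\<And>j p v. j < N \<Longrightarrow> p \<in> E j \<Longrightarrow> v \<in> tangent_space S p \<Longrightarrow> \<bar>v \<bullet> \<nu> j\<bar> \<le> \<epsilon> * norm v"
proof -
  have "\<forall>p\<in>S. \<exists>n d. norm n = 1 \<and> 0 < d \<and> flat n \<epsilon> (S \<inter> ball p d)"
    using S(2) hypersurface_chart_flat[OF _ _ \<epsilon>] unfolding C1_hypersurface_def by metis
  then obtain n d where nd: "\<And>p. p \<in> S \<Longrightarrow> norm (n p) = 1" "\<And>p. p \<in> S \<Longrightarrow> 0 < d p"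
    "\<And>p. p \<in> S \<Longrightarrow> flat (n p) \<epsilon> (S \<inter> ball p (d p))" by metis
  have "S \<subseteq> (\<Union>p\<in>S. ball p (d p / 2))" using nd(2) by force
  then obtain C where C: "C \<subseteq> S" "finite C" "S \<subseteq> (\<Union>p\<in>C. ball p (d p / 2))"
    by (rule compactE_image[OF S(1), rotated]) auto
  obtain f where f: "bij_betw f {0..<card C} C" using ex_bij_betw_nat_finite[OF C(2)] by blast
  define N where "N = card C"
  have fC: "f ` {..<N} = C" using f by (simp add: bij_betw_def N_def atLeast0LessThan)
  then have fS: "f j \<in> S" if "j < N" for j using that C(1) by auto
  let ?B = "\<lambda>j. ball (f j) (d (f j) / 2)"
  define E where "E j = (S - (\<Union>i<j. ?B i)) \<inter> ?B j" for j
  define \<delta> where "\<delta> = Min (insert 1 ((\<lambda>j. d (f j) / 2) ` {..<N}))"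
  have \<delta>le: "\<delta> \<le> d (f j) / 2" if "j < N" for j unfolding \<delta>_def using that by (intro Min_le) auto
  have near: "q \<in> S \<inter> ball (f j) (d (f j))" if "j < N" "p \<in> E j" "q \<in> S" "norm (q - p) < d (f j) / 2" for j p q
    using that dist_triangle[of "f j" q p] by (auto simp: E_def dist_norm norm_minus_commute)
  have self: "p \<in> S \<inter> ball (f j) (d (f j))" if "j < N" "p \<in> E j" for j p
    using near[OF that, of p] that nd(2)[OF fS[OF that(1)]] by (auto simp: E_def)
  show ?thesis
  proof (rule that[of \<delta> E N "\<lambda>j. n (f j)"])
    show "0 < \<delta>" unfolding \<delta>_def using nd(2) fS by (subst Min_gr_iff) auto
    show "S = (\<Union>j<N. E j)"
    proof (intro equalityI subsetI)
      fix x assume x: "x \<in> S"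
      then obtain j0 where j0: "j0 < N" "x \<in> ?B j0" using C(3) fC by auto
      define j where "j = (LEAST j. x \<in> ?B j)"
      have j: "x \<in> ?B j" unfolding j_def by (rule LeastI[of "\<lambda>j. x \<in> ?B j", OF j0(2)])
      have "j \<le> j0" unfolding j_def by (rule Least_le[of "\<lambda>j. x \<in> ?B j", OF j0(2)])
      moreover have "x \<notin> ?B i" if "i < j" for i using that not_less_Least[of i "\<lambda>j. x \<in> ?B j"] unfolding j_def by blast
      ultimately show "x \<in> (\<Union>j<N. E j)" using x j j0(1) by (intro UN_I[of j]) (auto simp: E_def)
    qed (auto simp: E_def)
    show "disjoint_family_on E {..<N}"
    proof -
      have "E i \<inter> E j = {}" if "i < j" for i j using that by (auto simp: E_def)
      then show ?thesis unfolding disjoint_family_on_def by (metis inf_commute linorder_neqE_nat)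
    qed
    show "norm (n (f j)) = 1" if "j < N" for j using nd(1) fS that by auto
    show "sigma_compact (E j)" for j unfolding E_def
      by (intro sigma_compact_compact_Int_open compact_diff S(1)) auto
    show "flat (n (f j)) \<epsilon> (E j)" if "j < N" for j
      using nd(3)[OF fS[OF that]] self[OF that] unfolding flat_def by blast
    show "\<bar>(q - p) \<bullet> n (f j)\<bar> \<le> \<epsilon> * norm (q - p)"
      if "j < N" "p \<in> E j" "q \<in> S" "norm (q - p) < \<delta>" for j p q
      using nd(3)[OF fS[OF that(1)]] self[OF that(1,2)] near[OF that(1-3)] \<delta>le[OF that(1)] that(4)
      unfolding flat_def by simp
    show "\<bar>v \<bullet> n (f j)\<bar> \<le> \<epsilon> * norm v" if "j < N" "p \<in> E j" "v \<in> tangent_space S p" for j p v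
    proof (rule tangent_space_flat[OF that(3)])
      show "p \<in> S" using self[OF that(1,2)] by simp
      show "norm (n (f j)) = 1" "0 < d (f j) / 2" using nd fS that by auto
      have "S \<inter> ball p (d (f j) / 2) \<subseteq> S \<inter> ball (f j) (d (f j))"
        using near[OF that(1,2)] by (auto simp: dist_norm norm_minus_commute)
      then show "flat (n (f j)) \<epsilon> (S \<inter> ball p (d (f j) / 2))"
        using nd(3)[OF fS[OF that(1)]] unfolding flat_def by blast
    qed (rule \<epsilon>)
  qed
qed

section \<open>The double integral in the displacement variable\<close>

lemma nn_integral_lborel_translation:
  fixes f :: "'a::euclidean_space \<Rightarrow> ennreal"
  assumes [measurable]: "f \<in> borel_measurable borel"
  shows "(\<integral>\<^sup>+x. f (c + x) \<partial>lborel) = (\<integral>\<^sup>+x. f x \<partial>lborel)"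
  by (subst (2) lborel_distr_plus[of c, symmetric], subst nn_integral_distr) simp_all

text \<open>
  For fixed \<open>x\<close> the substitution \<open>v = y - x\<close> is a translation, so the double integral becomes an integral
  over displacements of integrals over starting points.
\<close>

lemma nn_integral_displacement:
  fixes g :: "'a::euclidean_space \<times> 'a \<Rightarrow> ennreal"
  assumes g[measurable]: "g \<in> borel_measurable borel"
  shows "(\<integral>\<^sup>+z. g (fst z, snd z - fst z) \<partial>lebesgue) = (\<integral>\<^sup>+v. (\<integral>\<^sup>+x. g (x, v) \<partial>lborel) \<partial>lborel)"
proof -
  have [measurable]: "g \<in> borel_measurable (borel \<Otimes>\<^sub>M borel)" using g by (simp only: borel_prod)
  have "(\<integral>\<^sup>+z. g (fst z, snd z - fst z) \<partial>lebesgue) = (\<integral>\<^sup>+z. g (fst z, snd z - fst z) \<partial>(lborel \<Otimes>\<^sub>M lborel))"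
    by (simp add: nn_integral_completion lborel_prod)
  also have "\<dots> = (\<integral>\<^sup>+x. (\<integral>\<^sup>+y. g (x, y - x) \<partial>lborel) \<partial>lborel)"
    by (subst lborel.nn_integral_fst[symmetric]) auto
  also have "\<dots> = (\<integral>\<^sup>+x. (\<integral>\<^sup>+v. g (x, v) \<partial>lborel) \<partial>lborel)"
  proof (rule nn_integral_cong)
    fix x :: 'a
    have "(\<integral>\<^sup>+y. g (x, - x + y) \<partial>lborel) = (\<integral>\<^sup>+v. g (x, v) \<partial>lborel)"
      by (rule nn_integral_lborel_translation[of "\<lambda>v. g (x, v)" "- x"]) measurable
    then show "(\<integral>\<^sup>+y. g (x, y - x) \<partial>lborel) = (\<integral>\<^sup>+v. g (x, v) \<partial>lborel)" by simp
  qed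
  also have "\<dots> = (\<integral>\<^sup>+v. (\<integral>\<^sup>+x. g (x, v) \<partial>lborel) \<partial>lborel)"
    by (rule lborel_pair.Fubini') measurable
  finally show ?thesis .
qed

lemma mem_sweep_iff: "x \<in> sweep E v \<longleftrightarrow> (\<exists>t\<in>{0..1}. x + t *\<^sub>R v \<in> E)"
  unfolding sweep_def by (force simp: image_iff algebra_simps)

text \<open>
  The relation is the projection of a closed set along the compact interval of parameters \<open>t\<close>.
\<close>

lemma closed_sweep_relation:
  fixes E :: "'a::euclidean_space set"
  assumes "compact E"
  shows "closed {z :: 'a \<times> 'a. fst z \<in> sweep E (snd z)}"
proof -
  let ?T = "{w :: real \<times> ('a \<times> 'a). fst (snd w) + fst w *\<^sub>R snd (snd w) \<in> E}"
  have "closed ?T"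
    using continuous_closed_vimage[OF compact_imp_closed[OF assms], of "\<lambda>w :: real \<times> ('a \<times> 'a). fst (snd w) + fst w *\<^sub>R snd (snd w)"]
    by (auto simp: vimage_def intro!: continuous_intros)
  then have "closed {y. \<exists>t. t \<in> {0..1} \<and> (t, y) \<in> ?T}"
    by (intro closed_compact_projection) auto
  then show ?thesis by (simp add: mem_sweep_iff Bex_def)
qed

lemma sweep_relation_borel:
  fixes E :: "'a::euclidean_space set"
  assumes "sigma_compact E"
  shows "{z :: 'a \<times> 'a. fst z \<in> sweep E (snd z)} \<in> sets borel"
proof -
  obtain K where K: "\<forall>i::nat. compact (K i)" "E = (\<Union>i. K i)"
    using assms(1) by (auto simp: sigma_compact_def)
  have "{z :: 'a \<times> 'a. fst z \<in> sweep E (snd z)} = (\<Union>i. {z. fst z \<in> sweep (K i) (snd z)})"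
    by (auto simp: K(2) sweep_UN)
  also have "\<dots> \<in> sets borel"
    using closed_sweep_relation K(1) by (intro sets.countable_UN) (auto intro: borel_closed)
  finally show ?thesis .
qed

definition radial_kernel :: "real \<Rightarrow> 'a::euclidean_space \<Rightarrow> real" where
  "radial_kernel s v = 1 / unit_ball_vol (real (DIM('a) - 1)) * norm v powr (- (real DIM('a) + 2 * s))"

lemma frac_kernel_eq: "frac_kernel s x y = radial_kernel s (y - x)"
  unfolding frac_kernel_def radial_kernel_def powr_minus_divide by (simp add: norm_minus_commute)

lemma measurable_radial_kernel [measurable]: "radial_kernel s \<in> borel_measurable borel"
  unfolding radial_kernel_def by measurable

lemma unit_ball_vol_codim_pos: "0 < unit_ball_vol (real (DIM('a::euclidean_space) - 1))"
  by simp

lemma radial_kernel_nonneg: "0 \<le> radial_kernel s v"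
  unfolding radial_kernel_def by (intro mult_nonneg_nonneg) auto

text \<open>
  The weight \<open>1 - 2 s\<close> cancels the pole of the radial integral.
\<close>

lemma nn_integral_homogeneous_radial_kernel:
  fixes g :: "'a::euclidean_space \<Rightarrow> real"
  assumes [measurable]: "g \<in> borel_measurable borel" and hom: "\<And>t v. 0 < t \<Longrightarrow> g (t *\<^sub>R v) = t * g v"
    and s: "0 < s" "s < 1/2" and \<delta>: "0 < \<delta>"
  shows "ennreal (1 - 2 * s) * (ennreal (1/2) * (\<integral>\<^sup>+v. ennreal (radial_kernel s v) * (ennreal (g v) * indicator (ball 0 \<delta>) v) \<partial>lborel))
     = ennreal (\<delta> powr (1 - 2 * s) * (real DIM('a) + 1) / (2 * unit_ball_vol (real (DIM('a) - 1)))) *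
       (\<integral>\<^sup>+v. ennreal (g v) * indicator (ball 0 1) v \<partial>lborel)"
proof -
  let ?a = "real DIM('a) + 2 * s" and ?V = "unit_ball_vol (real (DIM('a) - 1))"
  have V: "0 < ?V" by simp
  have "(\<integral>\<^sup>+v. ennreal (radial_kernel s v) * (ennreal (g v) * indicator (ball 0 \<delta>) v) \<partial>lborel)
     = (\<integral>\<^sup>+v. ennreal (1 / ?V) * (ennreal (g v) * ennreal (norm v powr (- ?a)) * indicator (ball 0 \<delta>) v) \<partial>lborel)"
  proof (intro nn_integral_cong)
    fix v :: 'a
    have "ennreal (radial_kernel s v) = ennreal (1 / ?V) * ennreal (norm v powr (- ?a))"
      unfolding radial_kernel_def using V by (intro ennreal_mult) auto
    then show "ennreal (radial_kernel s v) * (ennreal (g v) * indicator (ball 0 \<delta>) v)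
      = ennreal (1 / ?V) * (ennreal (g v) * ennreal (norm v powr (- ?a)) * indicator (ball 0 \<delta>) v)"
      by (simp only: ac_simps)
  qed
  also have "\<dots> = ennreal (1 / ?V) * (\<integral>\<^sup>+v. ennreal (g v) * ennreal (norm v powr (- ?a)) * indicator (ball 0 \<delta>) v \<partial>lborel)"
    by (rule nn_integral_cmult) measurable
  also have "(\<integral>\<^sup>+v. ennreal (g v) * ennreal (norm v powr (- ?a)) * indicator (ball 0 \<delta>) v \<partial>lborel) =
     ennreal (\<delta> powr (real DIM('a) + 1 - ?a) * (real DIM('a) + 1) / (real DIM('a) + 1 - ?a)) *
     (\<integral>\<^sup>+v. ennreal (g v) * indicator (ball 0 1) v \<partial>lborel)"
    using s by (intro nn_integral_radial_kernel hom \<delta>) auto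
  also have "real DIM('a) + 1 - ?a = 1 - 2 * s" by simp
  finally have "ennreal (1 - 2 * s) * (ennreal (1/2) * (\<integral>\<^sup>+v. ennreal (radial_kernel s v) * (ennreal (g v) * indicator (ball 0 \<delta>) v) \<partial>lborel))
    = (ennreal (1 - 2 * s) * ennreal (1/2) * ennreal (1 / ?V) * ennreal (\<delta> powr (1 - 2 * s) * (real DIM('a) + 1) / (1 - 2 * s))) *
       (\<integral>\<^sup>+v. ennreal (g v) * indicator (ball 0 1) v \<partial>lborel)"
    by (simp only: mult.assoc)
  also have "ennreal (1 - 2 * s) * ennreal (1/2) * ennreal (1 / ?V) * ennreal (\<delta> powr (1 - 2 * s) * (real DIM('a) + 1) / (1 - 2 * s))
     = ennreal ((1 - 2 * s) * (1/2) * (1 / ?V) * (\<delta> powr (1 - 2 * s) * (real DIM('a) + 1) / (1 - 2 * s)))"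
    using s V by (simp only: ennreal_mult'[symmetric] mult_nonneg_nonneg divide_nonneg_nonneg)
  also have "(1 - 2 * s) * (1/2) * (1 / ?V) * (\<delta> powr (1 - 2 * s) * (real DIM('a) + 1) / (1 - 2 * s))
     = \<delta> powr (1 - 2 * s) * (real DIM('a) + 1) / (2 * ?V)"
  proof -
    have "(1 - 2 * s) * (1/2) * (1 / ?V) * (c / (1 - 2 * s)) = c / (2 * ?V)" for c
      using s by simp
    then show ?thesis .
  qed
  finally show ?thesis .
qed

section \<open>Upper and lower bounds from a flat partition\<close>

text \<open>
  A partition of \<open>S\<close> into flat pieces. The parameter \<open>\<beta>\<close> separates transversal displacements, with
  \<open>\<beta> * norm v \<le> |v \<bullet> \<nu> j|\<close>, from nearly tangential ones. Flatness \<open>\<beta>\<^sup>2 / 4\<close> is chosen such that the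
  relative error of the sweep is at most \<open>\<beta>\<close> for all transversal displacements.
\<close>

locale flat_partition =
  fixes S :: "'a::euclidean_space set" and N :: nat and E :: "nat \<Rightarrow> 'a set" and \<nu> :: "nat \<Rightarrow> 'a"
    and \<beta> \<delta> :: real
  assumes dim: "2 \<le> DIM('a)" and \<beta>: "0 < \<beta>" "\<beta> < 1" and \<delta>: "0 < \<delta>" and S: "compact S"
    and S_eq: "S = (\<Union>j<N. E j)" and disj: "disjoint_family_on E {..<N}"
    and nu: "\<And>j. j < N \<Longrightarrow> norm (\<nu> j) = 1" and sc: "\<And>j. j < N \<Longrightarrow> sigma_compact (E j)"
    and fl: "\<And>j. j < N \<Longrightarrow> flat (\<nu> j) (\<beta>\<^sup>2 / 4) (E j)"
    and near: "\<And>j p q. j < N \<Longrightarrow> p \<in> E j \<Longrightarrow> q \<in> S \<Longrightarrow> norm (q - p) < \<delta> \<Longrightarrow> \<bar>(q - p) \<bullet> \<nu> j\<bar> \<le> \<beta>\<^sup>2 / 4 * norm (q - p)"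
    and tang: "\<And>j p v. j < N \<Longrightarrow> p \<in> E j \<Longrightarrow> v \<in> tangent_space S p \<Longrightarrow> \<bar>v \<bullet> \<nu> j\<bar> \<le> \<beta>\<^sup>2 / 4 * norm v"
begin

definition total_shadow :: ennreal where
  "total_shadow = (\<Sum>j<N. projected_area (\<nu> j) (E j))"

lemma flatness: "0 \<le> \<beta>\<^sup>2 / 4" "\<beta>\<^sup>2 / 4 \<le> 1/2" "\<beta>\<^sup>2 / 4 < \<beta>" "4 * (\<beta>\<^sup>2 / 4) \<le> \<beta> * \<beta>" "2 * (\<beta>\<^sup>2 / 4) \<le> \<beta>"
proof -
  have "\<beta>\<^sup>2 \<le> \<beta>" using \<beta> by (simp add: power2_eq_square mult_le_cancel_left1)
  then show "\<beta>\<^sup>2 / 4 \<le> 1/2" "\<beta>\<^sup>2 / 4 < \<beta>" "2 * (\<beta>\<^sup>2 / 4) \<le> \<beta>"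
    using \<beta> by linarith+
qed (auto simp: power2_eq_square)

lemma total_shadow_finite: "total_shadow < top"
  unfolding total_shadow_def
proof (subst ennreal_sum_less_top, simp, intro ballI)
  show "projected_area (\<nu> j) (E j) < top" if "j \<in> {..<N}" for j
    using that S_eq S by (intro projected_area_finite bounded_subset[OF compact_imp_bounded[OF S]]) auto
qed

lemma total_shadow_le_hausdorff: "total_shadow \<le> hausdorff_measure (DIM('a) - 1) S"
  unfolding total_shadow_def by (subst S_eq, rule sum_projected_area_le_hausdorff) (use nu sc disj in auto)

lemma hausdorff_le_total_shadow: "hausdorff_measure (DIM('a) - 1) S \<le> ennreal ((1 + \<beta>) ^ DIM('a)) * total_shadow"
proof -
  have "hausdorff_measure (DIM('a) - 1) S \<le> (\<Sum>j<N. hausdorff_measure (DIM('a) - 1) (E j))"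
    by (subst S_eq, rule hausdorff_measure_UN_le) simp
  also have "\<dots> \<le> (\<Sum>j<N. ennreal ((1 + \<beta>) ^ DIM('a)) * projected_area (\<nu> j) (E j))"
  proof (rule sum_mono)
    fix j assume "j \<in> {..<N}"
    then have j: "j < N" by simp
    have "hausdorff_measure (DIM('a) - 1) (E j) \<le> ennreal ((1 + 2 * (\<beta>\<^sup>2 / 4)) ^ (DIM('a) - 1)) * projected_area (\<nu> j) (E j)"
      by (rule hausdorff_measure_flat_le[OF nu[OF j] fl[OF j] flatness(1,2) sc[OF j] dim])
    also have "(1 + 2 * (\<beta>\<^sup>2 / 4)) ^ (DIM('a) - 1) \<le> (1 + \<beta>) ^ DIM('a)"
    proof -
      have "(1 + 2 * (\<beta>\<^sup>2 / 4)) ^ (DIM('a) - 1) \<le> (1 + \<beta>) ^ (DIM('a) - 1)"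
        using flatness \<beta> by (intro power_mono) auto
      also have "\<dots> \<le> (1 + \<beta>) ^ DIM('a)" using \<beta> by (intro power_increasing) auto
      finally show ?thesis .
    qed
    finally show "hausdorff_measure (DIM('a) - 1) (E j) \<le> ennreal ((1 + \<beta>) ^ DIM('a)) * projected_area (\<nu> j) (E j)"
      by (simp add: ennreal_leI mult_right_mono)
  qed
  also have "\<dots> = ennreal ((1 + \<beta>) ^ DIM('a)) * total_shadow"
    by (simp add: total_shadow_def sum_distrib_left)
  finally show ?thesis .
qed

lemma null_S: "emeasure lborel S = 0"
proof -
  have "emeasure lborel S \<le> (\<Sum>j<N. emeasure lborel (E j))"
    by (subst S_eq, rule emeasure_subadditive_finite) (auto intro: sigma_compact_borel sc)
  also have "\<dots> = 0" using flat_null[OF nu fl flatness(1,2) sc] by simp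
  finally show ?thesis by simp
qed

text \<open>
  An upper bound for the volume of the sweep of a piece in units of its projected area: nearly
  \<open>|v \<bullet> \<nu> j|\<close> for transversal displacements and the crude bound \<open>3 ^ n * norm v\<close> for the others.
\<close>

definition sweep_profile :: "nat \<Rightarrow> 'a \<Rightarrow> real" where
  "sweep_profile j v = (1 + \<beta>) ^ DIM('a) * \<bar>v \<bullet> \<nu> j\<bar> + 3 ^ DIM('a) * (norm v * indicator {v. \<bar>v \<bullet> \<nu> j\<bar> \<le> \<beta> * norm v} v)"

lemma sweep_le_sweep_profile:
  assumes j: "j < N" and v: "v \<noteq> 0"
  shows "emeasure lborel (sweep (E j) v) \<le> ennreal (sweep_profile j v) * projected_area (\<nu> j) (E j)"
proof (cases "\<beta> * norm v \<le> \<bar>v \<bullet> \<nu> j\<bar>")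
  case True
  have "emeasure lborel (sweep (E j) v) \<le> ennreal ((1 + \<beta>) ^ DIM('a)) * (ennreal \<bar>v \<bullet> \<nu> j\<bar> * projected_area (\<nu> j) (E j))"
    using \<beta> by (intro sweep_flat_bounds(1)[OF nu[OF j] fl[OF j] flatness(1,2) sc[OF j] _ _ flatness(4) _ v True]) auto
  also have "\<dots> = ennreal ((1 + \<beta>) ^ DIM('a) * \<bar>v \<bullet> \<nu> j\<bar>) * projected_area (\<nu> j) (E j)"
    using \<beta> by (simp add: ennreal_mult mult.assoc)
  also have "\<dots> \<le> ennreal (sweep_profile j v) * projected_area (\<nu> j) (E j)"
    unfolding sweep_profile_def by (intro mult_right_mono ennreal_leI) auto
  finally show ?thesis .
next
  case False
  have "emeasure lborel (sweep (E j) v) \<le> ennreal (3 ^ DIM('a)) * (ennreal (norm v) * projected_area (\<nu> j) (E j))"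
    by (rule sweep_flat_crude[OF nu[OF j] fl[OF j] flatness(1,2) sc[OF j] v])
  also have "\<dots> = ennreal (3 ^ DIM('a) * norm v) * projected_area (\<nu> j) (E j)"
    by (simp add: ennreal_mult mult.assoc)
  also have "\<dots> \<le> ennreal (sweep_profile j v) * projected_area (\<nu> j) (E j)"
    unfolding sweep_profile_def using False \<beta> by (intro mult_right_mono ennreal_leI) auto
  finally show ?thesis .
qed

lemma measurable_sweep_profile [measurable]: "sweep_profile j \<in> borel_measurable borel"
  unfolding sweep_profile_def by measurable

lemma sweep_profile_homogeneous: "0 < t \<Longrightarrow> sweep_profile j (t *\<^sub>R v) = t * sweep_profile j v"
  by (simp add: sweep_profile_def indicator_def abs_mult algebra_simps)

text \<open>
  The nearly tangential part of the unit ball lies in a strip of width \<open>2 * \<beta>\<close>, so the crude bound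
  costs only a multiple of \<open>\<beta>\<close>.
\<close>

lemma nn_integral_ball_sweep_profile_le:
  assumes j: "j < N"
  shows "(\<integral>\<^sup>+v. ennreal (sweep_profile j v) * indicator (ball 0 1) v \<partial>lborel) \<le>
    ennreal (2 * unit_ball_vol (real (DIM('a) - 1)) / (real DIM('a) + 1) * ((1 + \<beta>) ^ DIM('a) + 3 ^ DIM('a) * (real DIM('a) + 1) * \<beta>))"
proof -
  let ?V = "unit_ball_vol (real (DIM('a) - 1))"
  have V: "0 < ?V" by simp
  have "(\<integral>\<^sup>+v. ennreal (sweep_profile j v) * indicator (ball 0 1) v \<partial>lborel)
     \<le> (\<integral>\<^sup>+v. ennreal ((1 + \<beta>) ^ DIM('a)) * (ennreal \<bar>v \<bullet> \<nu> j\<bar> * indicator (ball 0 1) v)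
         + ennreal (3 ^ DIM('a)) * indicator {v \<in> ball 0 1. \<bar>v \<bullet> \<nu> j\<bar> \<le> \<beta>} v \<partial>lborel)"
  proof (intro nn_integral_mono)
    fix v :: 'a
    show "ennreal (sweep_profile j v) * indicator (ball 0 1) v \<le> ennreal ((1 + \<beta>) ^ DIM('a)) * (ennreal \<bar>v \<bullet> \<nu> j\<bar> * indicator (ball 0 1) v)
         + ennreal (3 ^ DIM('a)) * indicator {v \<in> ball 0 1. \<bar>v \<bullet> \<nu> j\<bar> \<le> \<beta>} v"
    proof (cases "v \<in> ball 0 1")
      case True
      then have n1: "norm v \<le> 1" by simp
      have "sweep_profile j v \<le> (1 + \<beta>) ^ DIM('a) * \<bar>v \<bullet> \<nu> j\<bar> + 3 ^ DIM('a) * indicator {v \<in> ball 0 1. \<bar>v \<bullet> \<nu> j\<bar> \<le> \<beta>} v"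
        unfolding sweep_profile_def
      proof (intro add_left_mono mult_left_mono)
        have "\<beta> * norm v \<le> \<beta>" using n1 \<beta> by (simp add: mult_le_cancel_left1)
        then show "norm v * indicator {v. \<bar>v \<bullet> \<nu> j\<bar> \<le> \<beta> * norm v} v \<le> indicator {v \<in> ball 0 1. \<bar>v \<bullet> \<nu> j\<bar> \<le> \<beta>} v"
          using True n1 by (auto simp: indicator_def)
      qed simp
      then have "ennreal (sweep_profile j v) \<le> ennreal ((1 + \<beta>) ^ DIM('a) * \<bar>v \<bullet> \<nu> j\<bar> + 3 ^ DIM('a) * indicator {v \<in> ball 0 1. \<bar>v \<bullet> \<nu> j\<bar> \<le> \<beta>} v)"
        by (rule ennreal_leI)
      also have "\<dots> = ennreal ((1 + \<beta>) ^ DIM('a)) * ennreal \<bar>v \<bullet> \<nu> j\<bar> + ennreal (3 ^ DIM('a)) * indicator {v \<in> ball 0 1. \<bar>v \<bullet> \<nu> j\<bar> \<le> \<beta>} v"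
        using \<beta> by (subst ennreal_plus) (auto simp: ennreal_mult indicator_def)
      finally show ?thesis using True by simp
    qed simp
  qed
  also have "\<dots> = ennreal ((1 + \<beta>) ^ DIM('a)) * (\<integral>\<^sup>+v. ennreal \<bar>v \<bullet> \<nu> j\<bar> * indicator (ball 0 1) v \<partial>lborel)
         + ennreal (3 ^ DIM('a)) * emeasure lborel {v \<in> ball 0 1. \<bar>v \<bullet> \<nu> j\<bar> \<le> \<beta>}"
    by (subst nn_integral_add) (simp_all add: nn_integral_cmult nn_integral_cmult_indicator)
  also have "\<dots> \<le> ennreal ((1 + \<beta>) ^ DIM('a)) * ennreal (2 * ?V / (real DIM('a) + 1))
         + ennreal (3 ^ DIM('a)) * ennreal (2 * \<beta> * ?V)"
    using nn_integral_ball_abs_inner[OF nu[OF j] dim] emeasure_ball_strip_le[OF nu[OF j], of \<beta>] \<beta> dim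
    by (intro add_mono mult_left_mono) (auto simp: of_nat_diff add.commute)
  also have "\<dots> = ennreal ((1 + \<beta>) ^ DIM('a) * (2 * ?V / (real DIM('a) + 1)) + 3 ^ DIM('a) * (2 * \<beta> * ?V))"
  proof -
    have "0 \<le> 2 * ?V / (real DIM('a) + 1)" "0 \<le> 2 * \<beta> * ?V" using V \<beta> by auto
    then show ?thesis using \<beta> by (simp only: ennreal_mult'[symmetric] ennreal_plus[symmetric] mult_nonneg_nonneg
      zero_le_power zero_le_numeral add_nonneg_nonneg zero_le_one less_imp_le)
  qed
  also have "(1 + \<beta>) ^ DIM('a) * (2 * ?V / (real DIM('a) + 1)) + 3 ^ DIM('a) * (2 * \<beta> * ?V)
     = 2 * ?V / (real DIM('a) + 1) * ((1 + \<beta>) ^ DIM('a) + 3 ^ DIM('a) * (real DIM('a) + 1) * \<beta>)"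
    by (simp add: field_simps)
  finally show ?thesis .
qed

end

lemma borel_measurable_coordinates:
  fixes F :: "'a::euclidean_space \<Rightarrow> ennreal"
  assumes "F \<in> borel_measurable borel"
  shows "(\<lambda>z. F (fst z)) \<in> borel_measurable (borel :: ('a \<times> 'a) measure)"
    and "(\<lambda>z. F (snd z)) \<in> borel_measurable (borel :: ('a \<times> 'a) measure)"
    and "(\<lambda>z. F (snd z + fst z)) \<in> borel_measurable (borel :: ('a \<times> 'a) measure)"
  by (rule measurable_compose[OF _ assms], intro borel_measurable_continuous_onI continuous_intros)+

lemma frac_area_integrand:
  "frac_area s S \<Omega> = ennreal (1/2) * (\<integral>\<^sup>+z. ennreal (radial_kernel s (snd z - fst z)) *
     (ennreal (max (indicator \<Omega> (fst z)) (indicator \<Omega> (snd z))) * indicator (crossing_pairs S) z) \<partial>lebesgue)"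
proof -
  have eq: "(case z of (x, y) \<Rightarrow> ennreal (frac_kernel s x y * max (indicator \<Omega> x) (indicator \<Omega> y))) * indicator (crossing_pairs S) z =
    ennreal (radial_kernel s (snd z - fst z)) *
     (ennreal (max (indicator \<Omega> (fst z)) (indicator \<Omega> (snd z))) * indicator (crossing_pairs S) z)" for z
    by (cases z) (simp add: frac_kernel_eq ennreal_mult' radial_kernel_nonneg mult.assoc)
  show ?thesis unfolding frac_area_def by (simp only: eq)
qed

text \<open>
  A bound, uniform for \<open>s \<ge> 1 / 4\<close>, for the contribution of the displacements of length at least 1.
\<close>

definition far_field :: "'a::euclidean_space set \<Rightarrow> ennreal" where
  "far_field \<Omega> = emeasure lborel \<Omega> * (ennreal (1 / unit_ball_vol (real (DIM('a) - 1))) *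
     (\<integral>\<^sup>+v. ennreal (norm (v::'a) powr (- (real DIM('a) + 1/2))) * indicator (- ball 0 1) v \<partial>lborel))"

lemma far_field_finite: "bounded \<Omega> \<Longrightarrow> far_field \<Omega> < top"
  unfolding far_field_def
  using emeasure_bounded_finite[of \<Omega>] nn_integral_far_kernel_finite[where 'a='a, of "real DIM('a) + 1/2"]
  by (auto simp: ennreal_mult_less_top)

lemma nn_integral_far_kernel_le:
  assumes s: "1/4 \<le> s"
  shows "(\<integral>\<^sup>+v. ennreal (radial_kernel s (v::'a)) * (indicator (- ball 0 1) v * (2 * emeasure lborel \<Omega>)) \<partial>lborel)
    \<le> 2 * far_field (\<Omega> :: 'a::euclidean_space set)"
proof -
  let ?V = "unit_ball_vol (real (DIM('a) - 1))" and ?a = "real DIM('a) + 1/2"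
  have "(\<integral>\<^sup>+v. ennreal (radial_kernel s (v::'a)) * (indicator (- ball 0 1) v * (2 * emeasure lborel \<Omega>)) \<partial>lborel)
    \<le> (\<integral>\<^sup>+v. (2 * emeasure lborel \<Omega> * ennreal (1 / ?V)) * (ennreal (norm (v::'a) powr (- ?a)) * indicator (- ball 0 1) v) \<partial>lborel)"
  proof (intro nn_integral_mono)
    fix v :: 'a
    show "ennreal (radial_kernel s v) * (indicator (- ball 0 1) v * (2 * emeasure lborel \<Omega>))
      \<le> (2 * emeasure lborel \<Omega> * ennreal (1 / ?V)) * (ennreal (norm (v::'a) powr (- ?a)) * indicator (- ball 0 1) v)"
    proof (cases "norm v < 1")
      case False
      have "radial_kernel s v \<le> 1 / ?V * norm v powr (- ?a)"
        unfolding radial_kernel_def using False s by (intro mult_left_mono powr_mono) auto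
      then have "ennreal (radial_kernel s v) \<le> ennreal (1 / ?V * norm v powr (- ?a))" by (rule ennreal_leI)
      also have "\<dots> = ennreal (1 / ?V) * ennreal (norm v powr (- ?a))" by (rule ennreal_mult) auto
      finally have "ennreal (radial_kernel s v) * (2 * emeasure lborel \<Omega>)
        \<le> (ennreal (1 / ?V) * ennreal (norm v powr (- ?a))) * (2 * emeasure lborel \<Omega>)"
        by (rule mult_right_mono) simp
      then show ?thesis using False by (simp add: ac_simps)
    qed simp
  qed
  also have "\<dots> = (2 * emeasure lborel \<Omega> * ennreal (1 / ?V)) * (\<integral>\<^sup>+v. ennreal (norm (v::'a) powr (- ?a)) * indicator (- ball 0 1) v \<partial>lborel)"
    by (rule nn_integral_cmult) measurable
  also have "\<dots> = 2 * far_field \<Omega>" by (simp only: far_field_def mult.assoc)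
  finally show ?thesis .
qed

context flat_partition
begin

lemma crossing_imp_sweep:
  assumes "(x, y) \<in> crossing_pairs S"
  obtains j where "j < N" "x \<in> sweep (E j) (y - x)"
proof -
  have "odd (card (closed_segment x y \<inter> S - {x, y}))" using assms by (simp add: crossing_pairs_def)
  then have "closed_segment x y \<inter> S - {x, y} \<noteq> {}" by (metis card.empty even_zero)
  then obtain p where p: "p \<in> closed_segment x y" "p \<in> S" by blast
  then obtain t where t: "0 \<le> t" "t \<le> 1" "p = x + t *\<^sub>R (y - x)"
    by (auto simp: in_segment algebra_simps)
  obtain j where j: "j < N" "p \<in> E j" using p(2) S_eq by auto
  then have "x \<in> sweep (E j) (y - x)"
    unfolding mem_sweep_iff using t by (intro bexI[of _ t]) auto
  then show ?thesis using j(1) by (rule that[rotated])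
qed

text \<open>
  A crossing pair meets some piece, so its starting point lies in one of the sweeps.
  For short displacements the characteristic function of \<open>\<Omega>\<close> is bounded by 1. For long
  displacements the characteristic function of the crossing pairs is bounded by 1 instead, and
  the starting points fill at most twice the volume of \<open>\<Omega>\<close>.
\<close>

lemma weighted_area_le:
  assumes \<Omega>: "open \<Omega>" and s: "1/4 \<le> s" "s < 1/2"
  shows "ennreal (1 - 2 * s) * frac_area s S \<Omega> \<le>
    total_shadow * ennreal ((1 + \<beta>) ^ DIM('a) + 3 ^ DIM('a) * (real DIM('a) + 1) * \<beta>) + ennreal (1 - 2 * s) * far_field \<Omega>"
proof -
  let ?V = "unit_ball_vol (real (DIM('a) - 1))"
  let ?c = "(1 + \<beta>) ^ DIM('a) + 3 ^ DIM('a) * (real DIM('a) + 1) * \<beta>"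
  let ?R = "\<lambda>j. {z :: 'a \<times> 'a. fst z \<in> sweep (E j) (snd z)}"
  let ?K = "\<lambda>v::'a. ennreal (radial_kernel s v)"
  define g where "g z = ?K (snd z) * ((\<Sum>j<N. indicator (?R j) z * indicator (ball 0 1) (snd z))
      + indicator (- ball 0 1) (snd z) * (indicator \<Omega> (fst z) + indicator \<Omega> (snd z + fst z)))" for z
  have [measurable]: "\<Omega> \<in> sets borel" using \<Omega> by simp
  have R[measurable]: "(\<lambda>z. indicator (?R j) z :: ennreal) \<in> borel_measurable borel" if "j < N" for j
    using sweep_relation_borel[OF sc[OF that]] by simp
  have g[measurable]: "g \<in> borel_measurable borel"
    unfolding g_def
    by (intro borel_measurable_times_ennreal borel_measurable_add borel_measurable_sum R
        borel_measurable_coordinates borel_measurable_indicator) (measurable, auto)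
  have le: "?K (snd z - fst z) * (ennreal (max (indicator \<Omega> (fst z)) (indicator \<Omega> (snd z))) * indicator (crossing_pairs S) z)
     \<le> g (fst z, snd z - fst z)" for z
  proof (cases "z \<in> crossing_pairs S")
    case True
    obtain x y where z: "z = (x, y)" by (cases z)
    obtain j where j: "j < N" "x \<in> sweep (E j) (y - x)" using crossing_imp_sweep True z by blast
    have "ennreal (max (indicator \<Omega> x) (indicator \<Omega> y)) \<le>
      (\<Sum>j<N. indicator (?R j) (x, y - x) * indicator (ball 0 1) (y - x))
      + indicator (- ball 0 1) (y - x) * (indicator \<Omega> x + indicator \<Omega> y)"
    proof (cases "y - x \<in> ball 0 1")
      case True
      have "ennreal (max (indicator \<Omega> x) (indicator \<Omega> y)) \<le> 1" by (simp add: indicator_def)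
      also have "1 = indicator (?R j) (x, y - x) * (indicator (ball 0 1) (y - x) :: ennreal)" using j(2) True by simp
      also have "\<dots> \<le> (\<Sum>j<N. indicator (?R j) (x, y - x) * indicator (ball 0 1) (y - x))"
        using j(1) by (intro member_le_sum) auto
      finally show ?thesis by (rule order_trans) simp
    next
      case False
      then show ?thesis by (auto simp: indicator_def)
    qed
    then show ?thesis using True unfolding g_def z by (simp add: mult_left_mono)
  qed simp
  have "frac_area s S \<Omega> \<le> ennreal (1/2) * (\<integral>\<^sup>+z. g (fst z, snd z - fst z) \<partial>lebesgue)"
    unfolding frac_area_integrand by (intro mult_left_mono nn_integral_mono le) simp
  also have "(\<integral>\<^sup>+z. g (fst z, snd z - fst z) \<partial>lebesgue) = (\<integral>\<^sup>+v. (\<integral>\<^sup>+x. g (x, v) \<partial>lborel) \<partial>lborel)"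
    by (rule nn_integral_displacement[OF g])
  also have "\<dots> \<le> (\<integral>\<^sup>+v. (\<Sum>j<N. projected_area (\<nu> j) (E j) * (?K v * (ennreal (sweep_profile j v) * indicator (ball 0 1) v)))
      + ?K v * (indicator (- ball 0 1) v * (2 * emeasure lborel \<Omega>)) \<partial>lborel)"
  proof (rule nn_integral_mono_AE, use AE_lborel_singleton[of "0::'a"] in eventually_elim)
    case (elim v)
    have Rs: "sweep (E j) v \<in> sets borel" if "j < N" for j using that by (intro sigma_compact_borel sigma_compact_sweep sc)
    have "(\<integral>\<^sup>+x. indicator \<Omega> (v + x) \<partial>lborel) = (\<integral>\<^sup>+x. indicator \<Omega> x \<partial>(lborel :: 'a measure))"
      by (rule nn_integral_lborel_translation[of "indicator \<Omega>"]) measurable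
    then have tr: "(\<integral>\<^sup>+x. indicator \<Omega> (v + x) \<partial>lborel) = emeasure lborel \<Omega>" by simp
    have "(\<integral>\<^sup>+x. g (x, v) \<partial>lborel) = (\<integral>\<^sup>+x. ?K v * ((\<Sum>j<N. indicator (ball 0 1) v * indicator (sweep (E j) v) x)
      + indicator (- ball 0 1) v * (indicator \<Omega> x + indicator \<Omega> (v + x))) \<partial>lborel)"
      unfolding g_def by (intro nn_integral_cong) (simp add: indicator_def mult.commute)
    also have "\<dots> = ?K v * ((\<Sum>j<N. indicator (ball 0 1) v * emeasure lborel (sweep (E j) v))
      + indicator (- ball 0 1) v * (emeasure lborel \<Omega> + emeasure lborel \<Omega>))"
    proof -
      have near: "(\<integral>\<^sup>+x. (\<Sum>j<N. indicator (ball 0 1) v * indicator (sweep (E j) v) x) \<partial>lborel) =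
          (\<Sum>j<N. indicator (ball 0 1) v * emeasure lborel (sweep (E j) v))"
        using Rs by (subst nn_integral_sum) (auto simp: nn_integral_cmult_indicator intro!: sum.cong)
      have far: "(\<integral>\<^sup>+x. indicator (- ball 0 1) v * (indicator \<Omega> x + indicator \<Omega> (v + x)) \<partial>lborel) =
          indicator (- ball 0 1) v * (emeasure lborel \<Omega> + emeasure lborel \<Omega>)"
        by (simp add: nn_integral_cmult nn_integral_add tr)
      have m: "(\<lambda>x. \<Sum>j<N. indicator (ball 0 1) v * indicator (sweep (E j) v) x :: ennreal) \<in> borel_measurable lborel"
        using Rs by (intro borel_measurable_sum borel_measurable_times_ennreal) auto
      have m': "(\<lambda>x. indicator (- ball 0 1) v * (indicator \<Omega> x + indicator \<Omega> (v + x)) :: ennreal) \<in> borel_measurable lborel"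
        by measurable
      have "(\<integral>\<^sup>+x. ?K v * ((\<Sum>j<N. indicator (ball 0 1) v * indicator (sweep (E j) v) x)
          + indicator (- ball 0 1) v * (indicator \<Omega> x + indicator \<Omega> (v + x))) \<partial>lborel)
        = ?K v * (\<integral>\<^sup>+x. (\<Sum>j<N. indicator (ball 0 1) v * indicator (sweep (E j) v) x)
          + indicator (- ball 0 1) v * (indicator \<Omega> x + indicator \<Omega> (v + x)) \<partial>lborel)"
        by (rule nn_integral_cmult[OF borel_measurable_add[OF m m']])
      then show ?thesis
        by (simp only: nn_integral_add[OF m m'] near far)
    qed
    also have "\<dots> \<le> ?K v * ((\<Sum>j<N. indicator (ball 0 1) v * (ennreal (sweep_profile j v) * projected_area (\<nu> j) (E j)))
      + indicator (- ball 0 1) v * (2 * emeasure lborel \<Omega>))"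
      using elim by (intro mult_left_mono add_mono sum_mono sweep_le_sweep_profile) (auto simp: mult_2)
    also have "\<dots> = (\<Sum>j<N. projected_area (\<nu> j) (E j) * (?K v * (ennreal (sweep_profile j v) * indicator (ball 0 1) v)))
      + ?K v * (indicator (- ball 0 1) v * (2 * emeasure lborel \<Omega>))"
      by (simp only: distrib_left sum_distrib_left ac_simps)
    finally show ?case .
  qed
  also have "\<dots> = (\<Sum>j<N. projected_area (\<nu> j) (E j) * (\<integral>\<^sup>+v. ?K v * (ennreal (sweep_profile j v) * indicator (ball 0 1) v) \<partial>lborel))
      + (\<integral>\<^sup>+v. ?K v * (indicator (- ball 0 1) v * (2 * emeasure lborel \<Omega>)) \<partial>lborel)"
    by (simp add: nn_integral_add nn_integral_sum nn_integral_cmult)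
  also have "\<dots> \<le> (\<Sum>j<N. projected_area (\<nu> j) (E j) * (\<integral>\<^sup>+v. ?K v * (ennreal (sweep_profile j v) * indicator (ball 0 1) v) \<partial>lborel))
      + 2 * far_field \<Omega>"
    by (intro add_left_mono nn_integral_far_kernel_le s)
  finally have "frac_area s S \<Omega> \<le> ennreal (1/2) * ((\<Sum>j<N. projected_area (\<nu> j) (E j) * (\<integral>\<^sup>+v. ?K v * (ennreal (sweep_profile j v) * indicator (ball 0 1) v) \<partial>lborel))
      + 2 * far_field \<Omega>)"
    by (simp add: mult_left_mono)
  then have "ennreal (1 - 2 * s) * frac_area s S \<Omega> \<le> ennreal (1 - 2 * s) * (ennreal (1/2) * ((\<Sum>j<N. projected_area (\<nu> j) (E j) * (\<integral>\<^sup>+v. ?K v * (ennreal (sweep_profile j v) * indicator (ball 0 1) v) \<partial>lborel))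
      + 2 * far_field \<Omega>))"
    by (rule mult_left_mono) simp
  also have "\<dots> = (\<Sum>j<N. projected_area (\<nu> j) (E j) * (ennreal (1 - 2 * s) * (ennreal (1/2) * (\<integral>\<^sup>+v. ?K v * (ennreal (sweep_profile j v) * indicator (ball 0 1) v) \<partial>lborel))))
      + ennreal (1 - 2 * s) * ((ennreal (1/2) * 2) * far_field \<Omega>)"
    by (simp only: distrib_left sum_distrib_left ac_simps)
  also have "ennreal (1/2) * 2 = 1"
    using ennreal_mult[of "1/2" 2] by simp
  also have "(\<Sum>j<N. projected_area (\<nu> j) (E j) * (ennreal (1 - 2 * s) * (ennreal (1/2) * (\<integral>\<^sup>+v. ?K v * (ennreal (sweep_profile j v) * indicator (ball 0 1) v) \<partial>lborel))))
    \<le> (\<Sum>j<N. projected_area (\<nu> j) (E j) * ennreal ?c)"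
  proof (intro sum_mono mult_left_mono)
    fix j assume "j \<in> {..<N}"
    then have j: "j < N" by simp
    have "ennreal (1 - 2 * s) * (ennreal (1/2) * (\<integral>\<^sup>+v. ?K v * (ennreal (sweep_profile j v) * indicator (ball 0 1) v) \<partial>lborel))
      = ennreal (1 powr (1 - 2 * s) * (real DIM('a) + 1) / (2 * ?V)) * (\<integral>\<^sup>+v. ennreal (sweep_profile j v) * indicator (ball 0 1) v \<partial>lborel)"
      using s by (intro nn_integral_homogeneous_radial_kernel sweep_profile_homogeneous) auto
    also have "\<dots> \<le> ennreal (1 powr (1 - 2 * s) * (real DIM('a) + 1) / (2 * ?V)) * ennreal (2 * ?V / (real DIM('a) + 1) * ?c)"
      by (intro mult_left_mono nn_integral_ball_sweep_profile_le j) simp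
    also have "\<dots> = ennreal (1 powr (1 - 2 * s) * (real DIM('a) + 1) / (2 * ?V) * (2 * ?V / (real DIM('a) + 1) * ?c))"
      by (rule ennreal_mult'[symmetric]) simp
    also have "1 powr (1 - 2 * s) * (real DIM('a) + 1) / (2 * ?V) * (2 * ?V / (real DIM('a) + 1) * ?c) = ?c"
    proof -
      have "1 * d / (2 * V) * (2 * V / d * c) = c" if "0 < d" "0 < V" for d V c :: real using that by simp
      then show ?thesis by (simp only: powr_one_eq_one unit_ball_vol_codim_pos)
    qed
    finally show "ennreal (1 - 2 * s) * (ennreal (1/2) * (\<integral>\<^sup>+v. ?K v * (ennreal (sweep_profile j v) * indicator (ball 0 1) v) \<partial>lborel)) \<le> ennreal ?c" .
  qed simp
  also have "(\<Sum>j<N. projected_area (\<nu> j) (E j) * ennreal ?c) = total_shadow * ennreal ?c"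
    by (simp add: total_shadow_def sum_distrib_right)
  finally show ?thesis by (simp add: add_right_mono)
qed

text \<open>
  A second point of \<open>S\<close> on the segment would give a secant in the direction of \<open>v\<close>, which is too
  steep for the flatness of \<open>S\<close> near the first point. The same comparison excludes tangency.
\<close>

lemma transversal_sweep_crosses:
  assumes j: "j < N" and v: "v \<noteq> 0" "norm v < \<delta>" "\<beta> * norm v \<le> \<bar>v \<bullet> \<nu> j\<bar>"
    and x: "x \<in> sweep (E j) v" and out: "x \<notin> S" "x + v \<notin> S"
  shows "(x, x + v) \<in> crossing_pairs S"
    and "\<And>i. i < N \<Longrightarrow> x \<in> sweep (E i) v \<Longrightarrow> i = j"
proof -
  obtain t where t: "0 \<le> t" "t \<le> 1" "x + t *\<^sub>R v \<in> E j" using x by (auto simp: mem_sweep_iff)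
  define p where "p = x + t *\<^sub>R v"
  have p: "p \<in> E j" "p \<in> S" using t j S_eq by (auto simp: p_def)
  have uniq: "x + u *\<^sub>R v = p" if u: "0 \<le> u" "u \<le> 1" "x + u *\<^sub>R v \<in> S" for u
  proof -
    have d: "x + u *\<^sub>R v - p = (u - t) *\<^sub>R v" by (simp add: p_def algebra_simps)
    have "norm (x + u *\<^sub>R v - p) = \<bar>u - t\<bar> * norm v" by (simp add: d)
    also have "\<dots> \<le> 1 * norm v" using u t by (intro mult_right_mono) auto
    also have "\<dots> < \<delta>" using v by simp
    finally have "\<bar>(x + u *\<^sub>R v - p) \<bullet> \<nu> j\<bar> \<le> \<beta>\<^sup>2 / 4 * norm (x + u *\<^sub>R v - p)"
      by (rule near[OF j p(1) u(3)])
    then have "\<bar>u - t\<bar> * \<bar>v \<bullet> \<nu> j\<bar> \<le> \<bar>u - t\<bar> * (\<beta>\<^sup>2 / 4 * norm v)"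
      unfolding d by (simp add: abs_mult mult.left_commute)
    moreover have "\<beta>\<^sup>2 / 4 * norm v < \<beta> * norm v" using flatness(3) v(1) by simp
    then have "\<beta>\<^sup>2 / 4 * norm v < \<bar>v \<bullet> \<nu> j\<bar>" using v(3) by simp
    ultimately have "\<bar>u - t\<bar> = 0" by (metis abs_ge_zero less_eq_real_def mult_le_cancel_left_pos not_le)
    then show ?thesis by (simp add: p_def)
  qed
  have seg: "closed_segment x (x + v) \<inter> S = {p}"
  proof (intro equalityI subsetI)
    fix q assume "q \<in> closed_segment x (x + v) \<inter> S"
    then obtain u where "0 \<le> u" "u \<le> 1" "q = x + u *\<^sub>R v" "q \<in> S"
      by (auto simp: in_segment algebra_simps)
    then show "q \<in> {p}" using uniq by auto
  next
    fix q assume "q \<in> {p}"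
    moreover have "p \<in> closed_segment x (x + v)"
      unfolding in_segment using t by (intro exI[of _ t]) (auto simp: p_def algebra_simps)
    ultimately show "q \<in> closed_segment x (x + v) \<inter> S" using p by auto
  qed
  have "v \<notin> tangent_space S p"
  proof
    assume "v \<in> tangent_space S p"
    then have "\<bar>v \<bullet> \<nu> j\<bar> \<le> \<beta>\<^sup>2 / 4 * norm v" by (rule tang[OF j p(1)])
    moreover have "\<beta>\<^sup>2 / 4 * norm v < \<beta> * norm v" using flatness(3) v(1) by simp
    ultimately show False using v(3) by linarith
  qed
  moreover have "{p} - {x, x + v} = {p}" using p(2) out by auto
  ultimately show "(x, x + v) \<in> crossing_pairs S" by (simp add: crossing_pairs_def seg)
  show "i = j" if i: "i < N" "x \<in> sweep (E i) v" for i
  proof (rule ccontr)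
    assume "i \<noteq> j"
    obtain u where u: "0 \<le> u" "u \<le> 1" "x + u *\<^sub>R v \<in> E i" using i by (auto simp: mem_sweep_iff)
    then have "x + u *\<^sub>R v \<in> S" using i S_eq by auto
    then have "p \<in> E i" using uniq u by auto
    then show False using p(1) disj i(1) j \<open>i \<noteq> j\<close> by (auto simp: disjoint_family_on_def)
  qed
qed

text \<open>
  On the nearly tangential part of the ball the integrand is at most 1, so omitting this part loses at
  most the volume of a strip.
\<close>

lemma nn_integral_ball_transversal_ge:
  assumes j: "j < N"
  shows "ennreal (2 * unit_ball_vol (real (DIM('a) - 1)) / (real DIM('a) + 1) * (1 - (real DIM('a) + 1) * \<beta>)) \<le>
    (\<integral>\<^sup>+v. ennreal (\<bar>v \<bullet> \<nu> j\<bar> * indicator {v. \<beta> * norm v \<le> \<bar>v \<bullet> \<nu> j\<bar>} v) * indicator (ball 0 1) v \<partial>lborel)"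
    (is "_ \<le> ?I")
proof -
  let ?V = "unit_ball_vol (real (DIM('a) - 1))"
  have V: "0 < ?V" by simp
  have "ennreal (2 * ?V / (real DIM('a) + 1)) = (\<integral>\<^sup>+v. ennreal \<bar>v \<bullet> \<nu> j\<bar> * indicator (ball 0 1) v \<partial>lborel)"
    using nn_integral_ball_abs_inner[OF nu[OF j] dim] dim by (simp add: of_nat_diff add.commute)
  also have "\<dots> \<le> (\<integral>\<^sup>+v. ennreal (\<bar>v \<bullet> \<nu> j\<bar> * indicator {v. \<beta> * norm v \<le> \<bar>v \<bullet> \<nu> j\<bar>} v) * indicator (ball 0 1) v
      + indicator {v \<in> ball 0 1. \<bar>v \<bullet> \<nu> j\<bar> \<le> \<beta>} v \<partial>lborel)"
  proof (intro nn_integral_mono)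
    fix v :: 'a
    show "ennreal \<bar>v \<bullet> \<nu> j\<bar> * indicator (ball 0 1) v \<le>
      ennreal (\<bar>v \<bullet> \<nu> j\<bar> * indicator {v. \<beta> * norm v \<le> \<bar>v \<bullet> \<nu> j\<bar>} v) * indicator (ball 0 1) v
      + indicator {v \<in> ball 0 1. \<bar>v \<bullet> \<nu> j\<bar> \<le> \<beta>} v"
    proof (cases "v \<in> ball 0 1 \<and> \<not> \<beta> * norm v \<le> \<bar>v \<bullet> \<nu> j\<bar>")
      case True
      then have "\<bar>v \<bullet> \<nu> j\<bar> < \<beta> * norm v" "\<beta> * norm v \<le> \<beta> * 1" using \<beta> by (auto intro!: mult_left_mono)
      then have "\<bar>v \<bullet> \<nu> j\<bar> \<le> \<beta>" by linarith
      moreover from this have "ennreal \<bar>v \<bullet> \<nu> j\<bar> \<le> 1" using \<beta> by (simp flip: ennreal_1 add: ennreal_le_iff)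
      ultimately show ?thesis using True by simp
    next
      case False
      then show ?thesis by (cases "v \<in> ball 0 1") auto
    qed
  qed
  also have "\<dots> = ?I + emeasure lborel {v \<in> ball 0 1. \<bar>v \<bullet> \<nu> j\<bar> \<le> \<beta>}"
    by (subst nn_integral_add) simp_all
  also have "\<dots> \<le> ?I + ennreal (2 * \<beta> * ?V)"
    using emeasure_ball_strip_le[OF nu[OF j], of \<beta>] \<beta> dim by (intro add_left_mono) (simp add: of_nat_diff)
  finally have *: "ennreal (2 * ?V / (real DIM('a) + 1)) \<le> ?I + ennreal (2 * \<beta> * ?V)" .
  have eq: "2 * ?V / (real DIM('a) + 1) * (1 - (real DIM('a) + 1) * \<beta>) = 2 * ?V / (real DIM('a) + 1) - 2 * \<beta> * ?V"
    by (simp add: field_simps)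
  show ?thesis
  proof (cases ?I)
    case (real r)
    have "ennreal (2 * ?V / (real DIM('a) + 1)) \<le> ennreal (r + 2 * \<beta> * ?V)"
      using * real \<beta> V by (subst ennreal_plus) auto
    then have "2 * ?V / (real DIM('a) + 1) \<le> r + 2 * \<beta> * ?V"
      using real \<beta> V by (subst (asm) ennreal_le_iff) auto
    then show ?thesis unfolding eq real(2) by (intro ennreal_leI) linarith
  qed simp
qed

text \<open>
  Up to a null set of starting points, the transversal sweeps of different pieces are disjoint
  sets of crossing pairs that start in \<open>\<Omega>\<close>.
\<close>

lemma weighted_area_ge:
  assumes \<Omega>: "open \<Omega>" and s: "0 < s" "s < 1/2" and inside: "\<And>p. p \<in> S \<Longrightarrow> ball p \<delta> \<subseteq> \<Omega>"
  shows "total_shadow * ennreal (\<delta> powr (1 - 2 * s) * ((1 - \<beta>) ^ DIM('a) * (1 - (real DIM('a) + 1) * \<beta>)))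
    \<le> ennreal (1 - 2 * s) * frac_area s S \<Omega>"
proof -
  let ?V = "unit_ball_vol (real (DIM('a) - 1))"
  let ?R = "\<lambda>j. {z :: 'a \<times> 'a. fst z \<in> sweep (E j) (snd z)}"
  let ?K = "\<lambda>v::'a. ennreal (radial_kernel s v)"
  let ?T = "\<lambda>j. {v. \<beta> * norm v \<le> \<bar>v \<bullet> \<nu> j\<bar>}"
  let ?P = "\<lambda>j v. \<bar>v \<bullet> \<nu> j\<bar> * indicator (?T j) v"
  define h :: "nat \<Rightarrow> 'a \<times> 'a \<Rightarrow> ennreal" where
    "h j z = indicator (ball 0 \<delta> - {0}) (snd z) * indicator (?T j) (snd z) *
      (indicator (?R j) z * (indicator (- S) (fst z) * indicator (- S) (snd z + fst z)))" for j z
  define g where "g z = ?K (snd z) * (\<Sum>j<N. h j z)" for z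
  have [measurable]: "- S \<in> sets borel" using compact_imp_closed[OF S] by (auto simp: open_Compl)
  have [measurable]: "ball 0 \<delta> - {0::'a} \<in> sets borel" by auto
  have R: "(\<lambda>z. indicator (?R j) z :: ennreal) \<in> borel_measurable borel" if "j < N" for j
    using sweep_relation_borel[OF sc[OF that]] by simp
  have h: "h j \<in> borel_measurable borel" if "j < N" for j
    unfolding h_def
    by (intro borel_measurable_times_ennreal R[OF that] borel_measurable_coordinates borel_measurable_indicator) measurable
  have Km: "?K \<in> borel_measurable borel" by measurable
  have g: "g \<in> borel_measurable borel"
    unfolding g_def
    by (intro borel_measurable_times_ennreal borel_measurable_sum h borel_measurable_coordinates Km) auto
  have le: "g (fst z, snd z - fst z) \<le> ?K (snd z - fst z) * (ennreal (max (indicator \<Omega> (fst z)) (indicator \<Omega> (snd z))) * indicator (crossing_pairs S) z)" for z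
  proof -
    obtain x y where z: "z = (x, y)" by (cases z)
    define v where "v = y - x"
    have y: "y = x + v" by (simp add: v_def)
    show ?thesis
    proof (cases "\<exists>j<N. h j (x, v) \<noteq> 0")
      case False
      then show ?thesis by (simp add: g_def z y)
    next
      case True
      then obtain j where j: "j < N" "h j (x, v) \<noteq> 0" by blast
      then have v: "v \<noteq> 0" "norm v < \<delta>" "\<beta> * norm v \<le> \<bar>v \<bullet> \<nu> j\<bar>" "x \<in> sweep (E j) v" "x \<notin> S" "x + v \<notin> S"
        by (auto simp: h_def indicator_def add.commute split: if_splits)
      note cross = transversal_sweep_crosses[OF j(1) v]
      have "h i (x, v) = 0" if "i < N" "i \<noteq> j" for i
      proof -
        have "x \<notin> sweep (E i) v" using cross(2)[OF that(1)] that(2) by blast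
        then show ?thesis by (simp add: h_def)
      qed
      then have "(\<Sum>i<N. h i (x, v)) = (\<Sum>i<N. if i = j then h j (x, v) else 0)"
        by (intro sum.cong) auto
      also have "\<dots> = h j (x, v)" using j(1) by simp
      also have "\<dots> \<le> 1" by (auto simp: h_def indicator_def)
      finally have h1: "(\<Sum>i<N. h i (x, v)) \<le> 1" .
      obtain t where t: "0 \<le> t" "t \<le> 1" "x + t *\<^sub>R v \<in> E j" using v(4) by (auto simp: mem_sweep_iff)
      have "t * norm v \<le> 1 * norm v" using t by (intro mult_right_mono) auto
      then have "x \<in> ball (x + t *\<^sub>R v) \<delta>" using v(2) t by (simp add: dist_norm)
      moreover have "x + t *\<^sub>R v \<in> S" using t j(1) S_eq by blast
      ultimately have "x \<in> \<Omega>" using inside by blast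
      moreover have "?K v * (\<Sum>i<N. h i (x, v)) \<le> ?K v * 1" by (rule mult_left_mono[OF h1]) simp
      ultimately show ?thesis using cross(1) unfolding g_def z y by simp
    qed
  qed
  have inner: "(\<Sum>j<N. projected_area (\<nu> j) (E j) * (ennreal ((1 - \<beta>) ^ DIM('a)) * (?K v * (ennreal (?P j v) * indicator (ball 0 \<delta>) v))))
    \<le> (\<integral>\<^sup>+x. g (x, v) \<partial>lborel)" for v
  proof (cases "v = 0 \<or> v \<notin> ball 0 \<delta>")
    case True
    then show ?thesis by auto
  next
    case False
    then have v: "v \<noteq> 0" "v \<in> ball 0 \<delta>" by auto
    have Rs: "sweep (E j) v \<in> sets borel" if "j < N" for j using that by (intro sigma_compact_borel sigma_compact_sweep sc)
    have out: "AE x in lborel. x \<notin> S \<and> v + x \<notin> S"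
    proof -
      have Sb[measurable]: "S \<in> sets borel" using S by (rule borel_compact)
      have "(\<integral>\<^sup>+x. indicator S (v + x) \<partial>lborel) = (\<integral>\<^sup>+x. indicator S x \<partial>(lborel :: 'a measure))"
        using Sb by (intro nn_integral_lborel_translation[of "indicator S"]) simp
      also have "\<dots> = 0" using null_S Sb by simp
      finally have "AE x in lborel. (indicator S (v + x) :: ennreal) = 0"
        by (subst (asm) nn_integral_0_iff_AE) measurable
      moreover have "AE x in lborel. x \<notin> S" using null_S Sb by (intro AE_not_in) auto
      ultimately show ?thesis by eventually_elim (auto simp: indicator_def split: if_splits)
    qed
    have m: "(\<integral>\<^sup>+x. h j (x, v) \<partial>lborel) = indicator (?T j) v * emeasure lborel (sweep (E j) v)" if "j < N" for j
    proof -
      have "(\<integral>\<^sup>+x. h j (x, v) \<partial>lborel) = (\<integral>\<^sup>+x. indicator (?T j) v * indicator (sweep (E j) v) x \<partial>lborel)"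
        by (rule nn_integral_cong_AE, use out in eventually_elim) (use v in \<open>auto simp: h_def indicator_def\<close>)
      then show ?thesis using Rs[OF that] by (simp add: nn_integral_cmult_indicator)
    qed
    have hm: "(\<lambda>x. h j (x, v)) \<in> borel_measurable borel" if "j < N" for j
      by (rule measurable_compose[OF _ h[OF that]]) (intro borel_measurable_continuous_onI continuous_intros)
    have "(\<Sum>j<N. projected_area (\<nu> j) (E j) * (ennreal ((1 - \<beta>) ^ DIM('a)) * (?K v * (ennreal (?P j v) * indicator (ball 0 \<delta>) v))))
      \<le> (\<Sum>j<N. ?K v * (indicator (?T j) v * emeasure lborel (sweep (E j) v)))"
    proof (rule sum_mono)
      fix j assume "j \<in> {..<N}"
      then have j: "j < N" by simp
      show "projected_area (\<nu> j) (E j) * (ennreal ((1 - \<beta>) ^ DIM('a)) * (?K v * (ennreal (?P j v) * indicator (ball 0 \<delta>) v)))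
        \<le> ?K v * (indicator (?T j) v * emeasure lborel (sweep (E j) v))"
      proof (cases "\<beta> * norm v \<le> \<bar>v \<bullet> \<nu> j\<bar>")
        case True
        have "ennreal ((1 - \<beta>) ^ DIM('a)) * (ennreal \<bar>v \<bullet> \<nu> j\<bar> * projected_area (\<nu> j) (E j)) \<le> emeasure lborel (sweep (E j) v)"
          using \<beta> by (intro sweep_flat_bounds(2)[OF nu[OF j] fl[OF j] flatness(1,2) sc[OF j] _ _ flatness(4) _ v(1) True]) auto
        then have "?K v * (ennreal ((1 - \<beta>) ^ DIM('a)) * (ennreal \<bar>v \<bullet> \<nu> j\<bar> * projected_area (\<nu> j) (E j))) \<le> ?K v * emeasure lborel (sweep (E j) v)"
          by (rule mult_left_mono) simp
        then show ?thesis using True v by (simp add: ac_simps)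
      qed simp
    qed
    also have "\<dots> = ?K v * (\<Sum>j<N. (\<integral>\<^sup>+x. h j (x, v) \<partial>lborel))"
      unfolding sum_distrib_left by (intro sum.cong refl arg_cong2[where f="(*)"]) (simp only: m lessThan_iff)
    also have "\<dots> = ?K v * (\<integral>\<^sup>+x. (\<Sum>j<N. h j (x, v)) \<partial>lborel)"
      using hm by (subst nn_integral_sum) auto
    also have "\<dots> = (\<integral>\<^sup>+x. g (x, v) \<partial>lborel)"
      unfolding g_def using hm by (subst nn_integral_cmult[symmetric]) auto
    finally show ?thesis .
  qed
  have Pm[measurable]: "?P j \<in> borel_measurable borel" for j by measurable
  have Phom: "?P j (t *\<^sub>R v) = t * ?P j v" if "0 < t" for t j v
    using that by (simp add: indicator_def abs_mult)
  have "total_shadow * ennreal (\<delta> powr (1 - 2 * s) * ((1 - \<beta>) ^ DIM('a) * (1 - (real DIM('a) + 1) * \<beta>)))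
    = (\<Sum>j<N. projected_area (\<nu> j) (E j) * (ennreal ((1 - \<beta>) ^ DIM('a)) * ennreal (\<delta> powr (1 - 2 * s) * (1 - (real DIM('a) + 1) * \<beta>))))"
  proof -
    have "ennreal (\<delta> powr (1 - 2 * s) * ((1 - \<beta>) ^ DIM('a) * (1 - (real DIM('a) + 1) * \<beta>)))
       = ennreal ((1 - \<beta>) ^ DIM('a)) * ennreal (\<delta> powr (1 - 2 * s) * (1 - (real DIM('a) + 1) * \<beta>))"
      using \<beta> by (subst ennreal_mult'[symmetric]) (auto simp: mult.left_commute)
    then show ?thesis by (simp add: total_shadow_def sum_distrib_right)
  qed
  also have "\<dots> \<le> (\<Sum>j<N. projected_area (\<nu> j) (E j) * (ennreal ((1 - \<beta>) ^ DIM('a)) *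
      (ennreal (1 - 2 * s) * (ennreal (1/2) * (\<integral>\<^sup>+v. ?K v * (ennreal (?P j v) * indicator (ball 0 \<delta>) v) \<partial>lborel)))))"
  proof (intro sum_mono mult_left_mono)
    fix j assume "j \<in> {..<N}"
    then have j: "j < N" by simp
    let ?w = "2 * ?V / (real DIM('a) + 1) * (1 - (real DIM('a) + 1) * \<beta>)"
    have "\<delta> powr (1 - 2 * s) * (1 - (real DIM('a) + 1) * \<beta>) = \<delta> powr (1 - 2 * s) * (real DIM('a) + 1) / (2 * ?V) * ?w"
    proof -
      have "D * c = D * d / (2 * V) * (2 * V / d * c)" if "0 < d" "0 < V" for d V c D :: real using that by simp
      then show ?thesis by (simp only: unit_ball_vol_codim_pos)
    qed
    then have "ennreal (\<delta> powr (1 - 2 * s) * (1 - (real DIM('a) + 1) * \<beta>)) = ennreal (\<delta> powr (1 - 2 * s) * (real DIM('a) + 1) / (2 * ?V)) * ennreal ?w"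
      by (simp only:) (rule ennreal_mult', simp)
    also have "\<dots> \<le> ennreal (\<delta> powr (1 - 2 * s) * (real DIM('a) + 1) / (2 * ?V)) * (\<integral>\<^sup>+v. ennreal (?P j v) * indicator (ball 0 1) v \<partial>lborel)"
      by (intro mult_left_mono nn_integral_ball_transversal_ge j) simp
    also have "\<dots> = ennreal (1 - 2 * s) * (ennreal (1/2) * (\<integral>\<^sup>+v. ?K v * (ennreal (?P j v) * indicator (ball 0 \<delta>) v) \<partial>lborel))"
      by (rule nn_integral_homogeneous_radial_kernel[OF Pm Phom s \<delta>, symmetric])
    finally show "ennreal (\<delta> powr (1 - 2 * s) * (1 - (real DIM('a) + 1) * \<beta>)) \<le> \<dots>" .
  qed simp_all
  also have "\<dots> = ennreal (1 - 2 * s) * (ennreal (1/2) * (\<integral>\<^sup>+v. (\<Sum>j<N. projected_area (\<nu> j) (E j) * (ennreal ((1 - \<beta>) ^ DIM('a)) * (?K v * (ennreal (?P j v) * indicator (ball 0 \<delta>) v)))) \<partial>lborel))"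
  proof -
    let ?G = "\<lambda>j v. ?K v * (ennreal (?P j v) * indicator (ball 0 \<delta>) v)"
    have G: "?G j \<in> borel_measurable lborel" for j by measurable
    have "(\<integral>\<^sup>+v. projected_area (\<nu> j) (E j) * (ennreal ((1 - \<beta>) ^ DIM('a)) * ?G j v) \<partial>lborel)
      = projected_area (\<nu> j) (E j) * (ennreal ((1 - \<beta>) ^ DIM('a)) * (\<integral>\<^sup>+v. ?G j v \<partial>lborel))" for j
      using G by (subst nn_integral_cmult, (intro borel_measurable_times_ennreal, auto)[1], subst nn_integral_cmult) auto
    then have "(\<integral>\<^sup>+v. (\<Sum>j<N. projected_area (\<nu> j) (E j) * (ennreal ((1 - \<beta>) ^ DIM('a)) * ?G j v)) \<partial>lborel)
      = (\<Sum>j<N. projected_area (\<nu> j) (E j) * (ennreal ((1 - \<beta>) ^ DIM('a)) * (\<integral>\<^sup>+v. ?G j v \<partial>lborel)))"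
      using G by (subst nn_integral_sum) (auto intro!: borel_measurable_times_ennreal)
    then show ?thesis by (simp only: sum_distrib_left ac_simps)
  qed
  also have "\<dots> \<le> ennreal (1 - 2 * s) * (ennreal (1/2) * (\<integral>\<^sup>+v. (\<integral>\<^sup>+x. g (x, v) \<partial>lborel) \<partial>lborel))"
    by (intro mult_left_mono nn_integral_mono inner) simp_all
  also have "(\<integral>\<^sup>+v. (\<integral>\<^sup>+x. g (x, v) \<partial>lborel) \<partial>lborel) = (\<integral>\<^sup>+z. g (fst z, snd z - fst z) \<partial>lebesgue)"
    by (rule nn_integral_displacement[OF g, symmetric])
  also have "ennreal (1 - 2 * s) * (ennreal (1/2) * (\<integral>\<^sup>+z. g (fst z, snd z - fst z) \<partial>lebesgue)) \<le> ennreal (1 - 2 * s) * frac_area s S \<Omega>"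
    unfolding frac_area_integrand by (intro mult_left_mono nn_integral_mono le) simp_all
  finally show ?thesis .
qed

end

section \<open>The limit\<close>

lemma flat_partition_exists:
  fixes S \<Omega> :: "'a::euclidean_space set"
  assumes dim: "2 \<le> DIM('a)" and S: "compact S" "C1_hypersurface S" and \<Omega>: "open \<Omega>" "S \<subseteq> \<Omega>"
    and \<beta>: "0 < \<beta>" "\<beta> < 1"
  shows "\<exists>N E \<nu> \<delta>. flat_partition S N E \<nu> \<beta> \<delta> \<and> (\<forall>p\<in>S. ball p \<delta> \<subseteq> \<Omega>)"
proof (rule C1_hypersurface_flat_partition[OF S, of "\<beta>\<^sup>2 / 4"])
  show "0 < \<beta>\<^sup>2 / 4" using \<beta> by simp
  fix \<delta>0 :: real and N :: nat and E :: "nat \<Rightarrow> 'a set" and \<nu> :: "nat \<Rightarrow> 'a"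
  assume part: "0 < \<delta>0" "S = (\<Union>j<N. E j)" "disjoint_family_on E {..<N}"
    "\<And>j. j < N \<Longrightarrow> norm (\<nu> j) = 1" "\<And>j. j < N \<Longrightarrow> sigma_compact (E j)" "\<And>j. j < N \<Longrightarrow> flat (\<nu> j) (\<beta>\<^sup>2 / 4) (E j)"
    "\<And>j p q. j < N \<Longrightarrow> p \<in> E j \<Longrightarrow> q \<in> S \<Longrightarrow> norm (q - p) < \<delta>0 \<Longrightarrow> \<bar>(q - p) \<bullet> \<nu> j\<bar> \<le> \<beta>\<^sup>2 / 4 * norm (q - p)"
    "\<And>j p v. j < N \<Longrightarrow> p \<in> E j \<Longrightarrow> v \<in> tangent_space S p \<Longrightarrow> \<bar>v \<bullet> \<nu> j\<bar> \<le> \<beta>\<^sup>2 / 4 * norm v"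
  obtain \<delta>1 where \<delta>1: "0 < \<delta>1" "(\<Union>p\<in>S. ball p \<delta>1) \<subseteq> \<Omega>"
    using compact_subset_open_imp_ball_epsilon_subset[OF S(1) \<Omega>] by blast
  have "flat_partition S N E \<nu> \<beta> (min \<delta>0 \<delta>1)"
  proof
    show "S = (\<Union>j<N. E j)" by (rule part(2))
    show "\<bar>(q - p) \<bullet> \<nu> j\<bar> \<le> \<beta>\<^sup>2 / 4 * norm (q - p)"
      if "j < N" "p \<in> E j" "q \<in> S" "norm (q - p) < min \<delta>0 \<delta>1" for j p q
      using that by (intro part(7)) auto
    show "0 < min \<delta>0 \<delta>1" using part(1) \<delta>1(1) by simp
  qed (fact dim \<beta> S(1) part)+
  moreover have "ball p (min \<delta>0 \<delta>1) \<subseteq> \<Omega>" if "p \<in> S" for p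
    using \<delta>1(2) that by force
  ultimately show ?thesis by blast
qed

text \<open>
  For a fixed partition the bounds hold with errors that depend on \<open>\<beta>\<close> only as \<open>s\<close> tends to \<open>1 / 2\<close>:
  then \<open>(1 - 2 s)\<close> times the far field tends to 0 and \<open>\<delta> powr (1 - 2 s)\<close> tends to 1.
\<close>

lemma weighted_area_eventually_close:
  fixes S \<Omega> :: "'a::euclidean_space set"
  assumes dim: "2 \<le> DIM('a)" and S: "compact S" "C1_hypersurface S" and \<Omega>: "open \<Omega>" "bounded \<Omega>" "S \<subseteq> \<Omega>"
    and \<beta>: "0 < \<beta>" "(real DIM('a) + 1) * \<beta> < 1"
    and h: "hausdorff_measure (DIM('a) - 1) S = ennreal h" "0 \<le> h"
  shows "\<forall>\<^sub>F s in at_left (1/2).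
      ennreal (1 - 2 * s) * frac_area s S \<Omega> \<le> ennreal (h * ((1 + \<beta>) ^ DIM('a) + 3 ^ DIM('a) * (real DIM('a) + 1) * \<beta>) + \<beta>) \<and>
      ennreal (h / (1 + \<beta>) ^ DIM('a) * ((1 - \<beta>) * ((1 - \<beta>) ^ DIM('a) * (1 - (real DIM('a) + 1) * \<beta>))))
        \<le> ennreal (1 - 2 * s) * frac_area s S \<Omega>"
proof -
  let ?c = "(1 + \<beta>) ^ DIM('a) + 3 ^ DIM('a) * (real DIM('a) + 1) * \<beta>"
  let ?l = "(1 - \<beta>) ^ DIM('a) * (1 - (real DIM('a) + 1) * \<beta>)"
  have "1 * \<beta> \<le> (real DIM('a) + 1) * \<beta>" using \<beta> by (intro mult_right_mono) auto
  then have \<beta>1: "\<beta> < 1" using \<beta>(2) by linarith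
  obtain N E \<nu> \<delta> where P: "flat_partition S N E \<nu> \<beta> \<delta>" and inside: "\<And>p. p \<in> S \<Longrightarrow> ball p \<delta> \<subseteq> \<Omega>"
    using flat_partition_exists[OF dim S \<Omega>(1,3) \<beta>(1) \<beta>1] by blast
  interpret P: flat_partition S N E \<nu> \<beta> \<delta> by (rule P)
  obtain L where L: "P.total_shadow = ennreal L" "0 \<le> L" using P.total_shadow_finite by (cases P.total_shadow) auto
  have Lh: "L \<le> h" using P.total_shadow_le_hausdorff h L by simp
  have "ennreal h \<le> ennreal ((1 + \<beta>) ^ DIM('a) * L)"
    using P.hausdorff_le_total_shadow h(1) L \<beta> by (simp add: ennreal_mult)
  then have hL: "h / (1 + \<beta>) ^ DIM('a) \<le> L"
    using L \<beta> by (subst (asm) ennreal_le_iff) (auto simp: field_simps)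
  obtain f where f: "far_field \<Omega> = ennreal f" "0 \<le> f" using far_field_finite[OF \<Omega>(2)] by (cases "far_field \<Omega>") auto
  have "((\<lambda>s. (1 - 2 * s) * f) \<longlongrightarrow> (1 - 2 * (1/2)) * f) (at_left (1/2 :: real))"
    by (intro tendsto_intros)
  then have e1: "\<forall>\<^sub>F s in at_left (1/2). (1 - 2 * s) * f < \<beta>"
    using \<beta>(1) by (intro order_tendstoD(2)[where y="(1 - 2 * (1/2)) * f"]) auto
  have "((\<lambda>s. \<delta> powr (1 - 2 * s)) \<longlongrightarrow> \<delta> powr (1 - 2 * (1/2))) (at_left (1/2 :: real))"
    using P.\<delta> by (intro tendsto_intros) auto
  then have e2: "\<forall>\<^sub>F s in at_left (1/2). 1 - \<beta> < \<delta> powr (1 - 2 * s)"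
    using \<beta>(1) P.\<delta> by (intro order_tendstoD(1)[where y="\<delta> powr (1 - 2 * (1/2))"]) auto
  have e3: "\<forall>\<^sub>F s in at_left (1/2::real). s \<in> {1/4<..<1/2}"
    by (rule eventually_at_leftI[of "1/4"]) auto
  show ?thesis
    using e1 e2 e3
  proof eventually_elim
    case (elim s)
    then have s: "1/4 \<le> s" "s < 1/2" "0 < s" by auto
    have c: "0 \<le> ?c" using \<beta> by simp
    have l: "0 \<le> ?l" using \<beta> \<beta>1 by simp
    have "ennreal (1 - 2 * s) * frac_area s S \<Omega> \<le> ennreal L * ennreal ?c + ennreal (1 - 2 * s) * ennreal f"
      using P.weighted_area_le[OF \<Omega>(1) s(1,2)] L f by simp
    also have "\<dots> = ennreal (L * ?c + (1 - 2 * s) * f)"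
      using L f c s by (subst ennreal_plus) (auto simp: ennreal_mult)
    also have "\<dots> \<le> ennreal (h * ?c + \<beta>)"
      using elim(1) mult_right_mono[OF Lh c] by (intro ennreal_leI) linarith
    finally have up: "ennreal (1 - 2 * s) * frac_area s S \<Omega> \<le> ennreal (h * ?c + \<beta>)" .
    have "h / (1 + \<beta>) ^ DIM('a) * ((1 - \<beta>) * ?l) \<le> L * (\<delta> powr (1 - 2 * s) * ?l)"
      using hL elim(2) l L \<beta>1 by (intro mult_mono mult_right_mono) auto
    then have "ennreal (h / (1 + \<beta>) ^ DIM('a) * ((1 - \<beta>) * ?l)) \<le> ennreal (L * (\<delta> powr (1 - 2 * s) * ?l))"
      by (rule ennreal_leI)
    also have "\<dots> = P.total_shadow * ennreal (\<delta> powr (1 - 2 * s) * ?l)"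
      using L l by (simp add: ennreal_mult)
    also have "\<dots> \<le> ennreal (1 - 2 * s) * frac_area s S \<Omega>"
      by (rule P.weighted_area_ge[OF \<Omega>(1) s(3,2) inside])
    finally show ?case using up by blast
  qed
qed

text \<open>
  Both bounds tend to the Hausdorff measure as \<open>\<beta>\<close> tends to 0 from the right, so any strict bound
  for the Hausdorff measure is eventually a bound for the weighted nonlocal area.
\<close>

theorem nonlocal_area_tendsto_hausdorff:
  fixes S \<Omega> :: "'a::euclidean_space set"
  assumes dim: "2 \<le> DIM('a)" and S: "compact S" "C1_hypersurface S" and \<Omega>: "open \<Omega>" "bounded \<Omega>" "S \<subseteq> \<Omega>"
  shows "((\<lambda>s. ennreal (1 - 2 * s) * frac_area s S \<Omega>) \<longlongrightarrow> hausdorff_measure (DIM('a) - 1) S) (at_left (1/2))"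
proof -
  obtain N E \<nu> \<delta> where P: "flat_partition S N E \<nu> (1/2) \<delta>"
    using flat_partition_exists[OF dim S \<Omega>(1,3), of "1/2"] by auto
  interpret P: flat_partition S N E \<nu> "1/2" \<delta> by (rule P)
  have "hausdorff_measure (DIM('a) - 1) S < top"
    using P.hausdorff_le_total_shadow P.total_shadow_finite by (auto intro: le_less_trans simp: ennreal_mult_less_top)
  then obtain h where h: "hausdorff_measure (DIM('a) - 1) S = ennreal h" "0 \<le> h"
    by (cases "hausdorff_measure (DIM('a) - 1) S") auto
  let ?U = "\<lambda>\<beta>. h * ((1 + \<beta>) ^ DIM('a) + 3 ^ DIM('a) * (real DIM('a) + 1) * \<beta>) + \<beta>"
  let ?L = "\<lambda>\<beta>. h / (1 + \<beta>) ^ DIM('a) * ((1 - \<beta>) * ((1 - \<beta>) ^ DIM('a) * (1 - (real DIM('a) + 1) * \<beta>)))"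
  have "(?U \<longlongrightarrow> ?U 0) (at_right 0)" by (intro tendsto_intros)
  then have U: "((\<lambda>\<beta>. ennreal (?U \<beta>)) \<longlongrightarrow> ennreal h) (at_right 0)" by (intro tendsto_ennrealI) simp
  have "(?L \<longlongrightarrow> ?L 0) (at_right 0)" by (intro tendsto_intros) auto
  then have L: "((\<lambda>\<beta>. ennreal (?L \<beta>)) \<longlongrightarrow> ennreal h) (at_right 0)" by (intro tendsto_ennrealI) simp
  have "((\<lambda>\<beta>. (real DIM('a) + 1) * \<beta>) \<longlongrightarrow> (real DIM('a) + 1) * 0) (at_right 0)" by (intro tendsto_intros)
  then have "\<forall>\<^sub>F \<beta> in at_right 0. (real DIM('a) + 1) * \<beta> < 1" by (intro order_tendstoD(2)) auto
  then have small: "\<forall>\<^sub>F \<beta> in at_right 0. 0 < \<beta> \<and> (real DIM('a) + 1) * \<beta> < 1"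
    using eventually_at_right_less[of "0::real"] by eventually_elim simp
  note close = weighted_area_eventually_close[OF dim S \<Omega> _ _ h]
  show ?thesis unfolding h(1)
  proof (rule order_tendstoI)
    fix l assume "l < ennreal h"
    then have "\<forall>\<^sub>F \<beta> in at_right 0. l < ennreal (?L \<beta>)" by (rule order_tendstoD(1)[OF L])
    with small have "\<forall>\<^sub>F \<beta> in at_right 0. (0 < \<beta> \<and> (real DIM('a) + 1) * \<beta> < 1) \<and> l < ennreal (?L \<beta>)" by eventually_elim simp
    then obtain \<beta> where \<beta>: "0 < \<beta>" "(real DIM('a) + 1) * \<beta> < 1" "l < ennreal (?L \<beta>)"
      using eventually_happens'[OF trivial_limit_at_right_real] by blast
    show "\<forall>\<^sub>F s in at_left (1/2). l < ennreal (1 - 2 * s) * frac_area s S \<Omega>"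
      using close[OF \<beta>(1,2)] by eventually_elim (use \<beta>(3) in \<open>auto intro: less_le_trans\<close>)
  next
    fix u assume "ennreal h < u"
    then have "\<forall>\<^sub>F \<beta> in at_right 0. ennreal (?U \<beta>) < u" by (rule order_tendstoD(2)[OF U])
    with small have "\<forall>\<^sub>F \<beta> in at_right 0. (0 < \<beta> \<and> (real DIM('a) + 1) * \<beta> < 1) \<and> ennreal (?U \<beta>) < u" by eventually_elim simp
    then obtain \<beta> where \<beta>: "0 < \<beta>" "(real DIM('a) + 1) * \<beta> < 1" "ennreal (?U \<beta>) < u"
      using eventually_happens'[OF trivial_limit_at_right_real] by blast
    show "\<forall>\<^sub>F s in at_left (1/2). ennreal (1 - 2 * s) * frac_area s S \<Omega> < u"
      using close[OF \<beta>(1,2)] by eventually_elim (use \<beta>(3) in \<open>auto intro: le_less_trans\<close>)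
  qed
qed

theorem theorem3p3:
  fixes S \<Omega> :: "(real ^ 'n) set"
  assumes "CARD('n) \<ge> 2"
    and "compact S" and "C1_hypersurface S"
    and "open \<Omega>" and "bounded \<Omega>" and "S \<subseteq> \<Omega>"
  shows "((\<lambda>s. ennreal (1 - 2 * s) * frac_area s S \<Omega>) \<longlongrightarrow> hausdorff_measure (CARD('n) - 1) S)
           (at_left (1 / 2))"
  using nonlocal_area_tendsto_hausdorff[of S \<Omega>] assms by simp

end
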